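(* Let $(M,F)$ be a balanced complex Finsler manifold with positive Chern-Finsler scalar curvature (i.e. $s_D>0$ everywhere), and let $\rho$ be a smooth real function on $M$. Then the conformal metric $\tilde F(z,v)=e^{\frac12\rho(z)}F(z,v)$ has positive Chern-Finsler total scalar curvature, that is, $$\int_{\mathbb P\tilde M}\tilde s_{\tilde D}\,d\tilde\mu_{\mathbb P\tilde M}>0,$$ where $\tilde s_{\tilde D}$ and $d\tilde\mu_{\mathbb P\tilde M}$ are the Chern-Finsler scalar curvature and the volume form of $\mathbb P\tilde M$ associated to $\tilde F$.
   Context: Basic notation. $M$ is a complex manifold with $n=\dim_{\mathbb C}M\ge 2$. Local holomorphic coordinates $z^1,\dots,z^n$ on $M$ induce coordinates $(z,v)$ on the holomorphic tangent bundle $T^{1,0}M$ via $v=v^\alpha\partial/\partial z^\alpha$; $\tilde M=T^{1,0}M\setminus\{0\}$ is the complement of the zero section. Greek indices run from $1$ to $n$, repeated indices are summed, and barred indices refer to conjugate variables/objects. A complex Finsler metric is a continuous $F:T^{1,0}M\to[0,\infty)$ with $G=F^2$ smooth on $\tilde M$, $F>0$ on $\tilde M$, and $F(z,\zeta v)=|\zeta|F(z,v)$ for $\zeta\in\mathbb C$. Put $G_{\alpha\bar\beta}=\partial^2G/\partial v^\alpha\partial\bar v^\beta$, $G_{\alpha\bar\beta\sigma}=\partial G_{\alpha\bar\beta}/\partial v^\sigma$. $F$ is strongly pseudoconvex if $(G_{\alpha\bar\beta})$ is positive definite on $\tilde M$; $(G^{\bar\beta\alpha})$ is the inverse matrix.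 Put $\dot\partial_\alpha=\partial/\partial v^\alpha$, $\Gamma^\alpha_{;\mu}=G^{\bar\lambda\alpha}\,\partial^2G/\partial\bar v^\lambda\partial z^\mu$, $\delta_\mu=\partial/\partial z^\mu-\Gamma^\alpha_{;\mu}\dot\partial_\alpha$, $\delta_{\bar\mu}=\overline{\delta_\mu}$, $\delta v^\alpha=dv^\alpha+\Gamma^\alpha_{;\beta}dz^\beta$, $\Gamma^\alpha_{\beta;\mu}=G^{\bar\lambda\alpha}\delta_\mu(G_{\beta\bar\lambda})$, $\Gamma^\alpha_{\beta\gamma}=G^{\bar\lambda\alpha}G_{\beta\bar\lambda\gamma}$. Horizontal forms and balanced metrics. $\mathbb P\tilde M=\tilde M/(\mathbb C\setminus\{0\})$ is the projectivized tangent bundle. Put $\omega_{\mathcal V}=\sqrt{-1}\,(\log G)_{\alpha\bar\beta}\,\delta v^\alpha\wedge\delta\bar v^\beta$ (subscripts denote $v$-derivatives), $\omega_{\mathcal H}=\sqrt{-1}\,G_{\alpha\bar\beta}\,dz^\alpha\wedge d\bar z^\beta$, and $d\mu_{\mathbb P\tilde M}=\frac{\omega_{\mathcal V}^{n-1}}{(n-1)!}\wedge\frac{\omega_{\mathcal H}^n}{n!}$. $\mathcal A^{p,q}$ is the space of smooth horizontal $(p,q)$-forms on $\mathbb P\tilde M$: $\varphi=\frac1{p!q!}\varphi_{\alpha_1\cdots\alpha_p\bar\beta_1\cdots\bar\beta_q}dz^{\alpha_1}\wedge\cdots\wedge dz^{\alpha_p}\wedge d\bar z^{\beta_1}\wedge\cdots\wedge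 d\bar z^{\beta_q}$ (coefficients skew-symmetric, invariant under $v\mapsto\zeta v$). The operators $\partial_{\mathcal H}:\mathcal A^{p,q}\to\mathcal A^{p+1,q}$ and $\bar\partial_{\mathcal H}:\mathcal A^{p,q}\to\mathcal A^{p,q+1}$ are given by the usual coordinate formulas for $\partial,\bar\partial$ with $\partial/\partial z^\mu,\partial/\partial\bar z^\nu$ replaced by $\delta_\mu,\delta_{\bar\nu}$. The pointwise inner product is $\langle\varphi,\psi\rangle_{\mathbb P\tilde M}=\frac1{p!q!}\varphi_{\alpha_1\cdots\alpha_p\bar\beta_1\cdots\bar\beta_q}G^{\bar\gamma_1\alpha_1}\cdots G^{\bar\gamma_p\alpha_p}G^{\bar\beta_1\kappa_1}\cdots G^{\bar\beta_q\kappa_q}\overline{\psi_{\gamma_1\cdots\gamma_p\bar\kappa_1\cdots\bar\kappa_q}}$. For $M$ compact, $(\varphi,\psi)_{\mathbb P\tilde M}=\int_{\mathbb P\tilde M}\langle\varphi,\psi\rangle_{\mathbb P\tilde M}\,d\mu_{\mathbb P\tilde M}$, and $\partial_{\mathcal H}^*,\bar\partial_{\mathcal H}^*$ are the formal adjoints of $\partial_{\mathcal H},\bar\partial_{\mathcal H}$. A balanced complex Finsler manifold is a compact strongly pseudoconvex complex Finsler manifold $(M,F)$ with $(\partial_{\mathcal H}^*+\bar\partial_{\mathcal H}^* )\omega_{\mathcal H}=0$. Chern-Finsler scalar curvature. $s_D=G^{\bar\nu\mu}G^{\bar\beta\alpha}\Omega_{\alpha\bar\beta;\mu\bar\nu}$,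 where $\Omega_{\alpha\bar\beta;\mu\bar\nu}=G_{\gamma\bar\beta}\Omega^\gamma_{\alpha;\mu\bar\nu}$ and $\Omega^\alpha_{\beta;\mu\bar\nu}=-\delta_{\bar\nu}(\Gamma^\alpha_{\beta;\mu})-\Gamma^\alpha_{\beta\gamma}\delta_{\bar\nu}(\Gamma^\gamma_{;\mu})$ is the horizontal curvature of the Chern-Finsler connection $D$ with connection forms $\theta^\alpha_\beta=\Gamma^\alpha_{\beta;\mu}dz^\mu+\Gamma^\alpha_{\beta\gamma}\delta v^\gamma$. Tildes denote the same quantities formed from $\tilde F$ in place of $F$. *)

theory Defs
  imports
    "HOL-Analysis.Analysis"
    "HOL-Library.Complex_Order"
    "HOL-Combinatorics.Combinatorics"
begin

text \<open>The order on complex numbers is that of \<open>Complex_Order\<close>: \<open>0 < c\<close> means that \<open>c\<close> is real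
  and positive.\<close>

section \<open>Complex manifolds\<close>

primrec Ck_on :: "nat \<Rightarrow> 'a::real_normed_vector set \<Rightarrow> ('a \<Rightarrow> 'b::real_normed_vector) \<Rightarrow> bool" where
  "Ck_on 0 S f \<longleftrightarrow> continuous_on S f"
| "Ck_on (Suc k) S f \<longleftrightarrow>
     (\<forall>x\<in>S. f differentiable (at x)) \<and> (\<forall>h. Ck_on k S (\<lambda>x. frechet_derivative f (at x) h))"

text \<open>Smoothness on open subsets of finite-dimensional real spaces.\<close>

definition smooth_on :: "'a::real_normed_vector set \<Rightarrow> ('a \<Rightarrow> 'b::real_normed_vector) \<Rightarrow> bool" where
  "smooth_on S f \<longleftrightarrow> (\<forall>k. Ck_on k S f)"

text \<open>A holomorphic map in several variables: smooth with complex-linear differential.\<close>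

definition holomorphic_map_on :: "(complex^'n::finite) set \<Rightarrow> (complex^'n \<Rightarrow> complex^'n) \<Rightarrow> bool" where
  "holomorphic_map_on S f \<longleftrightarrow> smooth_on S f \<and>
     (\<forall>z\<in>S. \<forall>a h. frechet_derivative f (at z) (a *s h) = a *s frechet_derivative f (at z) h)"

text \<open>A chart is a pair (domain, coordinate map); the map is relevant on the domain only.\<close>

type_synonym ('m, 'n) chart = "'m set \<times> ('m \<Rightarrow> complex^'n)"

definition chart_inv :: "('m, 'n) chart \<Rightarrow> complex^'n \<Rightarrow> 'm" where
  "chart_inv c = inv_into (fst c) (snd c)"

definition transition :: "('m, 'n) chart \<Rightarrow> ('m, 'n) chart \<Rightarrow> complex^'n \<Rightarrow> complex^'n" where
  "transition c c' = (\<lambda>z. snd c' (chart_inv c z))"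

definition complex_atlas :: "('m::{t2_space,second_countable_topology}, 'n::finite) chart set \<Rightarrow> bool" where
  "complex_atlas A \<longleftrightarrow>
     (\<Union>c\<in>A. fst c) = UNIV \<and>
     (\<forall>c\<in>A. open (fst c) \<and> open (snd c ` fst c) \<and>
             homeomorphism (fst c) (snd c ` fst c) (snd c) (chart_inv c)) \<and>
     (\<forall>c\<in>A. \<forall>c'\<in>A. holomorphic_map_on (snd c ` (fst c \<inter> fst c')) (transition c c'))"

definition smooth_fun :: "('m, 'n::finite) chart set \<Rightarrow> ('m \<Rightarrow> real) \<Rightarrow> bool" where
  "smooth_fun A f \<longleftrightarrow> (\<forall>c\<in>A. smooth_on (snd c ` fst c) (\<lambda>z. f (chart_inv c z)))"

section \<open>The holomorphic tangent bundle\<close>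

text \<open>A tangent vector at \<open>p\<close> is encoded as the pair of \<open>p\<close> and the family of its component vectors
  with respect to all charts of the atlas around \<open>p\<close>; these are related by the Jacobians of the
  coordinate changes. The family is set to \<open>0\<close> at every other index.\<close>

type_synonym ('m, 'n) tvec = "'m \<times> (('m, 'n) chart \<Rightarrow> complex^'n)"

type_synonym 'n coords = "(complex^'n) \<times> (complex^'n)"

definition jac :: "('m, 'n::finite) chart \<Rightarrow> ('m, 'n) chart \<Rightarrow> 'm \<Rightarrow> complex^'n \<Rightarrow> complex^'n" where
  "jac c c' p = frechet_derivative (transition c c') (at (snd c p))"

definition tangent_bundle :: "('m, 'n::finite) chart set \<Rightarrow> ('m, 'n) tvec set" where
  "tangent_bundle A = {(p, w).
     (\<forall>c\<in>A. \<forall>c'\<in>A. p \<in> fst c \<inter> fst c' \<longrightarrow> w c' = jac c c' p (w c)) \<and>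
     (\<forall>c. c \<notin> A \<or> p \<notin> fst c \<longrightarrow> w c = 0)}"

definition slit_bundle :: "('m, 'n::finite) chart set \<Rightarrow> ('m, 'n) tvec set" where
  "slit_bundle A = {(p, w) \<in> tangent_bundle A. w \<noteq> (\<lambda>_. 0)}"

definition tscale :: "complex \<Rightarrow> ('m, 'n::finite) tvec \<Rightarrow> ('m, 'n) tvec" where
  "tscale \<zeta> u = (fst u, \<lambda>c. \<zeta> *s snd u c)"

text \<open>The tangent vector with coordinates \<open>(z, v)\<close> in the chart \<open>c\<close>.\<close>

definition tpoint :: "('m, 'n::finite) chart set \<Rightarrow> ('m, 'n) chart \<Rightarrow> 'n coords \<Rightarrow> ('m, 'n) tvec" where
  "tpoint A c x = (let p = chart_inv c (fst x) in
     (p, \<lambda>c'. if c' \<in> A \<and> p \<in> fst c' then jac c c' p (snd x) else 0))"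

definition slit_coords :: "('m, 'n::finite) chart \<Rightarrow> 'n coords set" where
  "slit_coords c = (snd c ` fst c) \<times> (UNIV - {0})"

section \<open>Local Chern-Finsler calculus\<close>

text \<open>Wirtinger derivatives with respect to the coordinates \<open>(z, v)\<close>.\<close>

definition dz :: "'n \<Rightarrow> ('n::finite coords \<Rightarrow> complex) \<Rightarrow> 'n coords \<Rightarrow> complex" where
  "dz \<mu> f x = (frechet_derivative f (at x) (axis \<mu> 1, 0)
                - \<i> * frechet_derivative f (at x) (axis \<mu> \<i>, 0)) / 2"

definition dzbar :: "'n \<Rightarrow> ('n::finite coords \<Rightarrow> complex) \<Rightarrow> 'n coords \<Rightarrow> complex" where
  "dzbar \<mu> f x = (frechet_derivative f (at x) (axis \<mu> 1, 0)
                   + \<i> * frechet_derivative f (at x) (axis \<mu> \<i>, 0)) / 2"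

definition dv :: "'n \<Rightarrow> ('n::finite coords \<Rightarrow> complex) \<Rightarrow> 'n coords \<Rightarrow> complex" where
  "dv \<alpha> f x = (frechet_derivative f (at x) (0, axis \<alpha> 1)
                - \<i> * frechet_derivative f (at x) (0, axis \<alpha> \<i>)) / 2"

definition dvbar :: "'n \<Rightarrow> ('n::finite coords \<Rightarrow> complex) \<Rightarrow> 'n coords \<Rightarrow> complex" where
  "dvbar \<alpha> f x = (frechet_derivative f (at x) (0, axis \<alpha> 1)
                   + \<i> * frechet_derivative f (at x) (0, axis \<alpha> \<i>)) / 2"

text \<open>Below, \<open>g\<close> is the expression of \<open>G = F\<^sup>2\<close> in a chart. Index conventions:
  \<open>Gm g \<alpha> \<beta>\<close> is \<open>G\<close> with lower indices \<open>\<alpha>\<close>, \<open>\<beta>\<close>-bar;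
  \<open>Ginv g \<beta> \<alpha>\<close> is \<open>G\<close> with upper indices \<open>\<beta>\<close>-bar, \<open>\<alpha>\<close>;
  \<open>Gam g \<alpha> \<mu>\<close> is \<open>\<Gamma>\<close> with upper \<open>\<alpha>\<close>, lower \<open>;\<mu>\<close>;
  \<open>GamH g \<alpha> \<beta> \<mu>\<close> is \<open>\<Gamma>\<close> with upper \<open>\<alpha>\<close>, lower \<open>\<beta>;\<mu>\<close>;
  \<open>GamV g \<alpha> \<beta> \<gamma>\<close> is \<open>\<Gamma>\<close> with upper \<open>\<alpha>\<close>, lower \<open>\<beta>\<gamma>\<close>.\<close>

definition Gm :: "('n::finite coords \<Rightarrow> real) \<Rightarrow> 'n \<Rightarrow> 'n \<Rightarrow> 'n coords \<Rightarrow> complex" where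
  "Gm g \<alpha> \<beta> = dv \<alpha> (dvbar \<beta> (\<lambda>x. of_real (g x)))"

definition Ginv :: "('n::finite coords \<Rightarrow> real) \<Rightarrow> 'n \<Rightarrow> 'n \<Rightarrow> 'n coords \<Rightarrow> complex" where
  "Ginv g \<beta> \<alpha> x = matrix_inv (\<chi> \<alpha>' \<beta>'. Gm g \<alpha>' \<beta>' x) $ \<beta> $ \<alpha>"

definition Gam :: "('n::finite coords \<Rightarrow> real) \<Rightarrow> 'n \<Rightarrow> 'n \<Rightarrow> 'n coords \<Rightarrow> complex" where
  "Gam g \<alpha> \<mu> x = (\<Sum>l\<in>UNIV. Ginv g l \<alpha> x * dvbar l (dz \<mu> (\<lambda>y. of_real (g y))) x)"

definition delta :: "('n::finite coords \<Rightarrow> real) \<Rightarrow> 'n \<Rightarrow> ('n coords \<Rightarrow> complex) \<Rightarrow> 'n coords \<Rightarrow> complex" where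
  "delta g \<mu> f x = dz \<mu> f x - (\<Sum>\<alpha>\<in>UNIV. Gam g \<alpha> \<mu> x * dv \<alpha> f x)"

definition deltabar :: "('n::finite coords \<Rightarrow> real) \<Rightarrow> 'n \<Rightarrow> ('n coords \<Rightarrow> complex) \<Rightarrow> 'n coords \<Rightarrow> complex" where
  "deltabar g \<mu> f x = dzbar \<mu> f x - (\<Sum>\<alpha>\<in>UNIV. cnj (Gam g \<alpha> \<mu> x) * dvbar \<alpha> f x)"

definition GamH :: "('n::finite coords \<Rightarrow> real) \<Rightarrow> 'n \<Rightarrow> 'n \<Rightarrow> 'n \<Rightarrow> 'n coords \<Rightarrow> complex" where
  "GamH g \<alpha> \<beta> \<mu> x = (\<Sum>l\<in>UNIV. Ginv g l \<alpha> x * delta g \<mu> (Gm g \<beta> l) x)"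

definition GamV :: "('n::finite coords \<Rightarrow> real) \<Rightarrow> 'n \<Rightarrow> 'n \<Rightarrow> 'n \<Rightarrow> 'n coords \<Rightarrow> complex" where
  "GamV g \<alpha> \<beta> \<gamma> x = (\<Sum>l\<in>UNIV. Ginv g l \<alpha> x * dv \<gamma> (Gm g \<beta> l) x)"

definition Omega :: "('n::finite coords \<Rightarrow> real) \<Rightarrow> 'n \<Rightarrow> 'n \<Rightarrow> 'n \<Rightarrow> 'n \<Rightarrow> 'n coords \<Rightarrow> complex" where
  "Omega g \<alpha> \<beta> \<mu> \<nu> x = - deltabar g \<nu> (GamH g \<alpha> \<beta> \<mu>) x
      - (\<Sum>\<gamma>\<in>UNIV. GamV g \<alpha> \<beta> \<gamma> x * deltabar g \<nu> (Gam g \<gamma> \<mu>) x)"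

definition Omega_low :: "('n::finite coords \<Rightarrow> real) \<Rightarrow> 'n \<Rightarrow> 'n \<Rightarrow> 'n \<Rightarrow> 'n \<Rightarrow> 'n coords \<Rightarrow> complex" where
  "Omega_low g \<alpha> \<beta> \<mu> \<nu> x = (\<Sum>\<gamma>\<in>UNIV. Gm g \<gamma> \<beta> x * Omega g \<gamma> \<alpha> \<mu> \<nu> x)"

definition scal :: "('n::finite coords \<Rightarrow> real) \<Rightarrow> 'n coords \<Rightarrow> complex" where
  "scal g x = (\<Sum>\<mu>\<in>UNIV. \<Sum>\<nu>\<in>UNIV. \<Sum>\<alpha>\<in>UNIV. \<Sum>\<beta>\<in>UNIV.
                  Ginv g \<nu> \<mu> x * Ginv g \<beta> \<alpha> x * Omega_low g \<alpha> \<beta> \<mu> \<nu> x)"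

section \<open>Complex Finsler metrics\<close>

definition Gloc :: "('m, 'n::finite) chart set \<Rightarrow> (('m, 'n) tvec \<Rightarrow> real) \<Rightarrow> ('m, 'n) chart \<Rightarrow> 'n coords \<Rightarrow> real" where
  "Gloc A F c x = (F (tpoint A c x))\<^sup>2"

definition complex_finsler :: "('m, 'n::finite) chart set \<Rightarrow> (('m, 'n) tvec \<Rightarrow> real) \<Rightarrow> bool" where
  "complex_finsler A F \<longleftrightarrow>
     (\<forall>u\<in>tangent_bundle A. 0 \<le> F u) \<and>
     (\<forall>c\<in>A. continuous_on ((snd c ` fst c) \<times> UNIV) (\<lambda>x. F (tpoint A c x))) \<and>
     (\<forall>c\<in>A. smooth_on (slit_coords c) (Gloc A F c)) \<and>
     (\<forall>u\<in>slit_bundle A. 0 < F u) \<and>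
     (\<forall>u\<in>tangent_bundle A. \<forall>\<zeta>. F (tscale \<zeta> u) = cmod \<zeta> * F u)"

definition strongly_pseudoconvex :: "('m, 'n::finite) chart set \<Rightarrow> (('m, 'n) tvec \<Rightarrow> real) \<Rightarrow> bool" where
  "strongly_pseudoconvex A F \<longleftrightarrow>
     (\<forall>c\<in>A. \<forall>x\<in>slit_coords c. \<forall>\<xi>::complex^'n. \<xi> \<noteq> 0 \<longrightarrow>
        0 < (\<Sum>\<alpha>\<in>UNIV. \<Sum>\<beta>\<in>UNIV. Gm (Gloc A F c) \<alpha> \<beta> x * \<xi> $ \<alpha> * cnj (\<xi> $ \<beta>)))"

section \<open>The volume form of the projectivized tangent bundle\<close>

text \<open>A complex-valued alternating \<open>p\<close>-form at a point is a function of the sequence of its arguments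
  that depends on the first \<open>p\<close> entries only. Wedge products are normalized such that
  \<open>(a \<and> b)(X, Y) = a(X) b(Y) - a(Y) b(X)\<close> for 1-forms.\<close>

type_synonym 'n altform = "(nat \<Rightarrow> 'n coords) \<Rightarrow> complex"

definition wedge :: "nat \<Rightarrow> nat \<Rightarrow> 'n altform \<Rightarrow> 'n altform \<Rightarrow> 'n altform" where
  "wedge p q a b X = (\<Sum>\<sigma> | \<sigma> permutes {..<p+q}.
      of_int (sign \<sigma>) * a (\<lambda>i. X (\<sigma> i)) * b (\<lambda>i. X (\<sigma> (p + i)))) / (fact p * fact q)"

primrec wedge_pow :: "nat \<Rightarrow> 'n altform \<Rightarrow> nat \<Rightarrow> 'n altform" where
  "wedge_pow p a 0 = (\<lambda>X. 1)"
| "wedge_pow p a (Suc m) = wedge p (p * m) a (wedge_pow p a m)"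

definition dz_form :: "'n::finite \<Rightarrow> 'n altform" where
  "dz_form \<alpha> X = fst (X 0) $ \<alpha>"

definition deltav_form :: "('n::finite coords \<Rightarrow> real) \<Rightarrow> 'n coords \<Rightarrow> 'n \<Rightarrow> 'n altform" where
  "deltav_form g x \<alpha> X = snd (X 0) $ \<alpha> + (\<Sum>\<beta>\<in>UNIV. Gam g \<alpha> \<beta> x * fst (X 0) $ \<beta>)"

definition omegaV :: "('n::finite coords \<Rightarrow> real) \<Rightarrow> 'n coords \<Rightarrow> 'n altform" where
  "omegaV g x X = \<i> * (\<Sum>\<alpha>\<in>UNIV. \<Sum>\<beta>\<in>UNIV. dv \<alpha> (dvbar \<beta> (\<lambda>y. of_real (ln (g y)))) x *
      wedge 1 1 (deltav_form g x \<alpha>) (\<lambda>Y. cnj (deltav_form g x \<beta> Y)) X)"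

definition omegaH :: "('n::finite coords \<Rightarrow> real) \<Rightarrow> 'n coords \<Rightarrow> 'n altform" where
  "omegaH g x X = \<i> * (\<Sum>\<alpha>\<in>UNIV. \<Sum>\<beta>\<in>UNIV. Gm g \<alpha> \<beta> x *
      wedge 1 1 (dz_form \<alpha>) (\<lambda>Y. cnj (dz_form \<beta> Y)) X)"

definition vol :: "('n::finite coords \<Rightarrow> real) \<Rightarrow> 'n coords \<Rightarrow> 'n altform" where
  "vol g x = (let n = CARD('n) in
     wedge (2 * (n - 1)) (2 * n)
       (\<lambda>X. wedge_pow 2 (omegaV g x) (n - 1) X / fact (n - 1))
       (\<lambda>X. wedge_pow 2 (omegaH g x) n X / fact n))"

section \<open>Integration over the projectivized tangent bundle\<close>

text \<open>Objects on the quotient of the slit bundle by the nonzero complex scalars are represented by their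
  lifts to the slit bundle. A chart \<open>c\<close> and an index \<open>k\<close> yield local coordinates \<open>(z, w)\<close> on the part
  where \<open>v\<^sub>k \<noteq> 0\<close>: \<open>w\<close> is the family of the affine coordinates \<open>v\<^sub>\<alpha> / v\<^sub>k\<close> with \<open>\<alpha> \<noteq> k\<close>. Forms are pulled
  back along the section \<open>(z, w) \<mapsto> (z, affv k w)\<close>.\<close>

definition affv :: "'n \<Rightarrow> ('n::finite \<Rightarrow> complex) \<Rightarrow> complex^'n" where
  "affv k w = (\<chi> \<alpha>. if \<alpha> = k then 1 else w \<alpha>)"

text \<open>The positively oriented real coordinate frame of the coordinates \<open>(z, w)\<close>:
  \<open>\<partial>/\<partial>(Re z)\<close>, \<open>\<partial>/\<partial>(Im z)\<close> for each component of \<open>z\<close>, followed by the same for \<open>w\<close>. The choice of the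
  enumeration of the index set is irrelevant, as it permutes pairs of vectors.\<close>

definition aff_frame :: "'n \<Rightarrow> nat \<Rightarrow> 'n::finite coords" where
  "aff_frame k j = (let u = (if even j then 1 else \<i>) in
     if j < 2 * CARD('n) then (axis (from_nat_into UNIV (j div 2)) u, 0)
     else (0, axis (from_nat_into (- {k}) (j div 2 - CARD('n))) u))"

text \<open>A finite continuous partition of unity on the projectivized tangent bundle. In the last
  condition, the set of all \<open>(z, [v])\<close> with \<open>z \<in> K\<close> and \<open>norm v \<le> R * norm (v\<^sub>k)\<close> is a compact subset of
  the coordinate domain given by \<open>(c, k)\<close>.\<close>

definition partition_of_unity ::
  "('m, 'n::finite) chart set \<Rightarrow> ('m, 'n) chart set \<Rightarrow> (('m, 'n) chart \<Rightarrow> 'n \<Rightarrow> ('m, 'n) tvec \<Rightarrow> real) \<Rightarrow> bool" where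
  "partition_of_unity A C \<theta> \<longleftrightarrow> finite C \<and> C \<subseteq> A \<and>
     (\<forall>u\<in>slit_bundle A. (\<Sum>c\<in>C. \<Sum>k\<in>UNIV. \<theta> c k u) = 1) \<and>
     (\<forall>c\<in>C. \<forall>k.
        (\<forall>u\<in>slit_bundle A. 0 \<le> \<theta> c k u \<and> (\<forall>\<zeta>. \<zeta> \<noteq> 0 \<longrightarrow> \<theta> c k (tscale \<zeta> u) = \<theta> c k u)) \<and>
        (\<forall>c'\<in>A. continuous_on (slit_coords c') (\<lambda>x. \<theta> c k (tpoint A c' x))) \<and>
        (\<exists>K R. compact K \<and> K \<subseteq> snd c ` fst c \<and>
           (\<forall>(p, w)\<in>slit_bundle A. \<theta> c k (p, w) \<noteq> 0 \<longrightarrow>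
              p \<in> fst c \<and> snd c p \<in> K \<and> norm (w c) \<le> R * norm (w c $ k))))"

definition chosen_partition ::
  "('m, 'n::finite) chart set \<Rightarrow> ('m, 'n) chart set \<times> (('m, 'n) chart \<Rightarrow> 'n \<Rightarrow> ('m, 'n) tvec \<Rightarrow> real)" where
  "chosen_partition A = (SOME P. partition_of_unity A (fst P) (snd P))"

text \<open>The integral of a form \<open>\<eta>\<close> of top degree \<open>4n - 2\<close>, given by its expressions in all charts. As usual,
  it is computed with a partition of unity, and does not depend on its choice.\<close>

definition PTM_integral ::
  "('m, 'n::finite) chart set \<Rightarrow> (('m, 'n) chart \<Rightarrow> 'n coords \<Rightarrow> 'n altform) \<Rightarrow> complex" where
  "PTM_integral A \<eta> = (let (C, \<theta>) = chosen_partition A in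
     \<Sum>c\<in>C. \<Sum>k\<in>UNIV.
       (LINT (z, w) | (lborel \<Otimes>\<^sub>M (\<Pi>\<^sub>M \<alpha> \<in> - {k}. lborel)).
          indicator (snd c ` fst c) z *
          of_real (\<theta> c k (tpoint A c (z, affv k w))) * \<eta> c (z, affv k w) (aff_frame k)))"

definition PTM_int_vol ::
  "('m, 'n::finite) chart set \<Rightarrow> (('m, 'n) tvec \<Rightarrow> real) \<Rightarrow> (('m, 'n) chart \<Rightarrow> 'n coords \<Rightarrow> complex) \<Rightarrow> complex" where
  "PTM_int_vol A F f = PTM_integral A (\<lambda>c x X. f c x * vol (Gloc A F c) x X)"

section \<open>Horizontal forms\<close>

text \<open>A horizontal form is given by its coefficients \<open>\<phi> c I J\<close> in every chart \<open>c\<close>, where the list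
  \<open>I\<close> holds the unbarred and \<open>J\<close> the barred indices. Coefficients with index lists of the wrong lengths
  vanish, such that forms of different bidegrees can be added.\<close>

type_synonym ('m, 'n) hform = "('m, 'n) chart \<Rightarrow> 'n list \<Rightarrow> 'n list \<Rightarrow> 'n coords \<Rightarrow> complex"

definition lists_of :: "nat \<Rightarrow> 'n list set" where
  "lists_of p = {I. length I = p}"

definition jac_comp :: "('m, 'n::finite) chart \<Rightarrow> ('m, 'n) chart \<Rightarrow> 'm \<Rightarrow> 'n \<Rightarrow> 'n \<Rightarrow> complex" where
  "jac_comp c c' p \<alpha> \<beta> = jac c c' p (axis \<beta> 1) $ \<alpha>"

definition horizontal_form :: "('m, 'n::finite) chart set \<Rightarrow> nat \<Rightarrow> nat \<Rightarrow> ('m, 'n) hform \<Rightarrow> bool" where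
  "horizontal_form A p q \<phi> \<longleftrightarrow>
     (\<forall>c\<in>A. \<forall>I J.
        (length I \<noteq> p \<or> length J \<noteq> q \<longrightarrow> (\<forall>x\<in>slit_coords c. \<phi> c I J x = 0)) \<and>
        smooth_on (slit_coords c) (\<phi> c I J) \<and>
        (\<forall>(z, v)\<in>slit_coords c. \<forall>\<zeta>. \<zeta> \<noteq> 0 \<longrightarrow> \<phi> c I J (z, \<zeta> *s v) = \<phi> c I J (z, v))) \<and>
     (\<forall>c\<in>A. \<forall>I\<in>lists_of p. \<forall>J\<in>lists_of q. \<forall>x\<in>slit_coords c. \<forall>\<sigma> \<tau>.
        \<sigma> permutes {..<p} \<longrightarrow> \<tau> permutes {..<q} \<longrightarrow>
        \<phi> c (permute_list \<sigma> I) (permute_list \<tau> J) x = of_int (sign \<sigma> * sign \<tau>) * \<phi> c I J x) \<and>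
     (\<forall>c\<in>A. \<forall>c'\<in>A. \<forall>m\<in>fst c \<inter> fst c'. \<forall>v. v \<noteq> 0 \<longrightarrow>
        (\<forall>I\<in>lists_of p. \<forall>J\<in>lists_of q.
           \<phi> c I J (snd c m, v) =
             (\<Sum>I'\<in>lists_of p. \<Sum>J'\<in>lists_of q.
                (\<Prod>i<p. jac_comp c c' m (I' ! i) (I ! i)) *
                (\<Prod>j<q. cnj (jac_comp c c' m (J' ! j) (J ! j))) *
                \<phi> c' I' J' (snd c' m, jac c c' m v))))"

definition drop_nth :: "nat \<Rightarrow> 'a list \<Rightarrow> 'a list" where
  "drop_nth i xs = take i xs @ drop (Suc i) xs"

definition dH :: "('m, 'n::finite) chart set \<Rightarrow> (('m, 'n) tvec \<Rightarrow> real) \<Rightarrow> ('m, 'n) hform \<Rightarrow> ('m, 'n) hform" where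
  "dH A F \<phi> c I J x =
     (\<Sum>i<length I. (-1) ^ i * delta (Gloc A F c) (I ! i) (\<phi> c (drop_nth i I) J) x)"

text \<open>The leading sign stems from moving the new barred differential past the unbarred ones.\<close>

definition dbarH :: "('m, 'n::finite) chart set \<Rightarrow> (('m, 'n) tvec \<Rightarrow> real) \<Rightarrow> ('m, 'n) hform \<Rightarrow> ('m, 'n) hform" where
  "dbarH A F \<phi> c I J x = (-1) ^ length I *
     (\<Sum>j<length J. (-1) ^ j * deltabar (Gloc A F c) (J ! j) (\<phi> c I (drop_nth j J)) x)"

definition pt_inner :: "nat \<Rightarrow> nat \<Rightarrow> ('n::finite coords \<Rightarrow> real) \<Rightarrow>
    ('n list \<Rightarrow> 'n list \<Rightarrow> 'n coords \<Rightarrow> complex) \<Rightarrow> ('n list \<Rightarrow> 'n list \<Rightarrow> 'n coords \<Rightarrow> complex) \<Rightarrow>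
    'n coords \<Rightarrow> complex" where
  "pt_inner p q g \<phi> \<psi> x =
     (\<Sum>a\<in>lists_of p. \<Sum>b\<in>lists_of q. \<Sum>c\<in>lists_of p. \<Sum>k\<in>lists_of q.
        \<phi> a b x * (\<Prod>i<p. Ginv g (c ! i) (a ! i) x) * (\<Prod>j<q. Ginv g (b ! j) (k ! j) x) *
        cnj (\<psi> c k x)) / (fact p * fact q)"

definition L2_inner :: "('m, 'n::finite) chart set \<Rightarrow> (('m, 'n) tvec \<Rightarrow> real) \<Rightarrow> nat \<Rightarrow> nat \<Rightarrow>
    ('m, 'n) hform \<Rightarrow> ('m, 'n) hform \<Rightarrow> complex" where
  "L2_inner A F p q \<phi> \<psi> = PTM_int_vol A F (\<lambda>c. pt_inner p q (Gloc A F c) (\<phi> c) (\<psi> c))"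

text \<open>\<open>T\<close> is the formal adjoint of \<open>D\<close>, an operator from \<open>(p, q)\<close>-forms to \<open>(p', q')\<close>-forms.\<close>

definition formal_adjoint :: "('m, 'n::finite) chart set \<Rightarrow> (('m, 'n) tvec \<Rightarrow> real) \<Rightarrow> nat \<times> nat \<Rightarrow> nat \<times> nat \<Rightarrow>
    (('m, 'n) hform \<Rightarrow> ('m, 'n) hform) \<Rightarrow> (('m, 'n) hform \<Rightarrow> ('m, 'n) hform) \<Rightarrow> bool" where
  "formal_adjoint A F = (\<lambda>(p, q) (p', q') D T.
     (\<forall>\<psi>. horizontal_form A p' q' \<psi> \<longrightarrow> horizontal_form A p q (T \<psi>)) \<and>
     (\<forall>\<phi> \<psi>. horizontal_form A p q \<phi> \<longrightarrow> horizontal_form A p' q' \<psi> \<longrightarrow>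
        L2_inner A F p' q' (D \<phi>) \<psi> = L2_inner A F p q \<phi> (T \<psi>)))"

text \<open>The form \<open>omegaH\<close> as an element of the space of horizontal \<open>(1, 1)\<close>-forms.\<close>

definition omegaH_hform :: "('m, 'n::finite) chart set \<Rightarrow> (('m, 'n) tvec \<Rightarrow> real) \<Rightarrow> ('m, 'n) hform" where
  "omegaH_hform A F c I J x =
     (if length I = 1 \<and> length J = 1 then \<i> * Gm (Gloc A F c) (I ! 0) (J ! 0) x else 0)"

section \<open>Balanced complex Finsler manifolds\<close>

text \<open>Formal adjoints are determined up to values outside the slit bundle. By the convention on index
  lists, the sum of the two values is taken in the direct sum of the \<open>(0, 1)\<close>- and the \<open>(1, 0)\<close>-forms.\<close>

definition balanced_finsler ::
  "('m::{t2_space,second_countable_topology}, 'n::finite) chart set \<Rightarrow> (('m, 'n) tvec \<Rightarrow> real) \<Rightarrow> bool" where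
  "balanced_finsler A F \<longleftrightarrow>
     complex_atlas A \<and> compact (UNIV :: 'm set) \<and> complex_finsler A F \<and> strongly_pseudoconvex A F \<and>
     (\<exists>T Tbar. formal_adjoint A F (0, 1) (1, 1) (dH A F) T \<and>
        formal_adjoint A F (1, 0) (1, 1) (dbarH A F) Tbar \<and>
        (\<forall>c\<in>A. \<forall>I J. \<forall>x\<in>slit_coords c.
           T (omegaH_hform A F) c I J x + Tbar (omegaH_hform A F) c I J x = 0))"

definition conformal :: "('m \<Rightarrow> real) \<Rightarrow> (('m, 'n) tvec \<Rightarrow> real) \<Rightarrow> ('m, 'n) tvec \<Rightarrow> real" where
  "conformal \<rho> F u = exp (\<rho> (fst u) / 2) * F u"

end

theory Submission
  imports Defs
begin

text \<open>
The proof compares the integrand of \<open>e\<^sup>\<rho> G\<close> with that of \<open>G\<close> pointwise and then uses that one integral vanishes.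

Since \<open>\<rho>\<close> is constant along the fibres, every change of a connection coefficient is \<open>\<rho>\<^sub>\<mu>\<close> times \<open>v\<close> or the identity,
and the operators \<open>delta\<close>, \<open>deltabar\<close> change by multiples of the radial derivatives. By homogeneity of \<open>G\<close>
(\<open>euler\<close>) the radial terms drop out of the curvature, which only changes by the complex Hessian of \<open>\<rho>\<close> times the
identity (\<open>Omega_conf\<close>). Taking traces, the scalar curvature becomes \<open>e\<^sup>-\<^sup>\<rho> (s - n \<box>\<rho>)\<close>, where \<open>\<box>\<close> is the trace of the
complex Hessian (\<open>scal_conf\<close>). The vertical form \<open>omegaV\<close> does not change because \<open>v\<close> is in the kernel of the vertical
Hessian of \<open>ln G\<close>, so the volume form is multiplied by \<open>e\<^sup>n\<^sup>\<rho>\<close> (\<open>vol_conf\<close>). For \<open>a = n - 1\<close> and \<open>f = e\<^sup>a\<^sup>\<rho>\<close> one has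
\<open>\<box>f = a f (\<box>\<rho> + a \<bar>\<partial>\<rho>\<bar>\<^sup>2)\<close>, and the new integrand is (\<open>scal_conformal\<close>)
\<open>f (s + n a \<bar>\<partial>\<rho>\<bar>\<^sup>2) - (n / a) \<box>f\<close>
with respect to the old volume form.

The function \<open>\<box>f\<close> is, up to a factor \<open>\<i>\<close>, the inner product of \<open>dbarH (\<partial>f)\<close> with \<open>omegaH\<close>. Its integral is therefore the
inner product of \<open>\<partial>f\<close> with the adjoint operator applied to \<open>omegaH\<close>. On a balanced manifold the values of the two adjoint
operators at \<open>omegaH\<close> add up to zero, and since they have different bidegrees, both vanish
(\<open>balanced_laplacian_integral\<close>). This requires that \<open>omegaH\<close> and \<open>\<partial>f\<close> are horizontal forms in the sense of the
definition, in particular that they transform correctly (\<open>omegaH_horizontal\<close>, \<open>del_horizontal\<close>).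

It remains to see that the integral of the positive function \<open>f (s + n a \<bar>\<partial>\<rho>\<bar>\<^sup>2)\<close> is positive (\<open>PTM_int_vol_pos\<close>).
Three facts enter. The volume form is positive on the coordinate frames of the projectivized bundle
(\<open>vol_pos\<close>): \<open>omegaH\<close> comes from the positive definite form \<open>G\<^sub>\<alpha>\<^sub>\<beta>\<close>, and \<open>omegaV\<close> is positive on vectors that are no
multiples of \<open>v\<close>, by the strict Cauchy-Schwarz inequality (\<open>logH_pos\<close>). The top power of the two-form of a positive
Hermitian form is positive on complex frames: Gram-Schmidt orthogonalization does not change its value
(\<open>kpow_pos\<close>), and on orthogonal frames every permutation in the definition of the wedge product contributes a nonnegative
term (\<open>wedge_pow_orthogonal_pos\<close>). The integral refers to a partition of unity, which exists by compactness
(\<open>partition_of_unity_exists\<close>). Finally, the supports of the partition functions are compact in the affine charts, so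
that all integrals of continuous functions converge (\<open>affine_integrable\<close>) and the integral is linear on them.
\<close>

section \<open>Smooth functions\<close>

lemma Ck_on_cong_imp:
  assumes "open S" "\<And>x. x \<in> S \<Longrightarrow> f x = g x" "Ck_on k S f"
  shows "Ck_on k S g"
  using assms
proof (induction k arbitrary: f g)
  case 0
  then show ?case using continuous_on_cong[OF refl, of S f g] by simp
next
  case (Suc k)
  have d: "f differentiable at x" if "x \<in> S" for x using Suc.prems(3) that by simp
  have hd: "(g has_derivative frechet_derivative f (at x)) (at x)" if "x \<in> S" for x
    using has_derivative_transform_within_open[OF d[OF that, unfolded frechet_derivative_works] \<open>open S\<close> that]
      Suc.prems(2) by simp
  have e: "frechet_derivative g (at x) = frechet_derivative f (at x)" if "x \<in> S" for x
    using frechet_derivative_at[OF hd[OF that]] by simp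
  have "Ck_on k S (\<lambda>x. frechet_derivative g (at x) h)" for h
    using Suc.IH[of "\<lambda>x. frechet_derivative f (at x) h"] Suc.prems e by simp
  moreover have "g differentiable at x" if "x \<in> S" for x
    using hd[OF that] differentiable_def by blast
  ultimately show ?case by simp
qed

text \<open>Any formula for the derivative may replace the Frechet derivative operator of the definition, because
derivatives on open sets are unique. Each closure property of \<open>Ck_on\<close> follows from this by induction on \<open>k\<close>.\<close>

lemma Ck_on_SucI:
  assumes "open S" "\<And>x. x \<in> S \<Longrightarrow> (f has_derivative f' x) (at x)"
    and "\<And>h. Ck_on k S (\<lambda>x. f' x h)"
  shows "Ck_on (Suc k) S f"
proof -
  have e: "frechet_derivative f (at x) = f' x" if "x \<in> S" for x
    using frechet_derivative_at[OF assms(2)[OF that]] by simp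
  have "Ck_on k S (\<lambda>x. frechet_derivative f (at x) h)" for h
    by (rule Ck_on_cong_imp[OF assms(1) _ assms(3)[of h]]) (simp add: e)
  with assms(2) show ?thesis by (auto simp: differentiable_def)
qed

lemma Ck_on_has_derivative:
  "Ck_on (Suc k) S f \<Longrightarrow> x \<in> S \<Longrightarrow> (f has_derivative frechet_derivative f (at x)) (at x)"
  by (simp add: frechet_derivative_works[symmetric])

lemma Ck_on_lower: "Ck_on (Suc k) S f \<Longrightarrow> Ck_on k S f"
proof (induction k arbitrary: f)
  case 0
  then show ?case
    by (auto intro!: continuous_at_imp_continuous_on differentiable_imp_continuous_within)
next
  case (Suc k)
  then show ?case by simp
qed

lemma Ck_on_const: "open S \<Longrightarrow> Ck_on k S (\<lambda>x. c)"
  by (induction k arbitrary: c) (auto intro!: Ck_on_SucI[where f'="\<lambda>x h. 0"])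

lemma Ck_on_linear:
  assumes "open S" "bounded_linear L" "Ck_on k S f"
  shows "Ck_on k S (\<lambda>x. L (f x))"
  using assms(3)
proof (induction k arbitrary: f)
  case 0
  then show ?case using bounded_linear.continuous_on[OF assms(2)] by auto
next
  case (Suc k)
  show ?case
    by (rule Ck_on_SucI[where f'="\<lambda>x h. L (frechet_derivative f (at x) h)"])
      (use Suc bounded_linear.has_derivative[OF assms(2) Ck_on_has_derivative[OF Suc.prems]] assms in auto)
qed

lemma Ck_on_add:
  assumes "open S" "Ck_on k S f" "Ck_on k S g"
  shows "Ck_on k S (\<lambda>x. f x + g x)"
  using assms(2,3)
proof (induction k arbitrary: f g)
  case 0
  then show ?case by (auto intro!: continuous_intros)
next
  case (Suc k)
  show ?case
    by (rule Ck_on_SucI[where f'="\<lambda>x h. frechet_derivative f (at x) h + frechet_derivative g (at x) h"])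
      (use Suc has_derivative_add[OF Ck_on_has_derivative[OF Suc.prems(1)] Ck_on_has_derivative[OF Suc.prems(2)]] assms in auto)
qed

lemma Ck_on_mult:
  fixes f g :: "'a::real_normed_vector \<Rightarrow> 'b::real_normed_algebra"
  assumes "open S" "Ck_on k S f" "Ck_on k S g"
  shows "Ck_on k S (\<lambda>x. f x * g x)"
  using assms(2,3)
proof (induction k arbitrary: f g)
  case 0
  then show ?case by (auto intro!: continuous_intros)
next
  case (Suc k)
  show ?case
    by (rule Ck_on_SucI[where f'="\<lambda>x h. f x * frechet_derivative g (at x) h + frechet_derivative f (at x) h * g x"])
      (use Suc has_derivative_mult[OF Ck_on_has_derivative[OF Suc.prems(1)] Ck_on_has_derivative[OF Suc.prems(2)]] assms
        Ck_on_lower[OF Suc.prems(1)] Ck_on_lower[OF Suc.prems(2)] in \<open>auto intro!: Ck_on_add\<close>)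
qed

text \<open>The derivative of \<open>1 / f\<close> is a product of copies of \<open>1 / f\<close> and of the derivative of \<open>f\<close>, so the induction
hypothesis for \<open>1 / f\<close> itself closes the step. The exponential function is treated in the same way.\<close>

lemma Ck_on_inverse:
  fixes f :: "'a::real_normed_vector \<Rightarrow> 'b::real_normed_field"
  assumes "open S" "Ck_on k S f" "\<And>x. x \<in> S \<Longrightarrow> f x \<noteq> 0"
  shows "Ck_on k S (\<lambda>x. inverse (f x))"
  using assms(2)
proof (induction k)
  case 0
  then show ?case using assms(3) by (auto intro!: continuous_intros)
next
  case (Suc k)
  have *: "Ck_on k S (\<lambda>x. inverse (f x))" using Suc Ck_on_lower by blast
  show ?case
  proof (rule Ck_on_SucI[where f'="\<lambda>x h. - (inverse (f x) * frechet_derivative f (at x) h * inverse (f x))"])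
    show "((\<lambda>x. inverse (f x)) has_derivative
        (\<lambda>h. - (inverse (f x) * frechet_derivative f (at x) h * inverse (f x)))) (at x)" if "x \<in> S" for x
      using Deriv.has_derivative_inverse[OF assms(3)[OF that] Ck_on_has_derivative[OF Suc.prems that]] .
    show "Ck_on k S (\<lambda>x. - (inverse (f x) * frechet_derivative f (at x) h * inverse (f x)))" for h
      by (rule Ck_on_linear[OF assms(1) bounded_linear_minus[OF bounded_linear_ident]])
        (use * Suc.prems assms(1) in \<open>auto intro!: Ck_on_mult\<close>)
  qed (use assms in auto)
qed

lemma Ck_on_exp:
  fixes f :: "'a::real_normed_vector \<Rightarrow> real"
  assumes "open S" "Ck_on k S f"
  shows "Ck_on k S (\<lambda>x. exp (f x))"
  using assms(2)
proof (induction k)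
  case 0
  then show ?case by (auto intro!: continuous_intros)
next
  case (Suc k)
  have *: "Ck_on k S (\<lambda>x. exp (f x))" using Suc Ck_on_lower by blast
  show ?case
  proof (rule Ck_on_SucI[where f'="\<lambda>x h. exp (f x) * frechet_derivative f (at x) h"])
    show "((\<lambda>x. exp (f x)) has_derivative (\<lambda>h. exp (f x) * frechet_derivative f (at x) h)) (at x)" if "x \<in> S" for x
      using has_derivative_exp[OF Ck_on_has_derivative[OF Suc.prems that]] by (simp add: mult.commute)
  qed (use * Suc.prems assms in \<open>auto intro!: Ck_on_mult\<close>)
qed

lemma Ck_on_fst:
  assumes "open S" "open T" "Ck_on k S f"
  shows "Ck_on k (S \<times> T) (\<lambda>x. f (fst x))"
  using assms(3)
proof (induction k arbitrary: f)
  case 0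
  then show ?case by (auto intro!: continuous_on_compose2[of S f _ fst] continuous_intros)
next
  case (Suc k)
  show ?case
  proof (rule Ck_on_SucI[where f'="\<lambda>x h. frechet_derivative f (at (fst x)) (fst h)"])
    show "((\<lambda>x. f (fst x)) has_derivative (\<lambda>h. frechet_derivative f (at (fst x)) (fst h))) (at x)"
      if "x \<in> S \<times> T" for x
      using has_derivative_compose[OF has_derivative_fst[OF has_derivative_ident] Ck_on_has_derivative[OF Suc.prems]] that by auto
    show "Ck_on k (S \<times> T) (\<lambda>x. frechet_derivative f (at (fst x)) (fst h))" for h
      using Suc.IH[of "\<lambda>z. frechet_derivative f (at z) (fst h)"] Suc.prems by simp
  qed (use assms open_Times in auto)
qed

lemma smooth_on_cong_imp:
  "open S \<Longrightarrow> (\<And>x. x \<in> S \<Longrightarrow> f x = g x) \<Longrightarrow> smooth_on S f \<Longrightarrow> smooth_on S g"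
  unfolding smooth_on_def using Ck_on_cong_imp by blast

lemma smooth_on_differentiable: "smooth_on S f \<Longrightarrow> x \<in> S \<Longrightarrow> f differentiable (at x)"
  unfolding smooth_on_def by (metis Ck_on.simps(2))

lemma smooth_on_has_derivative:
  "smooth_on S f \<Longrightarrow> x \<in> S \<Longrightarrow> (f has_derivative frechet_derivative f (at x)) (at x)"
  using smooth_on_differentiable frechet_derivative_works by blast

lemma smooth_on_continuous_on: "smooth_on S f \<Longrightarrow> continuous_on S f"
  unfolding smooth_on_def by (metis Ck_on.simps(1))

lemma smooth_on_derivative: "smooth_on S f \<Longrightarrow> smooth_on S (\<lambda>x. frechet_derivative f (at x) h)"
  unfolding smooth_on_def by (metis Ck_on.simps(2))

lemma smooth_on_const: "open S \<Longrightarrow> smooth_on S (\<lambda>x. c)"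
  by (simp add: smooth_on_def Ck_on_const)

lemma smooth_on_linear: "open S \<Longrightarrow> bounded_linear L \<Longrightarrow> smooth_on S f \<Longrightarrow> smooth_on S (\<lambda>x. L (f x))"
  by (simp add: smooth_on_def Ck_on_linear)

lemma smooth_on_add: "open S \<Longrightarrow> smooth_on S f \<Longrightarrow> smooth_on S g \<Longrightarrow> smooth_on S (\<lambda>x. f x + g x)"
  by (simp add: smooth_on_def Ck_on_add)

lemma smooth_on_mult:
  fixes f g :: "'a::real_normed_vector \<Rightarrow> 'b::real_normed_algebra"
  shows "open S \<Longrightarrow> smooth_on S f \<Longrightarrow> smooth_on S g \<Longrightarrow> smooth_on S (\<lambda>x. f x * g x)"
  by (simp add: smooth_on_def Ck_on_mult)

lemma smooth_on_inverse:
  fixes f :: "'a::real_normed_vector \<Rightarrow> 'b::real_normed_field"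
  shows "open S \<Longrightarrow> smooth_on S f \<Longrightarrow> (\<And>x. x \<in> S \<Longrightarrow> f x \<noteq> 0) \<Longrightarrow> smooth_on S (\<lambda>x. inverse (f x))"
  by (simp add: smooth_on_def Ck_on_inverse)

lemma smooth_on_exp:
  fixes f :: "'a::real_normed_vector \<Rightarrow> real"
  shows "open S \<Longrightarrow> smooth_on S f \<Longrightarrow> smooth_on S (\<lambda>x. exp (f x))"
  by (simp add: smooth_on_def Ck_on_exp)

lemma smooth_on_fst: "open S \<Longrightarrow> open T \<Longrightarrow> smooth_on S f \<Longrightarrow> smooth_on (S \<times> T) (\<lambda>x. f (fst x))"
  by (simp add: smooth_on_def Ck_on_fst)

lemma smooth_on_of_real:
  "open S \<Longrightarrow> smooth_on S f \<Longrightarrow> smooth_on S (\<lambda>x. of_real (f x) :: complex)"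
  using smooth_on_linear bounded_linear_of_real by blast

lemma smooth_on_cnj: "open S \<Longrightarrow> smooth_on S f \<Longrightarrow> smooth_on S (\<lambda>x. cnj (f x))"
  using smooth_on_linear bounded_linear_cnj by blast

lemma smooth_on_minus: "open S \<Longrightarrow> smooth_on S f \<Longrightarrow> smooth_on S (\<lambda>x. - f x)"
  using smooth_on_linear bounded_linear_minus[OF bounded_linear_ident] by blast

lemma smooth_on_diff: "open S \<Longrightarrow> smooth_on S f \<Longrightarrow> smooth_on S g \<Longrightarrow> smooth_on S (\<lambda>x. f x - g x)"
  using smooth_on_add[of S f "\<lambda>x. - g x"] smooth_on_minus by auto

lemma smooth_on_sum:
  "open S \<Longrightarrow> (\<And>i. i \<in> I \<Longrightarrow> smooth_on S (f i)) \<Longrightarrow> smooth_on S (\<lambda>x. \<Sum>i\<in>I. f i x)"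
  by (induction I rule: infinite_finite_induct) (auto intro: smooth_on_const smooth_on_add)

lemma smooth_on_prod:
  fixes f :: "'i \<Rightarrow> 'a::real_normed_vector \<Rightarrow> 'b::real_normed_field"
  shows "open S \<Longrightarrow> (\<And>i. i \<in> I \<Longrightarrow> smooth_on S (f i)) \<Longrightarrow> smooth_on S (\<lambda>x. \<Prod>i\<in>I. f i x)"
  by (induction I rule: infinite_finite_induct) (auto intro: smooth_on_const smooth_on_mult)

lemmas smooth_intros = smooth_on_const smooth_on_add smooth_on_mult smooth_on_cnj smooth_on_minus
  smooth_on_diff smooth_on_sum smooth_on_prod smooth_on_of_real smooth_on_exp

section \<open>Wirtinger calculus\<close>

text \<open>An operator is a derivation here if its value at \<open>x\<close> is a complex-linear functional of the differential at
\<open>x\<close>. This covers the four Wirtinger derivatives as well as \<open>delta\<close> and \<open>deltabar\<close>, which therefore share one set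
of calculation rules.\<close>

definition derivation :: "(('n::finite coords \<Rightarrow> complex) \<Rightarrow> 'n coords \<Rightarrow> complex) \<Rightarrow> bool" where
  "derivation P \<longleftrightarrow> (\<exists>L. (\<forall>f x. P f x = L x (frechet_derivative f (at x))) \<and>
     (\<forall>x D E. L x (\<lambda>h. D h + E h) = L x D + L x E) \<and> (\<forall>x D c. L x (\<lambda>h. c * D h) = c * L x D))"

lemma derivation_directional:
  assumes "\<And>f x. P f x = (frechet_derivative f (at x) a + s * frechet_derivative f (at x) b) / 2"
  shows "derivation P"
  unfolding derivation_def
  by (rule exI[of _ "\<lambda>x D. (D a + s * D b) / 2"]) (simp add: assms field_simps)

lemma derivation_dz [simp]: "derivation (dz \<mu>)"
  by (rule derivation_directional[of _ _ "- \<i>"]) (simp add: dz_def)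

lemma derivation_dzbar [simp]: "derivation (dzbar \<mu>)"
  by (rule derivation_directional) (simp add: dzbar_def)

lemma derivation_dv [simp]: "derivation (dv \<alpha>)"
  by (rule derivation_directional[of _ _ "- \<i>"]) (simp add: dv_def)

lemma derivation_dvbar [simp]: "derivation (dvbar \<alpha>)"
  by (rule derivation_directional) (simp add: dvbar_def)

lemma derivation_combine:
  assumes "derivation P" "\<And>\<alpha>::'k::finite. derivation (Q \<alpha>)"
  shows "derivation (\<lambda>f x. P f x - (\<Sum>\<alpha>\<in>UNIV. (c \<alpha> x * Q \<alpha> f x)))"
proof -
  obtain L where L: "\<And>f x. P f x = L x (frechet_derivative f (at x))"
    "\<And>x D E. L x (\<lambda>h. D h + E h) = L x D + L x E" "\<And>x D c. L x (\<lambda>h. c * D h) = c * L x D"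
    using assms(1) unfolding derivation_def by blast
  have "\<forall>\<alpha>. \<exists>M. (\<forall>f x. Q \<alpha> f x = M x (frechet_derivative f (at x))) \<and>
     (\<forall>x D E. M x (\<lambda>h. D h + E h) = M x D + M x E) \<and> (\<forall>x D c. M x (\<lambda>h. c * D h) = c * M x D)"
    using assms(2) unfolding derivation_def by blast
  from choice[OF this] obtain M where M: "\<And>\<alpha> f x. Q \<alpha> f x = M \<alpha> x (frechet_derivative f (at x))"
    "\<And>\<alpha> x D E. M \<alpha> x (\<lambda>h. D h + E h) = M \<alpha> x D + M \<alpha> x E" "\<And>\<alpha> x D c. M \<alpha> x (\<lambda>h. c * D h) = c * M \<alpha> x D"
    by blast
  show ?thesis
    unfolding derivation_def
    by (rule exI[of _ "\<lambda>x D. L x D - (\<Sum>\<alpha>\<in>UNIV. (c \<alpha> x * M \<alpha> x D))"])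
      (simp add: L M sum.distrib algebra_simps sum_distrib_left)
qed

lemma derivation_delta [simp]: "derivation (delta g \<mu>)"
  using derivation_combine[of "dz \<mu>" dv "\<lambda>\<alpha>. Gam g \<alpha> \<mu>"] by (simp add: delta_def[abs_def])

lemma derivation_deltabar [simp]: "derivation (deltabar g \<mu>)"
  using derivation_combine[of "dzbar \<mu>" dvbar "\<lambda>\<alpha> x. cnj (Gam g \<alpha> \<mu> x)"] by (simp add: deltabar_def[abs_def])

lemma derivationE:
  assumes "derivation P"
  obtains L where "\<And>f x. P f x = L x (frechet_derivative f (at x))"
    "\<And>x D E. L x (\<lambda>h. D h + E h) = L x D + L x E" "\<And>x D c. L x (\<lambda>h. c * D h) = c * L x D"
  using assms unfolding derivation_def by blast

text \<open>Identities that hold on an open set may be differentiated. All iterated derivatives below are computed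
through this rule.\<close>

lemma derivation_cong:
  assumes "derivation P" "open S" "x \<in> S" "\<And>y. y \<in> S \<Longrightarrow> f y = g y" "f differentiable (at x)"
  shows "P f x = P g x"
proof -
  have "frechet_derivative f (at x) = frechet_derivative g (at x)"
    using frechet_derivative_transform_within_open[OF assms(5,2,3,4)] .
  note d = this
  obtain L where L: "\<And>f x. P f x = L x (frechet_derivative f (at x))"
    "\<And>x D E. L x (\<lambda>h. D h + E h) = L x D + L x E" "\<And>x D c. L x (\<lambda>h. c * D h) = c * L x D"
    by (rule derivationE[OF assms(1)]) blast
  show ?thesis by (simp add: L(1) d)
qed

lemma derivation_const: "derivation P \<Longrightarrow> P (\<lambda>x. c) x = 0"
proof (erule derivationE)
  fix L assume L: "\<And>f x. P f x = L x (frechet_derivative f (at x))" "\<And>x D c. L x (\<lambda>h. c * D h) = c * L x D"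
  show "P (\<lambda>x. c) x = 0"
    using L(2)[of x 0 "\<lambda>h. 0"] by (simp add: L(1))
qed

lemma derivation_add:
  assumes "derivation P" "f differentiable (at x)" "g differentiable (at x)"
  shows "P (\<lambda>x. f x + g x) x = P f x + P g x"
proof -
  have "frechet_derivative (\<lambda>x. f x + g x) (at x)
    = (\<lambda>h. frechet_derivative f (at x) h + frechet_derivative g (at x) h)"
    using frechet_derivative_at[OF has_derivative_add[OF assms(2,3)[unfolded frechet_derivative_works]]] by simp
  note d = this
  obtain L where L: "\<And>f x. P f x = L x (frechet_derivative f (at x))"
    "\<And>x D E. L x (\<lambda>h. D h + E h) = L x D + L x E" "\<And>x D c. L x (\<lambda>h. c * D h) = c * L x D"
    by (rule derivationE[OF assms(1)]) blast
  show ?thesis by (simp add: L(1) d L(2,3))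
qed

lemma derivation_mult:
  assumes "derivation P" "f differentiable (at x)" "g differentiable (at x)"
  shows "P (\<lambda>x. f x * g x) x = f x * P g x + P f x * g x"
proof -
  have "frechet_derivative (\<lambda>x. f x * g x) (at x)
    = (\<lambda>h. f x * frechet_derivative g (at x) h + g x * frechet_derivative f (at x) h)"
    using frechet_derivative_at[OF has_derivative_mult[OF assms(2,3)[unfolded frechet_derivative_works]]]
    by (simp add: mult.commute)
  note d = this
  obtain L where L: "\<And>f x. P f x = L x (frechet_derivative f (at x))"
    "\<And>x D E. L x (\<lambda>h. D h + E h) = L x D + L x E" "\<And>x D c. L x (\<lambda>h. c * D h) = c * L x D"
    by (rule derivationE[OF assms(1)]) blast
  show ?thesis by (simp add: L(1) d L(2,3) mult.commute)
qed

lemma derivation_cmult: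
  assumes "derivation P" "f differentiable (at x)"
  shows "P (\<lambda>x. c * f x) x = c * P f x"
  using derivation_mult[OF assms(1) differentiable_const assms(2), of c] by (simp add: derivation_const[OF assms(1)])

lemma derivation_sum:
  assumes "derivation P" "\<And>i. i \<in> I \<Longrightarrow> f i differentiable (at x)"
  shows "P (\<lambda>x. \<Sum>i\<in>I. f i x) x = (\<Sum>i\<in>I. P (f i) x)"
  using assms(2)
proof (induction I rule: infinite_finite_induct)
  case (insert i I)
  have "(\<lambda>x. \<Sum>i\<in>I. f i x) differentiable at x"
    using insert by (intro differentiable_sum) auto
  then show ?case using insert by (simp add: derivation_add[OF assms(1)])
qed (simp_all add: derivation_const[OF assms(1)])

text \<open>Exponential, logarithm and reciprocal are only ever applied to real functions, hence a real outer
function \<open>\<phi>\<close> of one variable suffices.\<close>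

lemma derivation_chain_real:
  fixes r :: "'n::finite coords \<Rightarrow> real"
  assumes "derivation P" "r differentiable (at x)" "(\<phi> has_field_derivative d) (at (r x))"
  shows "P (\<lambda>x. of_real (\<phi> (r x))) x = of_real d * P (\<lambda>x. of_real (r x)) x"
proof -
  have r: "(r has_derivative frechet_derivative r (at x)) (at x)"
    using assms(2) frechet_derivative_works by blast
  have "((\<lambda>x. of_real (r x) :: complex) has_derivative (\<lambda>h. of_real (frechet_derivative r (at x) h))) (at x)"
    by (rule bounded_linear.has_derivative[OF bounded_linear_of_real r])
  note 1 = frechet_derivative_at[OF this]
  have "((\<lambda>x. \<phi> (r x)) has_derivative (\<lambda>h. d * frechet_derivative r (at x) h)) (at x)"
    using has_derivative_compose[OF r assms(3)[unfolded has_field_derivative_def]] .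
  from bounded_linear.has_derivative[OF bounded_linear_of_real this]
  have "((\<lambda>x. of_real (\<phi> (r x)) :: complex) has_derivative
      (\<lambda>h. of_real d * of_real (frechet_derivative r (at x) h))) (at x)" by simp
  note 2 = frechet_derivative_at[OF this]
  obtain L where L: "\<And>f x. P f x = L x (frechet_derivative f (at x))"
     "\<And>x D c. L x (\<lambda>h. c * D h) = c * L x D"
    using assms(1) unfolding derivation_def by blast
  show ?thesis
    using L(2)[of x "of_real d" "\<lambda>h. of_real (frechet_derivative r (at x) h)"] by (simp add: L(1) 1[symmetric] 2[symmetric])
qed

lemma frechet_cnj:
  assumes "f differentiable (at x)"
  shows "frechet_derivative (\<lambda>x. cnj (f x)) (at x) = (\<lambda>h. cnj (frechet_derivative f (at x) h))"
  using frechet_derivative_at[OF bounded_linear.has_derivative[OF bounded_linear_cnj assms[unfolded frechet_derivative_works]]]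
  by simp

lemma dvbar_cnj: "f differentiable (at x) \<Longrightarrow> dvbar \<alpha> (\<lambda>x. cnj (f x)) x = cnj (dv \<alpha> f x)"
  by (simp add: dvbar_def dv_def frechet_cnj)

lemma dzbar_cnj: "f differentiable (at x) \<Longrightarrow> dzbar \<alpha> (\<lambda>x. cnj (f x)) x = cnj (dz \<alpha> f x)"
  by (simp add: dzbar_def dz_def frechet_cnj)

lemma smooth_on_dz: "open S \<Longrightarrow> smooth_on S f \<Longrightarrow> smooth_on S (dz \<alpha> f)"
  unfolding dz_def[abs_def] divide_inverse by (intro smooth_intros smooth_on_derivative) auto

lemma smooth_on_dzbar: "open S \<Longrightarrow> smooth_on S f \<Longrightarrow> smooth_on S (dzbar \<alpha> f)"
  unfolding dzbar_def[abs_def] divide_inverse by (intro smooth_intros smooth_on_derivative) auto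

lemma smooth_on_dv: "open S \<Longrightarrow> smooth_on S f \<Longrightarrow> smooth_on S (dv \<alpha> f)"
  unfolding dv_def[abs_def] divide_inverse by (intro smooth_intros smooth_on_derivative) auto

lemma smooth_on_dvbar: "open S \<Longrightarrow> smooth_on S f \<Longrightarrow> smooth_on S (dvbar \<alpha> f)"
  unfolding dvbar_def[abs_def] divide_inverse by (intro smooth_intros smooth_on_derivative) auto

lemma wirtinger_split:
  "of_real (Re w) * p + of_real (Im w) * q = w * ((p - \<i> * q) / 2) + cnj w * ((p + \<i> * q) / 2)"
  by (simp add: complex_eq_iff field_simps)

lemma axis_decompose: "(w::complex^'n::finite) = (\<Sum>\<alpha>\<in>UNIV. Re (w $ \<alpha>) *\<^sub>R axis \<alpha> 1 + Im (w $ \<alpha>) *\<^sub>R axis \<alpha> \<i>)"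
  by (simp add: vec_eq_iff axis_def if_distrib[of "\<lambda>x. _ * x"] if_distrib[of "\<lambda>x. _ *\<^sub>R x"] sum.delta' sum.distrib
      complex_eq_iff cong: if_cong)

text \<open>On vertical vectors \<open>df\<close> is the sum of its parts of type \<open>(1, 0)\<close> and \<open>(0, 1)\<close>. The chain rule, which holds
for real differentials, is translated to Wirtinger derivatives by this formula.\<close>

lemma frechet_vertical:
  fixes f :: "'n::finite coords \<Rightarrow> complex"
  assumes "f differentiable (at x)"
  shows "frechet_derivative f (at x) (0, w) = (\<Sum>\<alpha>\<in>UNIV. w $ \<alpha> * dv \<alpha> f x + cnj (w $ \<alpha>) * dvbar \<alpha> f x)"
proof -
  interpret linear "frechet_derivative f (at x)"
    using assms linear_frechet_derivative by blast
  have e: "(0, w) = (\<Sum>\<alpha>\<in>UNIV. Re (w $ \<alpha>) *\<^sub>R (0::complex^'n, axis \<alpha> 1) + Im (w $ \<alpha>) *\<^sub>R (0, axis \<alpha> \<i>))"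
    by (subst axis_decompose) (simp add: prod_eq_iff fst_sum snd_sum)
  have "frechet_derivative f (at x) (0, w) = (\<Sum>\<alpha>\<in>UNIV. of_real (Re (w $ \<alpha>)) * frechet_derivative f (at x) (0, axis \<alpha> 1)
     + of_real (Im (w $ \<alpha>)) * frechet_derivative f (at x) (0, axis \<alpha> \<i>))"
    unfolding e sum add scale by (simp add: scaleR_conv_of_real)
  also have "\<dots> = (\<Sum>\<alpha>\<in>UNIV. w $ \<alpha> * dv \<alpha> f x + cnj (w $ \<alpha>) * dvbar \<alpha> f x)"
    by (intro sum.cong refl) (simp add: wirtinger_split dv_def dvbar_def dz_def dzbar_def)
  finally show ?thesis .
qed

lemma frechet_horizontal:
  fixes f :: "'n::finite coords \<Rightarrow> complex"
  assumes "f differentiable (at x)"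
  shows "frechet_derivative f (at x) (w, 0) = (\<Sum>\<alpha>\<in>UNIV. w $ \<alpha> * dz \<alpha> f x + cnj (w $ \<alpha>) * dzbar \<alpha> f x)"
proof -
  interpret linear "frechet_derivative f (at x)"
    using assms linear_frechet_derivative by blast
  have e: "(w, 0) = (\<Sum>\<alpha>\<in>UNIV. Re (w $ \<alpha>) *\<^sub>R (axis \<alpha> 1, 0::complex^'n) + Im (w $ \<alpha>) *\<^sub>R (axis \<alpha> \<i>, 0))"
    by (subst axis_decompose) (simp add: prod_eq_iff fst_sum snd_sum)
  have "frechet_derivative f (at x) (w, 0) = (\<Sum>\<alpha>\<in>UNIV. of_real (Re (w $ \<alpha>)) * frechet_derivative f (at x) (axis \<alpha> 1, 0)
     + of_real (Im (w $ \<alpha>)) * frechet_derivative f (at x) (axis \<alpha> \<i>, 0))"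
    unfolding e sum add scale by (simp add: scaleR_conv_of_real)
  also have "\<dots> = (\<Sum>\<alpha>\<in>UNIV. w $ \<alpha> * dz \<alpha> f x + cnj (w $ \<alpha>) * dzbar \<alpha> f x)"
    by (intro sum.cong refl) (simp add: wirtinger_split dv_def dvbar_def dz_def dzbar_def)
  finally show ?thesis .
qed

lemma frechet_base:
  assumes "f differentiable (at (fst x))"
  shows "frechet_derivative (\<lambda>x. f (fst x)) (at x) = (\<lambda>h. frechet_derivative f (at (fst x)) (fst h))"
  using frechet_derivative_at[OF has_derivative_compose[OF has_derivative_fst[OF has_derivative_ident]
        assms[unfolded frechet_derivative_works]]] by simp

lemma dv_base: "f differentiable (at (fst x)) \<Longrightarrow> dv \<alpha> (\<lambda>x. f (fst x)) x = 0"
  and dvbar_base: "f differentiable (at (fst x)) \<Longrightarrow> dvbar \<alpha> (\<lambda>x. f (fst x)) x = 0"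
  using linear_0[OF linear_frechet_derivative, of f "at (fst x)"]
  by (simp_all add: dv_def dvbar_def frechet_base)

lemma frechet_fibre_coord:
  "frechet_derivative (\<lambda>x. snd x $ \<gamma>) (at x) = (\<lambda>h. snd h $ \<gamma>)"
  by (rule frechet_derivative_at[symmetric]) (auto intro!: derivative_eq_intros bounded_linear_imp_has_derivative
     bounded_linear_vec_nth bounded_linear_compose[OF bounded_linear_vec_nth bounded_linear_snd])

lemma fibre_coord_differentiable: "(\<lambda>x::'n::finite coords. snd x $ \<gamma>) differentiable (at x)"
  by (rule bounded_linear_imp_differentiable) (rule bounded_linear_compose[OF bounded_linear_vec_nth bounded_linear_snd])

lemma fibre_coord_derivs:
  "dz \<mu> (\<lambda>x. snd x $ \<gamma>) x = 0" "dzbar \<mu> (\<lambda>x. snd x $ \<gamma>) x = 0"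
  "dvbar \<alpha> (\<lambda>x. snd x $ \<gamma>) x = 0" "dv \<alpha> (\<lambda>x. snd x $ \<gamma>) x = (if \<alpha> = \<gamma> then 1 else 0)"
  by (auto simp: dz_def dzbar_def dv_def dvbar_def frechet_fibre_coord axis_def)

section \<open>Homogeneity along the fibres\<close>

text \<open>Bidegree \<open>(a, b)\<close> in \<open>(v, cnj v)\<close>. The degrees are integers rather than natural numbers since
\<open>G\<^sub>\<alpha>\<^sub>\<beta>\<close> has bidegree \<open>(0, 0)\<close> and is differentiated further.\<close>

definition bihom :: "(complex^'n::finite) set \<Rightarrow> int \<Rightarrow> int \<Rightarrow> ('n coords \<Rightarrow> complex) \<Rightarrow> bool" where
  "bihom U a b f \<longleftrightarrow> (\<forall>z\<in>U. \<forall>v. v \<noteq> 0 \<longrightarrow> (\<forall>\<zeta>. \<zeta> \<noteq> 0 \<longrightarrow>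
     f (z, \<zeta> *s v) = \<zeta> powi a * cnj \<zeta> powi b * f (z, v)))"

lemma bihomD: "bihom U a b f \<Longrightarrow> z \<in> U \<Longrightarrow> v \<noteq> 0 \<Longrightarrow> \<zeta> \<noteq> 0 \<Longrightarrow>
     f (z, \<zeta> *s v) = \<zeta> powi a * cnj \<zeta> powi b * f (z, v)"
  by (simp add: bihom_def)

lemma bihom_mult: "bihom U a b f \<Longrightarrow> bihom U a' b' g \<Longrightarrow> bihom U (a + a') (b + b') (\<lambda>x. f x * g x)"
  by (auto simp: bihom_def power_int_add)

lemma bihom_sum: "(\<And>i. i \<in> I \<Longrightarrow> bihom U a b (f i)) \<Longrightarrow> bihom U a b (\<lambda>x. \<Sum>i\<in>I. f i x)"
  by (auto simp: bihom_def sum_distrib_left)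

lemma bihom_diff: "bihom U a b f \<Longrightarrow> bihom U a b g \<Longrightarrow> bihom U a b (\<lambda>x. f x - g x)"
  by (auto simp: bihom_def algebra_simps)

lemma fibre_scale_bounded_linear: "bounded_linear (\<lambda>h::'n::finite coords. (fst h, \<zeta> *s snd h))"
proof -
  have "linear (\<lambda>v::complex^'n. \<zeta> *s v)"
    by (auto simp: linear_iff vec_eq_iff algebra_simps)
  then have "bounded_linear (\<lambda>v::complex^'n. \<zeta> *s v)" using linear_conv_bounded_linear by blast
  from bounded_linear_Pair[OF bounded_linear_fst bounded_linear_compose[OF this bounded_linear_snd]]
  show ?thesis .
qed

lemma vec_scale_nonzero: "\<zeta> \<noteq> 0 \<Longrightarrow> v \<noteq> 0 \<Longrightarrow> \<zeta> *s (v::complex^'n::finite) \<noteq> 0"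
  by (auto simp: vec_eq_iff)

lemma open_slit: "open U \<Longrightarrow> open (U \<times> (UNIV - {0::complex^'n::finite}))"
  by (intro open_Times open_delete) auto

text \<open>Differentiate \<open>f (z, \<zeta> v) = c f (z, v)\<close> with respect to \<open>(z, v)\<close>.\<close>

lemma bihom_frechet:
  fixes f :: "'n::finite coords \<Rightarrow> complex"
  assumes "open U" "bihom U a b f" "\<And>x. x \<in> U \<times> (UNIV - {0}) \<Longrightarrow> f differentiable (at x)"
    and "z \<in> U" "v \<noteq> 0" "\<zeta> \<noteq> 0"
  shows "frechet_derivative f (at (z, \<zeta> *s v)) (h, \<zeta> *s w)
    = \<zeta> powi a * cnj \<zeta> powi b * frechet_derivative f (at (z, v)) (h, w)"
proof -
  let ?M = "\<lambda>h::'n coords. (fst h, \<zeta> *s snd h)"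
  let ?c = "\<zeta> powi a * cnj \<zeta> powi b"
  have "(f has_derivative frechet_derivative f (at (?M (z, v)))) (at (?M (z, v)))"
    using assms(3)[of "?M (z, v)"] vec_scale_nonzero assms(4-6) frechet_derivative_works by auto
  from has_derivative_compose[OF bounded_linear_imp_has_derivative[OF fibre_scale_bounded_linear[of \<zeta>]] this]
  have 1: "((\<lambda>x. f (?M x)) has_derivative (\<lambda>h. frechet_derivative f (at (?M (z, v))) (?M h))) (at (z, v))" .
  have d: "(f has_derivative frechet_derivative f (at (z, v))) (at (z, v))"
    using assms(3)[of "(z, v)"] assms(4-6) frechet_derivative_works by auto
  have "((\<lambda>x. ?c * f x) has_derivative (\<lambda>h. ?c * frechet_derivative f (at (z, v)) h)) (at (z, v))"
    by (rule has_derivative_mult_right[OF d])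
  then have 2: "((\<lambda>x. f (?M x)) has_derivative (\<lambda>h. ?c * frechet_derivative f (at (z, v)) h)) (at (z, v))"
  proof (rule has_derivative_transform_within_open[OF _ open_slit[OF assms(1)]])
    show "(z, v) \<in> U \<times> (UNIV - {0})" using assms by simp
    show "?c * f y = f (?M y)" if "y \<in> U \<times> (UNIV - {0})" for y
      using that by (metis bihomD[OF assms(2) _ _ assms(6)] DiffD2 SigmaE fst_conv insertI1 snd_conv)
  qed
  from has_derivative_unique[OF 1 2] have "frechet_derivative f (at (?M (z, v))) (?M (h, w)) = ?c * frechet_derivative f (at (z, v)) (h, w)"
    by meson
  then show ?thesis by simp
qed

lemma bihom_dz:
  assumes "open U" "bihom U a b f" "\<And>x. x \<in> U \<times> (UNIV - {0}) \<Longrightarrow> f differentiable (at x)"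
  shows "bihom U a b (dz \<mu> f)" "bihom U a b (dzbar \<mu> f)"
  unfolding bihom_def dz_def dzbar_def
  using bihom_frechet[OF assms, where w=0] by (simp_all add: field_simps)

lemma bihom_dv:
  assumes "open U" "bihom U a b f" "\<And>x. x \<in> U \<times> (UNIV - {0}) \<Longrightarrow> f differentiable (at x)"
  shows "bihom U (a - 1) b (dv \<alpha> f)" "bihom U a (b - 1) (dvbar \<alpha> f)"
proof -
  have "dv \<alpha> f (z, \<zeta> *s v) = \<zeta> powi (a - 1) * cnj \<zeta> powi b * dv \<alpha> f (z, v) \<and>
      dvbar \<alpha> f (z, \<zeta> *s v) = \<zeta> powi a * cnj \<zeta> powi (b - 1) * dvbar \<alpha> f (z, v)"
    if *: "z \<in> U" "v \<noteq> 0" "\<zeta> \<noteq> 0" for z v \<zeta>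
  proof -
    have d: "f differentiable (at (z, \<zeta> *s v))"
      using assms(3)[of "(z, \<zeta> *s v)"] * vec_scale_nonzero by auto
    let ?c = "\<zeta> powi a * cnj \<zeta> powi b"
    have ax: "\<zeta> *s axis \<alpha> s = (axis \<alpha> (\<zeta> * s) :: complex^'a)" for s
      by (auto simp: vec_eq_iff axis_def)
    have ax2: "(\<Sum>\<gamma>\<in>UNIV. axis \<alpha> s $ \<gamma> * p \<gamma> + cnj (axis \<alpha> s $ \<gamma>) * q \<gamma>) = s * p \<alpha> + cnj s * q \<alpha>"
      for s and p q :: "'a \<Rightarrow> complex"
      by (simp add: axis_def sum.distrib if_distrib[of "\<lambda>x. x * _"] if_distrib[of cnj] cong: if_cong)
    have eq: "?c * frechet_derivative f (at (z, v)) (0, axis \<alpha> s) = \<zeta> * s * dv \<alpha> f (z, \<zeta> *s v) + cnj (\<zeta> * s) * dvbar \<alpha> f (z, \<zeta> *s v)" for s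
      using bihom_frechet[OF assms *, where h=0 and w="axis \<alpha> s"] unfolding ax frechet_vertical[OF d] ax2 by simp
    have e1: "?c * frechet_derivative f (at (z, v)) (0, axis \<alpha> 1)
        = \<zeta> * dv \<alpha> f (z, \<zeta> *s v) + cnj \<zeta> * dvbar \<alpha> f (z, \<zeta> *s v)"
      using eq[of 1] by simp
    have e2: "?c * frechet_derivative f (at (z, v)) (0, axis \<alpha> \<i>)
        = \<i> * (\<zeta> * dv \<alpha> f (z, \<zeta> *s v) - cnj \<zeta> * dvbar \<alpha> f (z, \<zeta> *s v))"
      using eq[of "\<i>"] by (simp add: algebra_simps)
    have "?c * dv \<alpha> f (z, v) = (?c * frechet_derivative f (at (z, v)) (0, axis \<alpha> 1)
        - \<i> * (?c * frechet_derivative f (at (z, v)) (0, axis \<alpha> \<i>))) / 2"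
      by (simp add: dv_def algebra_simps)
    then have 1: "?c * dv \<alpha> f (z, v) = \<zeta> * dv \<alpha> f (z, \<zeta> *s v)"
      unfolding e1 e2 by (simp add: field_simps)
    have "?c * dvbar \<alpha> f (z, v) = (?c * frechet_derivative f (at (z, v)) (0, axis \<alpha> 1)
        + \<i> * (?c * frechet_derivative f (at (z, v)) (0, axis \<alpha> \<i>))) / 2"
      by (simp add: dvbar_def algebra_simps)
    then have 2: "?c * dvbar \<alpha> f (z, v) = cnj \<zeta> * dvbar \<alpha> f (z, \<zeta> *s v)"
      unfolding e1 e2 by (simp add: field_simps)
    show ?thesis using 1 2 *(3) by (simp add: power_int_diff field_simps)
  qed
  then show "bihom U (a - 1) b (dv \<alpha> f)" "bihom U a (b - 1) (dvbar \<alpha> f)"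
    unfolding bihom_def by blast+
qed

text \<open>The curve \<open>t \<mapsto> exp (t s) v\<close> stays in the punctured complex line through \<open>v\<close>, where homogeneity turns \<open>f\<close>
into the exponential of \<open>t (a s + b cnj s)\<close>; take the derivative at \<open>t = 0\<close>.\<close>

lemma bihom_radial:
  fixes f :: "'n::finite coords \<Rightarrow> complex"
  assumes "bihom U a b f" "f differentiable (at (z, v))" "z \<in> U" "v \<noteq> 0"
  shows "frechet_derivative f (at (z, v)) (0, s *s v) = (of_int a * s + of_int b * cnj s) * f (z, v)"
proof -
  let ?k = "\<lambda>t::real. (z, exp (of_real t * s) *s v)"
  have e: "((\<lambda>t::real. exp (of_real t * c)) has_vector_derivative c) (at 0)" for c :: complex
  proof -
    have "((\<lambda>t. exp (t * c)) has_field_derivative c) (at (of_real 0))"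
      by (auto intro!: derivative_eq_intros)
    from has_vector_derivative_real_field[OF this] show ?thesis .
  qed
  have bl: "bounded_linear (\<lambda>c::complex. (0::complex^'n, c *s v))"
  proof -
    have "linear (\<lambda>c::complex. (0::complex^'n, c *s v))"
      by (auto simp: linear_iff vec_eq_iff algebra_simps)
    then show ?thesis using linear_conv_bounded_linear by blast
  qed
  have "((\<lambda>t::real. (0::complex^'n, exp (of_real t * s) *s v)) has_vector_derivative (0, s *s v)) (at 0)"
    using bounded_linear.has_vector_derivative[OF bl e[of s]] by simp
  then have "((\<lambda>t::real. (z, 0) + (0::complex^'n, exp (of_real t * s) *s v)) has_vector_derivative (0, s *s v)) (at 0)"
    using has_vector_derivative_add[OF has_vector_derivative_const[of "(z, 0::complex^'n)" "at 0"]] by fastforce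
  then have k: "(?k has_vector_derivative (0, s *s v)) (at 0)" by simp
  have "(f has_derivative frechet_derivative f (at (?k 0))) (at (?k 0))"
    using assms(2)[unfolded frechet_derivative_works] by simp
  from has_derivative_compose[OF k[unfolded has_vector_derivative_def] this]
  have 1: "((\<lambda>t. f (?k t)) has_vector_derivative frechet_derivative f (at (z, v)) (0, s *s v)) (at 0)"
    unfolding has_vector_derivative_def
    using linear_scale[OF linear_frechet_derivative[OF assms(2)], of _ "(0, s *s v)"] by simp
  have eqk: "f (?k t) = exp (of_real t * (of_int a * s + of_int b * cnj s)) * f (z, v)" for t
    using bihomD[OF assms(1,3,4), of "exp (of_real t * s)"]
    by (simp add: exp_power_int exp_cnj exp_add algebra_simps)
  have 2: "((\<lambda>t. f (?k t)) has_vector_derivative (of_int a * s + of_int b * cnj s) * f (z, v)) (at 0)"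
    unfolding eqk by (rule has_vector_derivative_mult_left[OF e])
  from vector_derivative_unique_at[OF 1 2] show ?thesis .
qed

text \<open>The radial derivatives in the directions \<open>v\<close> and \<open>\<i> v\<close> are the sum and \<open>\<i>\<close> times the difference of the two
contractions.\<close>

lemma euler:
  fixes f :: "'n::finite coords \<Rightarrow> complex"
  assumes "bihom U a b f" "f differentiable (at (z, v))" "z \<in> U" "v \<noteq> 0"
  shows "(\<Sum>\<alpha>\<in>UNIV. v $ \<alpha> * dv \<alpha> f (z, v)) = of_int a * f (z, v)"
    and "(\<Sum>\<alpha>\<in>UNIV. cnj (v $ \<alpha>) * dvbar \<alpha> f (z, v)) = of_int b * f (z, v)"
proof -
  let ?P = "\<Sum>\<alpha>\<in>UNIV. v $ \<alpha> * dv \<alpha> f (z, v)" and ?Q = "\<Sum>\<alpha>\<in>UNIV. cnj (v $ \<alpha>) * dvbar \<alpha> f (z, v)"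
  have eq: "s * ?P + cnj s * ?Q = (of_int a * s + of_int b * cnj s) * f (z, v)" for s
    using bihom_radial[OF assms, of s] unfolding frechet_vertical[OF assms(2)]
    by (simp add: sum.distrib sum_distrib_left mult.assoc)
  from eq[of 1] have "?P + ?Q = (of_int a + of_int b) * f (z, v)" by simp
  moreover from eq[of \<i>] have "\<i> * (?P - ?Q) = \<i> * ((of_int a - of_int b) * f (z, v))" by (simp add: algebra_simps)
  then have "?P - ?Q = (of_int a - of_int b) * f (z, v)" by simp
  ultimately have "2 * ?P = 2 * (of_int a * f (z, v))" "2 * ?Q = 2 * (of_int b * f (z, v))" by algebra+
  then show "?P = of_int a * f (z, v)" "?Q = of_int b * f (z, v)" by simp_all
qed

section \<open>Hermitian matrices\<close>

lemma sum_delta_mult [simp]: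
  fixes c :: "'k::finite \<Rightarrow> 'a::comm_semiring_1"
  shows "(\<Sum>\<sigma>\<in>UNIV. c \<sigma> * (if \<sigma> = \<alpha> then 1 else 0)) = c \<alpha>"
    "(\<Sum>\<sigma>\<in>UNIV. c \<sigma> * (if \<alpha> = \<sigma> then 1 else 0)) = c \<alpha>"
    "(\<Sum>\<sigma>\<in>UNIV. (if \<sigma> = \<alpha> then 1 else 0) * c \<sigma>) = c \<alpha>"
    "(\<Sum>\<sigma>\<in>UNIV. (if \<alpha> = \<sigma> then 1 else 0) * c \<sigma>) = c \<alpha>"
  by (simp_all add: if_distrib[of "\<lambda>x. _ * x"] if_distrib[of "\<lambda>x. x * _"] cong: if_cong)

lemma sum_if_const: "(\<Sum>\<beta>\<in>A. if P then f \<beta> else 0) = (if P then (\<Sum>\<beta>\<in>A. f \<beta>) else 0)"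
  by simp

text \<open>Polarization with the vectors \<open>e\<^sub>a + e\<^sub>b\<close> and \<open>e\<^sub>a + \<i> e\<^sub>b\<close>.\<close>

lemma hermitian_of_real_form:
  fixes M :: "'n::finite \<Rightarrow> 'n \<Rightarrow> complex"
  assumes "\<And>\<xi>::complex^'n. Im (\<Sum>\<alpha>\<in>UNIV. \<Sum>\<beta>\<in>UNIV. M \<alpha> \<beta> * \<xi> $ \<alpha> * cnj (\<xi> $ \<beta>)) = 0"
  shows "cnj (M a b) = M b a"
proof -
  have q: "(\<Sum>\<alpha>\<in>UNIV. \<Sum>\<beta>\<in>UNIV. M \<alpha> \<beta> * (axis a 1 + axis b s :: complex^'n) $ \<alpha> * cnj ((axis a 1 + axis b s :: complex^'n) $ \<beta>))
     = M a a + M a b * cnj s + M b a * s + M b b * s * cnj s" for s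
    by (simp add: axis_def sum.distrib algebra_simps if_distrib[of "\<lambda>x. x * _"] if_distrib[of "\<lambda>x. _ * x"]
        if_distrib[of cnj] sum_if_const cong: if_cong)
  have q1: "(\<Sum>\<alpha>\<in>UNIV. \<Sum>\<beta>\<in>UNIV. M \<alpha> \<beta> * (axis a 1 :: complex^'n) $ \<alpha> * cnj ((axis a 1 :: complex^'n) $ \<beta>)) = M a a" for a
    by (simp add: axis_def algebra_simps if_distrib[of "\<lambda>x. x * _"] if_distrib[of "\<lambda>x. _ * x"]
        if_distrib[of cnj] sum_if_const cong: if_cong)
  have d: "Im (M c c) = 0" for c using assms[of "axis c 1"] unfolding q1 .
  have "Im (M a a + M a b * cnj s + M b a * s + M b b * s * cnj s) = 0" for s
    using assms[of "axis a 1 + axis b s"] unfolding q .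
  from this[of 1] this[of \<i>] d show ?thesis by (simp add: complex_eq_iff)
qed

lemma matrix_inv_unique:
  fixes A :: "'a::field^'n^'n"
  assumes "B ** A = mat 1"
  shows "matrix_inv A = B" "A ** B = mat 1"
proof -
  show 1: "A ** B = mat 1" using assms matrix_left_right_inverse by blast
  have "A ** matrix_inv A = mat 1 \<and> matrix_inv A ** A = mat 1"
    unfolding matrix_inv_def by (rule someI[of _ B]) (use 1 assms in simp)
  then have "B ** (A ** matrix_inv A) = B" by simp
  then show "matrix_inv A = B" by (simp add: matrix_mul_assoc assms)
qed

section \<open>A Finsler metric in a chart\<close>

text \<open>The function \<open>g\<close> is the expression of \<open>G = F\<^sup>2\<close> in a chart with image \<open>U\<close>.\<close>

locale finsler_chart =
  fixes U :: "(complex^'n::finite) set" and g :: "'n coords \<Rightarrow> real"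
  assumes open_U: "open U"
    and smooth_g: "smooth_on (U \<times> (UNIV - {0})) g"
    and g_pos: "\<And>x. x \<in> U \<times> (UNIV - {0}) \<Longrightarrow> 0 < g x"
    and g_hom: "\<And>z v \<zeta>. z \<in> U \<Longrightarrow> v \<noteq> 0 \<Longrightarrow> \<zeta> \<noteq> 0 \<Longrightarrow> g (z, \<zeta> *s v) = (cmod \<zeta>)\<^sup>2 * g (z, v)"
    and pos_def: "\<And>x \<xi>. x \<in> U \<times> (UNIV - {0}) \<Longrightarrow> \<xi> \<noteq> 0 \<Longrightarrow>
      0 < (\<Sum>\<alpha>\<in>UNIV. \<Sum>\<beta>\<in>UNIV. Gm g \<alpha> \<beta> x * \<xi> $ \<alpha> * cnj (\<xi> $ \<beta>))"
begin

abbreviation "S \<equiv> U \<times> (UNIV - {0::complex^'n})"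

abbreviation "G \<equiv> \<lambda>x. complex_of_real (g x)"

lemma open_S: "open S" by (rule open_slit[OF open_U])

lemma smooth_G: "smooth_on S G" by (rule smooth_on_of_real[OF open_S smooth_g])

lemma smooth_Gm: "smooth_on S (Gm g \<alpha> \<beta>)"
  unfolding Gm_def by (intro smooth_on_dv smooth_on_dvbar smooth_G open_S)

lemma bihom_G: "bihom U 1 1 G"
  unfolding bihom_def by (auto simp: g_hom complex_norm_square[unfolded of_real_power])

lemma bihom_dvbar_G: "bihom U 1 0 (dvbar \<beta> G)"
  using bihom_dv(2)[OF open_U bihom_G smooth_on_differentiable[OF smooth_G]] by simp

lemma bihom_Gm: "bihom U 0 0 (Gm g \<alpha> \<beta>)"
  unfolding Gm_def
  using bihom_dv(1)[OF open_U bihom_dvbar_G smooth_on_differentiable[OF smooth_on_dvbar[OF open_S smooth_G]]] by simp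

text \<open>Positivity in the order of the complex numbers includes that the quadratic form is real-valued.\<close>

lemma Gm_hermitian:
  assumes "x \<in> S"
  shows "cnj (Gm g \<alpha> \<beta> x) = Gm g \<beta> \<alpha> x"
proof (rule hermitian_of_real_form)
  fix \<xi> :: "complex^'n"
  show "Im (\<Sum>\<alpha>\<in>UNIV. \<Sum>\<beta>\<in>UNIV. Gm g \<alpha> \<beta> x * \<xi> $ \<alpha> * cnj (\<xi> $ \<beta>)) = 0"
    using pos_def[OF assms, of \<xi>] by (cases "\<xi> = 0") (simp_all add: less_complex_def)
qed

definition Gmat :: "'n coords \<Rightarrow> complex^'n^'n" where
  "Gmat x = (\<chi> \<alpha> \<beta>. Gm g \<alpha> \<beta> x)"

lemma Ginv_Gmat: "Ginv g \<beta> \<alpha> x = matrix_inv (Gmat x) $ \<beta> $ \<alpha>"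
  by (simp add: Ginv_def Gmat_def)

lemma invertible_Gmat:
  assumes "x \<in> S"
  shows "invertible (Gmat x)"
proof -
  have "w = 0" if "Gmat x *v w = 0" for w
  proof (rule ccontr)
    assume "w \<noteq> 0"
    then have nz: "(\<chi> i. cnj (w $ i)) \<noteq> 0" by (auto simp: vec_eq_iff)
    have "(\<Sum>\<beta>\<in>UNIV. Gm g \<alpha> \<beta> x * cnj (w $ \<alpha>) * w $ \<beta>) = cnj (w $ \<alpha>) * (Gmat x *v w) $ \<alpha>" for \<alpha>
      by (simp add: Gmat_def matrix_vector_mult_def sum_distrib_left mult_ac)
    then have "(\<Sum>\<alpha>\<in>UNIV. \<Sum>\<beta>\<in>UNIV. Gm g \<alpha> \<beta> x * (\<chi> i. cnj (w $ i)) $ \<alpha> * cnj ((\<chi> i. cnj (w $ i)) $ \<beta>)) = 0"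
      by (simp add: that)
    with pos_def[OF assms nz] show False by simp
  qed
  then show ?thesis
    unfolding invertible_left_inverse matrix_left_invertible_ker by blast
qed

lemma det_Gmat: "x \<in> S \<Longrightarrow> det (Gmat x) \<noteq> 0"
  using invertible_Gmat invertible_det_nz by blast

lemma Ginv_left:
  assumes "x \<in> S"
  shows "(\<Sum>\<alpha>\<in>UNIV. Ginv g \<beta> \<alpha> x * Gm g \<alpha> \<gamma> x) = (if \<beta> = \<gamma> then 1 else 0)"
proof -
  obtain B where B: "B ** Gmat x = mat 1"
    using invertible_Gmat[OF assms] invertible_left_inverse by blast
  have "matrix_inv (Gmat x) ** Gmat x = mat 1" using matrix_inv_unique(1)[OF B] B by simp
  then have "(matrix_inv (Gmat x) ** Gmat x) $ \<beta> $ \<gamma> = mat 1 $ \<beta> $ \<gamma>" by simp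
  then show ?thesis by (simp add: matrix_matrix_mult_def Ginv_Gmat mat_def Gmat_def split: if_splits)
qed

lemma Ginv_right:
  assumes "x \<in> S"
  shows "(\<Sum>\<beta>\<in>UNIV. Gm g \<alpha> \<beta> x * Ginv g \<beta> \<gamma> x) = (if \<alpha> = \<gamma> then 1 else 0)"
proof -
  obtain B where B: "B ** Gmat x = mat 1"
    using invertible_Gmat[OF assms] invertible_left_inverse by blast
  have "Gmat x ** matrix_inv (Gmat x) = mat 1" using matrix_inv_unique[OF B] by simp
  then have "(Gmat x ** matrix_inv (Gmat x)) $ \<alpha> $ \<gamma> = mat 1 $ \<alpha> $ \<gamma>" by simp
  then show ?thesis by (simp add: matrix_matrix_mult_def Ginv_Gmat mat_def Gmat_def split: if_splits)
qed

lemma Ginv_contract: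
  assumes "x \<in> S"
  shows "(\<Sum>l\<in>UNIV. Ginv g l \<alpha> x * (\<Sum>\<sigma>\<in>UNIV. c \<sigma> * Gm g \<sigma> l x)) = c \<alpha>"
proof -
  have "(\<Sum>l\<in>UNIV. Ginv g l \<alpha> x * (\<Sum>\<sigma>\<in>UNIV. c \<sigma> * Gm g \<sigma> l x))
      = (\<Sum>\<sigma>\<in>UNIV. c \<sigma> * (\<Sum>l\<in>UNIV. Gm g \<sigma> l x * Ginv g l \<alpha> x))"
    unfolding sum_distrib_left by (subst sum.swap) (simp add: mult_ac)
  also have "\<dots> = c \<alpha>" by (simp add: Ginv_right[OF assms])
  finally show ?thesis .
qed

lemma smooth_det:
  assumes "\<And>i j. smooth_on S (\<lambda>x. M x $ i $ j)"
  shows "smooth_on S (\<lambda>x. det (M x :: complex^'n^'n))"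
  unfolding det_def by (intro smooth_intros open_S assms)

text \<open>By Cramer's rule the entries of the inverse are quotients of determinants of smooth functions.\<close>

lemma smooth_Ginv: "smooth_on S (Ginv g \<beta> \<alpha>)"
proof -
  define N where "N x = (\<chi> i j. if j = \<beta> then axis \<alpha> 1 $ i else Gmat x $ i $ j)" for x
  have "smooth_on S (\<lambda>x. Gmat x $ i $ j)" for i j
    using smooth_Gm by (simp add: Gmat_def)
  moreover from this have "smooth_on S (\<lambda>x. N x $ i $ j)" for i j
    by (cases "j = \<beta>") (simp_all add: N_def smooth_on_const[OF open_S])
  ultimately have "smooth_on S (\<lambda>x. det (N x) * inverse (det (Gmat x)))"
    using det_Gmat open_S by (intro smooth_on_mult smooth_on_inverse smooth_det) auto
  then show ?thesis
  proof (rule smooth_on_cong_imp[OF open_S, rotated])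
    fix x assume x: "x \<in> S"
    obtain B where B: "B ** Gmat x = mat 1"
      using invertible_Gmat[OF x] invertible_left_inverse by blast
    have "Gmat x *v (B *v axis \<alpha> 1) = axis \<alpha> 1"
      by (simp add: matrix_vector_mul_assoc matrix_inv_unique(2)[OF B])
    with cramer[of "Gmat x"] invertible_Gmat[OF x] invertible_det_nz
    have "B *v axis \<alpha> 1 = (\<chi> k. det (\<chi> i j. if j = k then axis \<alpha> 1 $ i else Gmat x $ i $ j) / det (Gmat x))" by blast
    then have "(B *v axis \<alpha> 1) $ \<beta> = det (N x) / det (Gmat x)"
      by (simp add: N_def)
    then show "det (N x) * inverse (det (Gmat x)) = Ginv g \<beta> \<alpha> x"
      by (simp add: Ginv_Gmat matrix_inv_unique(1)[OF B] divide_inverse matrix_vector_mul_component inner_axis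
          matrix_vector_mult_def axis_def if_distrib[of "\<lambda>x. _ * x"] cong: if_cong)
  qed
qed

lemma smooth_Gam: "smooth_on S (Gam g \<alpha> \<mu>)"
  unfolding Gam_def[abs_def] by (intro smooth_intros smooth_Ginv smooth_on_dvbar smooth_on_dz smooth_g open_S)

lemma smooth_delta: "smooth_on S f \<Longrightarrow> smooth_on S (delta g \<mu> f)"
  unfolding delta_def[abs_def] by (intro smooth_intros smooth_Gam smooth_on_dv smooth_on_dz open_S)

lemma smooth_deltabar: "smooth_on S f \<Longrightarrow> smooth_on S (deltabar g \<mu> f)"
  unfolding deltabar_def[abs_def] by (intro smooth_intros smooth_Gam smooth_on_dvbar smooth_on_dzbar open_S)

lemma smooth_GamH: "smooth_on S (GamH g \<alpha> \<beta> \<mu>)"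
  unfolding GamH_def[abs_def] by (intro smooth_intros smooth_Ginv smooth_delta smooth_Gm open_S)

lemma smooth_GamV: "smooth_on S (GamV g \<alpha> \<beta> \<mu>)"
  unfolding GamV_def[abs_def] by (intro smooth_intros smooth_Ginv smooth_on_dv smooth_Gm open_S)

lemma smooth_scal: "smooth_on S (scal g)"
  unfolding scal_def[abs_def] Omega_low_def Omega_def
  by (intro smooth_intros smooth_Ginv smooth_deltabar smooth_Gm smooth_GamV smooth_GamH smooth_Gam open_S)

lemmas differentiable_basics = smooth_on_differentiable[OF smooth_G] smooth_on_differentiable[OF smooth_Gm]
  smooth_on_differentiable[OF smooth_Gam] smooth_on_differentiable[OF smooth_GamH]
  smooth_on_differentiable[OF smooth_on_dvbar[OF open_S smooth_G]]
  smooth_on_differentiable[OF smooth_on_dz(1)[OF open_S smooth_G]]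
  smooth_on_differentiable[OF smooth_on_dv[OF open_S smooth_Gm]]

lemma bihom_Ginv: "bihom U 0 0 (Ginv g \<beta> \<alpha>)"
proof -
  have "Gmat (z, \<zeta> *s v) = Gmat (z, v)" if "z \<in> U" "v \<noteq> 0" "\<zeta> \<noteq> 0" for z v \<zeta>
    using bihomD[OF bihom_Gm that] by (simp add: Gmat_def)
  then show ?thesis by (simp add: bihom_def Ginv_Gmat)
qed

text \<open>The bidegrees of \<open>G\<close>, its derivatives and the connection coefficients are the reason why a conformal
factor on the base changes the curvature so little: by Euler's identities, a coefficient of degree \<open>0\<close> in
\<open>v\<close> or in \<open>cnj v\<close> has vanishing radial derivative of the respective type.\<close>

lemma bihom_Gam: "bihom U 1 0 (Gam g \<alpha> \<mu>)"
proof -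
  have "bihom U 1 0 (dvbar l (dz \<mu> G))" for l
    using bihom_dv(2)[OF open_U bihom_dz(1)[OF open_U bihom_G differentiable_basics(1)] differentiable_basics(6)] by simp
  from bihom_sum[OF bihom_mult[OF bihom_Ginv this]] show ?thesis by (simp add: Gam_def[abs_def])
qed

lemma bihom_GamH: "bihom U 0 0 (GamH g \<alpha> \<beta> \<mu>)"
proof -
  have 1: "bihom U 0 0 (dz \<mu> (Gm g \<beta> l))" for l by (rule bihom_dz[OF open_U bihom_Gm differentiable_basics(2)])
  have 2: "bihom U (-1) 0 (dv \<alpha> (Gm g \<beta> l))" for \<alpha> l
    using bihom_dv(1)[OF open_U bihom_Gm differentiable_basics(2)] by simp
  have "bihom U 0 0 (delta g \<mu> (Gm g \<beta> l))" for l
    using bihom_diff[OF 1[of l] bihom_sum[OF bihom_mult[OF bihom_Gam 2], simplified]] by (simp add: delta_def[abs_def])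
  from bihom_sum[OF bihom_mult[OF bihom_Ginv this]] show ?thesis by (simp add: GamH_def[abs_def])
qed

lemma slit_cases:
  assumes "x \<in> S" obtains z v where "x = (z, v)" "z \<in> U" "v \<noteq> 0"
  using assms by auto

lemma Gm_radial: "x \<in> S \<Longrightarrow> (\<Sum>\<sigma>\<in>UNIV. snd x $ \<sigma> * Gm g \<sigma> l x) = dvbar l G x"
  by (erule slit_cases) (use euler(1)[OF bihom_dvbar_G differentiable_basics(5)] in \<open>simp add: Gm_def\<close>)

lemma G_radial: "x \<in> S \<Longrightarrow> (\<Sum>\<sigma>\<in>UNIV. cnj (snd x $ \<sigma>) * dvbar \<sigma> G x) = G x"
  "x \<in> S \<Longrightarrow> (\<Sum>\<sigma>\<in>UNIV. snd x $ \<sigma> * dv \<sigma> G x) = G x"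
  by (erule slit_cases, use euler[OF bihom_G differentiable_basics(1)] in simp)+

lemma dv_Gm_radial: "x \<in> S \<Longrightarrow> (\<Sum>\<sigma>\<in>UNIV. snd x $ \<sigma> * dv \<sigma> (Gm g \<beta> l) x) = 0"
  by (erule slit_cases) (use euler(1)[OF bihom_Gm differentiable_basics(2)] in simp)

lemma GamV_radial: 
  assumes "x \<in> S" shows "(\<Sum>\<gamma>\<in>UNIV. GamV g \<alpha> \<beta> \<gamma> x * snd x $ \<gamma>) = 0"
proof -
  have "(\<Sum>\<gamma>\<in>UNIV. GamV g \<alpha> \<beta> \<gamma> x * snd x $ \<gamma>)
     = (\<Sum>l\<in>UNIV. Ginv g l \<alpha> x * (\<Sum>\<gamma>\<in>UNIV. snd x $ \<gamma> * dv \<gamma> (Gm g \<beta> l) x))"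
    unfolding GamV_def sum_distrib_left sum_distrib_right by (subst sum.swap) (simp add: mult_ac)
  then show ?thesis by (simp add: dv_Gm_radial[OF assms])
qed

lemma dvbar_Gam_radial: "x \<in> S \<Longrightarrow> (\<Sum>\<sigma>\<in>UNIV. cnj (snd x $ \<sigma>) * dvbar \<sigma> (Gam g \<alpha> \<mu>) x) = 0"
  by (erule slit_cases) (use euler(2)[OF bihom_Gam differentiable_basics(3)] in simp)

lemma dvbar_GamH_radial: "x \<in> S \<Longrightarrow> (\<Sum>\<sigma>\<in>UNIV. cnj (snd x $ \<sigma>) * dvbar \<sigma> (GamH g \<alpha> \<beta> \<mu>) x) = 0"
  by (erule slit_cases) (use euler(2)[OF bihom_GamH differentiable_basics(4)] in simp)

text \<open>The trace of the complex Hessian of \<open>f\<close> with respect to \<open>G\<close>.\<close>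

definition "lap f x = (\<Sum>\<mu>\<in>UNIV. \<Sum>\<nu>\<in>UNIV. Ginv g \<nu> \<mu> x * dzbar \<nu> (dz \<mu> f) x)"

lemma smooth_lap: "smooth_on S f \<Longrightarrow> smooth_on S (lap f)"
  unfolding lap_def[abs_def] by (intro smooth_intros smooth_Ginv smooth_on_dz smooth_on_dzbar open_S)

end

section \<open>Conformal change in a chart\<close>

locale conformal_chart = finsler_chart U g for U :: "(complex^'n::finite) set" and g :: "'n coords \<Rightarrow> real" +
  fixes r :: "complex^'n \<Rightarrow> real"
  assumes smooth_r: "smooth_on U r"
begin

definition "conf_g x = exp (r (fst x)) * g x"

definition "rho x = complex_of_real (r (fst x))"

definition "R x = complex_of_real (exp (r (fst x)))"

lemma smooth_rho: "smooth_on S rho"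
  using smooth_on_of_real[OF open_S smooth_on_fst[OF open_U _ smooth_r]] by (auto simp: rho_def[abs_def])

lemma smooth_R: "smooth_on S R"
  using smooth_on_of_real[OF open_S smooth_on_exp[OF open_S smooth_on_fst[OF open_U _ smooth_r]]]
  by (auto simp: R_def[abs_def])

lemma R_nz [simp]: "R x \<noteq> 0"
  by (simp add: R_def)

text \<open>The factors \<open>R\<close> of the conformal \<open>G\<^sub>\<alpha>\<^sub>\<beta>\<close> and of its inverse cancel in every coefficient of the connection.\<close>

lemma R_cancel [simp]:
  "inverse (R x) * a * (R x * b) = a * b" "inverse (R x) * (a * (R x * b)) = a * b"
  "R x * (inverse (R x) * a) = a"
  by simp_all

lemma conf_G: "complex_of_real (conf_g x) = R x * G x"
  by (simp add: conf_g_def R_def)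

lemma dv_R: "x \<in> S \<Longrightarrow> dv \<alpha> R x = 0" "x \<in> S \<Longrightarrow> dvbar \<alpha> R x = 0"
  and dv_rho: "x \<in> S \<Longrightarrow> dv \<alpha> rho x = 0" "x \<in> S \<Longrightarrow> dvbar \<alpha> rho x = 0"
proof -
  have "(\<lambda>z. complex_of_real (exp (r z))) differentiable at (fst x)"
    "(\<lambda>z. complex_of_real (r z)) differentiable at (fst x)" if "x \<in> S" for x
    using smooth_on_differentiable[OF smooth_on_of_real[OF open_U]] smooth_on_exp[OF open_U] smooth_r that open_U by auto
  then show "x \<in> S \<Longrightarrow> dv \<alpha> R x = 0" "x \<in> S \<Longrightarrow> dvbar \<alpha> R x = 0"
   "x \<in> S \<Longrightarrow> dv \<alpha> rho x = 0" "x \<in> S \<Longrightarrow> dvbar \<alpha> rho x = 0"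
    unfolding R_def[abs_def] rho_def[abs_def]
    using dv_base[of "\<lambda>z. complex_of_real (exp (r z))"] dvbar_base[of "\<lambda>z. complex_of_real (exp (r z))"]
      dv_base[of "\<lambda>z. complex_of_real (r z)"] dvbar_base[of "\<lambda>z. complex_of_real (r z)"] by blast+
qed

lemma dv_dz_rho: "x \<in> S \<Longrightarrow> dv \<alpha> (dz \<mu> rho) x = 0" "x \<in> S \<Longrightarrow> dvbar \<alpha> (dz \<mu> rho) x = 0"
proof -
  define h where "h z = (frechet_derivative (\<lambda>z. complex_of_real (r z)) (at z) (axis \<mu> 1)
     - \<i> * frechet_derivative (\<lambda>z. complex_of_real (r z)) (at z) (axis \<mu> \<i>)) * inverse 2" for z
  have sr: "smooth_on U (\<lambda>z. complex_of_real (r z))"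
    by (rule smooth_on_of_real[OF open_U smooth_r])
  have sh: "smooth_on U h" unfolding h_def[abs_def]
    by (intro smooth_intros smooth_on_derivative open_U smooth_r)
  have eq: "dz \<mu> rho y = h (fst y)" if "y \<in> S" for y
    unfolding dz_def rho_def[abs_def] h_def
    using that smooth_on_differentiable[OF sr, of "fst y"]
    by (auto simp: frechet_base[of "\<lambda>z. complex_of_real (r z)"])
  have d: "dz \<mu> rho differentiable at x" if "x \<in> S" for x
    by (rule smooth_on_differentiable[OF smooth_on_dz[OF open_S smooth_rho] that])
  show "dv \<alpha> (dz \<mu> rho) x = 0" if x: "x \<in> S"
    using derivation_cong[OF derivation_dv open_S x eq d[OF x], of \<alpha>] dv_base[OF smooth_on_differentiable[OF sh], of x \<alpha>] x
    by auto
  show "dvbar \<alpha> (dz \<mu> rho) x = 0" if x: "x \<in> S"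
    using derivation_cong[OF derivation_dvbar open_S x eq d[OF x], of \<alpha>] dvbar_base[OF smooth_on_differentiable[OF sh], of x \<alpha>] x
    by auto
qed

lemmas diff_R = smooth_on_differentiable[OF smooth_R]
lemmas diff_dz_rho = smooth_on_differentiable[OF smooth_on_dz[OF open_S smooth_rho]]

lemma derivation_R: "derivation P \<Longrightarrow> x \<in> S \<Longrightarrow> P R x = R x * P rho x"
  unfolding R_def[abs_def] rho_def[abs_def]
  using derivation_chain_real[of P "\<lambda>x. r (fst x)" x exp "exp (r (fst x))"] 
    smooth_on_differentiable[OF smooth_on_fst[OF open_U _ smooth_r], of UNIV x]
  by auto

text \<open>With \<open>P rho x = 0\<close> for vertical \<open>P\<close>, the factor \<open>R\<close> passes through all derivatives along the fibres.\<close>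

lemma derivation_R_mult:
  "derivation P \<Longrightarrow> x \<in> S \<Longrightarrow> f differentiable (at x) \<Longrightarrow> P (\<lambda>x. R x * f x) x = R x * (P f x + P rho x * f x)"
  by (simp add: derivation_mult diff_R derivation_R algebra_simps)

lemma dvbar_conf: "x \<in> S \<Longrightarrow> dvbar l (\<lambda>x. complex_of_real (conf_g x)) x = R x * dvbar l G x"
  using derivation_R_mult[OF derivation_dvbar _ differentiable_basics(1), of x l] by (simp add: conf_G dv_rho)

lemma Gm_conf: "x \<in> S \<Longrightarrow> Gm conf_g \<alpha> \<beta> x = R x * Gm g \<alpha> \<beta> x"
proof -
  assume x: "x \<in> S"
  have "Gm conf_g \<alpha> \<beta> x = dv \<alpha> (\<lambda>x. R x * dvbar \<beta> G x) x"
    unfolding Gm_def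
    by (rule derivation_cong[OF derivation_dv open_S x, symmetric])
      (use dvbar_conf smooth_on_differentiable[OF smooth_on_mult[OF open_S smooth_R smooth_on_dvbar[OF open_S smooth_G]] x] in simp_all)
  then show ?thesis using x by (simp add: derivation_R_mult differentiable_basics dv_rho Gm_def)
qed

lemma Ginv_conf: 
  assumes x: "x \<in> S"
  shows "Ginv conf_g \<beta> \<alpha> x = inverse (R x) * Ginv g \<beta> \<alpha> x"
proof -
  define B where "B = (\<chi> i j. inverse (R x) * Ginv g i j x)"
  have "(B ** (\<chi> \<alpha> \<beta>. Gm conf_g \<alpha> \<beta> x)) $ i $ j = mat 1 $ i $ j" for i j
    using Ginv_left[OF x, of i j] by (simp add: matrix_matrix_mult_def B_def Gm_conf[OF x] mat_def del: mult.assoc)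
  then have "B ** (\<chi> \<alpha> \<beta>. Gm conf_g \<alpha> \<beta> x) = mat 1" by (simp add: vec_eq_iff)
  from matrix_inv_unique(1)[OF this] show ?thesis by (simp add: Ginv_def B_def)
qed

text \<open>The additional term of \<open>\<partial>\<^sub>\<mu> (R G)\<close> is \<open>R \<rho>\<^sub>\<mu> G\<close>. Its vertical derivatives are \<open>R \<rho>\<^sub>\<mu> G\<^sub>\<lambda>\<close> with barred \<open>\<lambda>\<close>,
and raising the index gives \<open>\<rho>\<^sub>\<mu> v\<close> by homogeneity. So \<open>delta\<close> changes by a multiple of the radial derivative.\<close>

lemma Gam_conf:
  assumes x: "x \<in> S"
  shows "Gam conf_g \<alpha> \<mu> x = Gam g \<alpha> \<mu> x + dz \<mu> rho x * snd x $ \<alpha>"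
proof -
  have eq: "dz \<mu> (\<lambda>x. complex_of_real (conf_g x)) y = R y * (dz \<mu> G y + dz \<mu> rho y * G y)" if "y \<in> S" for y
    using derivation_R_mult[OF derivation_dz that differentiable_basics(1)[OF that]] by (simp add: conf_G)
  have s: "smooth_on S (\<lambda>y. dz \<mu> G y + dz \<mu> rho y * G y)"
    by (intro smooth_on_add smooth_on_mult smooth_on_dz smooth_G smooth_rho open_S)
  have "dvbar l (dz \<mu> (\<lambda>x. complex_of_real (conf_g x))) x = dvbar l (\<lambda>y. R y * (dz \<mu> G y + dz \<mu> rho y * G y)) x" for l
    by (rule derivation_cong[OF derivation_dvbar open_S x, symmetric])
      (use eq smooth_on_differentiable[OF smooth_on_mult[OF open_S smooth_R s] x] in simp_all)
  also have "\<dots> l = R x * (dvbar l (dz \<mu> G) x + dz \<mu> rho x * dvbar l G x)" for l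
  proof -
    have "dvbar l (\<lambda>y. R y * (dz \<mu> G y + dz \<mu> rho y * G y)) x = R x * dvbar l (\<lambda>y. dz \<mu> G y + dz \<mu> rho y * G y) x"
      using derivation_R_mult[OF derivation_dvbar x smooth_on_differentiable[OF s x]] by (simp add: dv_rho(2)[OF x])
    also have "dvbar l (\<lambda>y. dz \<mu> G y + dz \<mu> rho y * G y) x
        = dvbar l (dz \<mu> G) x + dvbar l (\<lambda>y. dz \<mu> rho y * G y) x"
      by (rule derivation_add[OF derivation_dvbar differentiable_basics(6)[OF x] differentiable_mult[OF diff_dz_rho[OF x] differentiable_basics(1)[OF x]]])
    also have "dvbar l (\<lambda>y. dz \<mu> rho y * G y) x = dz \<mu> rho x * dvbar l G x"
      using derivation_mult[OF derivation_dvbar diff_dz_rho[OF x] differentiable_basics(1)[OF x]] by (simp add: dv_dz_rho(2)[OF x])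
    finally show ?thesis .
  qed
  finally have "Ginv conf_g l \<alpha> x * dvbar l (dz \<mu> (\<lambda>x. complex_of_real (conf_g x))) x
     = Ginv g l \<alpha> x * dvbar l (dz \<mu> G) x + dz \<mu> rho x * (Ginv g l \<alpha> x * dvbar l G x)" for l
    by (simp add: Ginv_conf[OF x]) (simp add: algebra_simps)
  then have "Gam conf_g \<alpha> \<mu> x = Gam g \<alpha> \<mu> x + dz \<mu> rho x * (\<Sum>l\<in>UNIV. Ginv g l \<alpha> x * dvbar l G x)"
    by (simp add: Gam_def sum.distrib sum_distrib_left)
  also have "(\<Sum>l\<in>UNIV. Ginv g l \<alpha> x * dvbar l G x) = snd x $ \<alpha>"
    using Ginv_contract[OF x, of \<alpha> "\<lambda>\<sigma>. snd x $ \<sigma>"] by (simp add: Gm_radial[OF x])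
  finally show ?thesis .
qed

lemma delta_conf:
  assumes x: "x \<in> S"
  shows "delta conf_g \<mu> f x = delta g \<mu> f x - dz \<mu> rho x * (\<Sum>\<alpha>\<in>UNIV. snd x $ \<alpha> * dv \<alpha> f x)"
  by (simp add: delta_def Gam_conf[OF x] algebra_simps sum.distrib sum_distrib_left)

lemma deltabar_conf:
  assumes x: "x \<in> S"
  shows "deltabar conf_g \<mu> f x = deltabar g \<mu> f x - cnj (dz \<mu> rho x) * (\<Sum>\<alpha>\<in>UNIV. cnj (snd x $ \<alpha>) * dvbar \<alpha> f x)"
  by (simp add: deltabar_def Gam_conf[OF x] algebra_simps sum.distrib sum_distrib_left)

text \<open>The radial derivative of \<open>G\<^sub>\<beta>\<^sub>\<lambda>\<close> vanishes, hence only the derivative of the conformal factor contributes.\<close>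

lemma GamH_conf:
  assumes x: "x \<in> S"
  shows "GamH conf_g \<alpha> \<beta> \<mu> x = GamH g \<alpha> \<beta> \<mu> x + dz \<mu> rho x * (if \<alpha> = \<beta> then 1 else 0)"
proof -
  have d_rho: "delta conf_g \<mu> rho x = dz \<mu> rho x"
    by (simp add: delta_def dv_rho[OF x])
  have "delta conf_g \<mu> (Gm conf_g \<beta> l) x = delta conf_g \<mu> (\<lambda>x. R x * Gm g \<beta> l x) x" for l
    by (rule derivation_cong[OF derivation_delta open_S x, symmetric])
      (use Gm_conf smooth_on_differentiable[OF smooth_on_mult[OF open_S smooth_R smooth_Gm] x] in simp_all)
  also have "\<dots> l = R x * (delta g \<mu> (Gm g \<beta> l) x + dz \<mu> rho x * Gm g \<beta> l x)" for l
    using x by (simp add: derivation_R_mult differentiable_basics d_rho) (simp add: delta_conf dv_Gm_radial)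
  finally have "Ginv conf_g l \<alpha> x * delta conf_g \<mu> (Gm conf_g \<beta> l) x
     = Ginv g l \<alpha> x * delta g \<mu> (Gm g \<beta> l) x + dz \<mu> rho x * (Gm g \<beta> l x * Ginv g l \<alpha> x)" for l
    by (simp add: Ginv_conf[OF x]) (simp add: algebra_simps)
  then have "GamH conf_g \<alpha> \<beta> \<mu> x = GamH g \<alpha> \<beta> \<mu> x + dz \<mu> rho x * (\<Sum>l\<in>UNIV. Gm g \<beta> l x * Ginv g l \<alpha> x)"
    by (simp add: GamH_def sum.distrib sum_distrib_left)
  then show ?thesis by (simp add: Ginv_right[OF x])
qed

lemma GamV_conf:
  assumes x: "x \<in> S"
  shows "GamV conf_g \<alpha> \<beta> \<gamma> x = GamV g \<alpha> \<beta> \<gamma> x"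
proof -
  have "dv \<gamma> (Gm conf_g \<beta> l) x = dv \<gamma> (\<lambda>x. R x * Gm g \<beta> l x) x" for l
    by (rule derivation_cong[OF derivation_dv open_S x, symmetric])
      (use Gm_conf smooth_on_differentiable[OF smooth_on_mult[OF open_S smooth_R smooth_Gm] x] in simp_all)
  also have "\<dots> l = R x * dv \<gamma> (Gm g \<beta> l) x" for l
    using x by (simp add: derivation_R_mult differentiable_basics dv_rho)
  finally show ?thesis by (simp add: GamV_def Ginv_conf[OF x])
qed

abbreviation "hess \<mu> \<nu> \<equiv> dzbar \<nu> (dz \<mu> rho)"

lemma deltabar_dz_rho: "x \<in> S \<Longrightarrow> deltabar g \<nu> (dz \<mu> rho) x = hess \<mu> \<nu> x"
  by (simp add: deltabar_def dv_dz_rho)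

lemma deltabar_fibre_coord: "deltabar g \<nu> (\<lambda>x. snd x $ \<alpha>) x = 0"
  by (simp add: deltabar_def fibre_coord_derivs)

lemma smooth_fibre_coord: "smooth_on S (\<lambda>x. snd x $ \<alpha>)"
proof -
  have "Ck_on k S (\<lambda>x. snd x $ \<alpha>)" for k
  proof (cases k)
    case 0 then show ?thesis by (auto intro!: continuous_intros)
  next
    case (Suc m)
    then show ?thesis
      by (auto simp: frechet_fibre_coord fibre_coord_differentiable Ck_on_const[OF open_S])
  qed
  then show ?thesis by (simp add: smooth_on_def)
qed

text \<open>Both connection coefficients have degree \<open>0\<close> in \<open>cnj v\<close>, so \<open>deltabar\<close> acts on them as before the
conformal change. Their additional terms contribute the complex Hessian of \<open>\<rho>\<close>, multiplied by the identity and
by \<open>v\<close>, respectively; the latter is annihilated by \<open>GamV\<close>.\<close>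

lemma Omega_conf:
  assumes x: "x \<in> S"
  shows "Omega conf_g \<alpha> \<beta> \<mu> \<nu> x = Omega g \<alpha> \<beta> \<mu> \<nu> x - hess \<mu> \<nu> x * (if \<alpha> = \<beta> then 1 else 0)"
proof -
  let ?d = "if \<alpha> = \<beta> then 1 else 0 :: complex"
  note sd = smooth_on_differentiable
  have s1: "smooth_on S (\<lambda>x. dz \<mu> rho x * ?d)"
    by (intro smooth_on_mult smooth_on_dz smooth_rho open_S smooth_on_const)
  have s2: "smooth_on S (\<lambda>x. dz \<mu> rho x * snd x $ \<gamma>)" for \<gamma>
    by (intro smooth_on_mult smooth_on_dz smooth_rho open_S smooth_fibre_coord)
  have 1: "deltabar conf_g \<nu> (GamH conf_g \<alpha> \<beta> \<mu>) x = deltabar g \<nu> (GamH g \<alpha> \<beta> \<mu>) x + hess \<mu> \<nu> x * ?d"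
  proof -
    have "deltabar conf_g \<nu> (GamH conf_g \<alpha> \<beta> \<mu>) x = deltabar conf_g \<nu> (\<lambda>x. GamH g \<alpha> \<beta> \<mu> x + dz \<mu> rho x * ?d) x"
      by (rule derivation_cong[OF derivation_deltabar open_S x, symmetric])
        (use GamH_conf sd[OF smooth_on_add[OF open_S smooth_GamH s1] x] in simp_all)
    also have "\<dots> = deltabar conf_g \<nu> (GamH g \<alpha> \<beta> \<mu>) x + ?d * deltabar conf_g \<nu> (dz \<mu> rho) x"
      using derivation_add[OF derivation_deltabar differentiable_basics(4)[OF x] sd[OF s1 x]]
        derivation_mult[OF derivation_deltabar diff_dz_rho[OF x] differentiable_const]
      by (simp add: derivation_const)
    also have "\<dots> = deltabar g \<nu> (GamH g \<alpha> \<beta> \<mu>) x + hess \<mu> \<nu> x * ?d"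
      using dvbar_GamH_radial[OF x] by (simp add: deltabar_conf[OF x] deltabar_dz_rho[OF x] dv_dz_rho[OF x])
    finally show ?thesis .
  qed
  have 2: "deltabar conf_g \<nu> (Gam conf_g \<gamma> \<mu>) x = deltabar g \<nu> (Gam g \<gamma> \<mu>) x + hess \<mu> \<nu> x * snd x $ \<gamma>" for \<gamma>
  proof -
    have "deltabar conf_g \<nu> (Gam conf_g \<gamma> \<mu>) x = deltabar conf_g \<nu> (\<lambda>x. Gam g \<gamma> \<mu> x + dz \<mu> rho x * snd x $ \<gamma>) x"
      by (rule derivation_cong[OF derivation_deltabar open_S x, symmetric])
        (use Gam_conf sd[OF smooth_on_add[OF open_S smooth_Gam s2] x] in simp_all)
    also have "\<dots> = deltabar conf_g \<nu> (Gam g \<gamma> \<mu>) x + (dz \<mu> rho x * deltabar conf_g \<nu> (\<lambda>x. snd x $ \<gamma>) x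
         + deltabar conf_g \<nu> (dz \<mu> rho) x * snd x $ \<gamma>)"
      using derivation_add[OF derivation_deltabar differentiable_basics(3)[OF x] sd[OF s2 x]]
        derivation_mult[OF derivation_deltabar diff_dz_rho[OF x] fibre_coord_differentiable]
      by simp
    also have "\<dots> = deltabar g \<nu> (Gam g \<gamma> \<mu>) x + hess \<mu> \<nu> x * snd x $ \<gamma>"
      using dvbar_Gam_radial[OF x]
      by (simp add: deltabar_conf[OF x] deltabar_dz_rho[OF x] dv_dz_rho[OF x] deltabar_fibre_coord fibre_coord_derivs)
    finally show ?thesis .
  qed
  have "(\<Sum>\<gamma>\<in>UNIV. GamV g \<alpha> \<beta> \<gamma> x * (deltabar g \<nu> (Gam g \<gamma> \<mu>) x + hess \<mu> \<nu> x * snd x $ \<gamma>))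
    = (\<Sum>\<gamma>\<in>UNIV. GamV g \<alpha> \<beta> \<gamma> x * deltabar g \<nu> (Gam g \<gamma> \<mu>) x)
      + hess \<mu> \<nu> x * (\<Sum>\<gamma>\<in>UNIV. GamV g \<alpha> \<beta> \<gamma> x * snd x $ \<gamma>)"
    by (simp add: sum.distrib sum_distrib_left algebra_simps)
  then show ?thesis
    by (simp add: Omega_def 1 2 GamV_conf[OF x] GamV_radial[OF x])
qed

lemma scal_conf:
  assumes x: "x \<in> S"
  shows "scal conf_g x = inverse (R x) * (scal g x - of_nat CARD('n) * lap rho x)"
proof -
  have Ol: "Omega_low conf_g \<alpha> \<beta> \<mu> \<nu> x = R x * (Omega_low g \<alpha> \<beta> \<mu> \<nu> x - hess \<mu> \<nu> x * Gm g \<alpha> \<beta> x)" for \<alpha> \<beta> \<mu> \<nu>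
  proof -
    have "Omega_low conf_g \<alpha> \<beta> \<mu> \<nu> x = (\<Sum>\<gamma>\<in>UNIV. R x * (Gm g \<gamma> \<beta> x * Omega g \<gamma> \<alpha> \<mu> \<nu> x)
       - R x * hess \<mu> \<nu> x * (Gm g \<gamma> \<beta> x * (if \<gamma> = \<alpha> then 1 else 0)))"
      unfolding Omega_low_def Gm_conf[OF x] Omega_conf[OF x] by (intro sum.cong refl) (simp only: algebra_simps)
    also have "\<dots> = R x * Omega_low g \<alpha> \<beta> \<mu> \<nu> x - R x * hess \<mu> \<nu> x * Gm g \<alpha> \<beta> x"
      unfolding sum_subtractf sum_distrib_left[symmetric] Omega_low_def[symmetric] by simp
    finally show ?thesis by (simp only: algebra_simps)
  qed
  have tr: "(\<Sum>\<alpha>\<in>UNIV. \<Sum>\<beta>\<in>UNIV. Ginv g \<beta> \<alpha> x * Gm g \<alpha> \<beta> x) = of_nat CARD('n)"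
    by (subst sum.swap) (simp add: Ginv_left[OF x])
  have "scal conf_g x = (\<Sum>\<mu>\<in>UNIV. \<Sum>\<nu>\<in>UNIV. inverse (R x) * ((\<Sum>\<alpha>\<in>UNIV. \<Sum>\<beta>\<in>UNIV.
      Ginv g \<nu> \<mu> x * Ginv g \<beta> \<alpha> x * Omega_low g \<alpha> \<beta> \<mu> \<nu> x)
      - Ginv g \<nu> \<mu> x * hess \<mu> \<nu> x * (\<Sum>\<alpha>\<in>UNIV. \<Sum>\<beta>\<in>UNIV. Ginv g \<beta> \<alpha> x * Gm g \<alpha> \<beta> x)))"
    unfolding scal_def
    by (intro sum.cong refl) (simp add: Ol Ginv_conf[OF x] sum_distrib_left sum_subtractf algebra_simps)
  also have "\<dots> = inverse (R x) * (scal g x - of_nat CARD('n) * lap rho x)"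
    by (simp add: tr scal_def lap_def sum_distrib_left sum_subtractf algebra_simps)
  finally show ?thesis .
qed

definition "grad_sq x = (\<Sum>\<mu>\<in>UNIV. \<Sum>\<nu>\<in>UNIV. Ginv g \<nu> \<mu> x * dz \<mu> rho x * dzbar \<nu> rho x)"

lemma smooth_grad_sq: "smooth_on S grad_sq"
  unfolding grad_sq_def[abs_def]
  by (intro smooth_intros smooth_Ginv smooth_on_dz smooth_on_dzbar smooth_rho open_S)

lemma dzbar_rho: "x \<in> S \<Longrightarrow> dzbar \<nu> rho x = cnj (dz \<nu> rho x)"
  using dzbar_cnj[OF smooth_on_differentiable[OF smooth_rho], of x \<nu>] by (simp add: rho_def[abs_def])

text \<open>With \<open>y\<close> the vector obtained from \<open>\<partial>\<rho>\<close> by raising the index, the sum is the value of the positive definite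
form of \<open>G\<close> at the conjugate of \<open>y\<close>.\<close>

lemma grad_sq_nonneg:
  assumes x: "x \<in> S"
  shows "0 \<le> grad_sq x"
proof -
  define y where "y \<nu> = (\<Sum>\<mu>\<in>UNIV. Ginv g \<nu> \<mu> x * dz \<mu> rho x)" for \<nu>
  have rho_y: "dz \<kappa> rho x = (\<Sum>\<nu>\<in>UNIV. Gm g \<kappa> \<nu> x * y \<nu>)" for \<kappa>
  proof -
    have "(\<Sum>\<nu>\<in>UNIV. Gm g \<kappa> \<nu> x * y \<nu>) = (\<Sum>\<mu>\<in>UNIV. (\<Sum>\<nu>\<in>UNIV. Gm g \<kappa> \<nu> x * Ginv g \<nu> \<mu> x) * dz \<mu> rho x)"
      unfolding y_def sum_distrib_left sum_distrib_right by (subst sum.swap) (simp add: mult.assoc)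
    then show ?thesis by (simp add: Ginv_right[OF x])
  qed
  have "grad_sq x = (\<Sum>\<nu>\<in>UNIV. y \<nu> * cnj (dz \<nu> rho x))"
    unfolding grad_sq_def y_def sum_distrib_right dzbar_rho[OF x] by (subst sum.swap) simp
  also have "\<dots> = (\<Sum>\<nu>\<in>UNIV. \<Sum>\<kappa>\<in>UNIV. Gm g \<kappa> \<nu> x * cnj (y \<kappa>) * y \<nu>)"
    by (subst rho_y) (simp add: Gm_hermitian[OF x] sum_distrib_left mult_ac)
  also have "\<dots> = (\<Sum>\<alpha>\<in>UNIV. \<Sum>\<beta>\<in>UNIV. Gm g \<alpha> \<beta> x * (\<chi> i. cnj (y i)) $ \<alpha> * cnj ((\<chi> i. cnj (y i)) $ \<beta>))"
    by (subst sum.swap) simp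
  also have "0 \<le> \<dots>"
    using pos_def[OF x, of "\<chi> i. cnj (y i)"]
    by (cases "(\<chi> i. cnj (y i)) = 0") (simp_all add: less_imp_le vec_eq_iff)
  finally show ?thesis .
qed

definition "exp_rho a x = complex_of_real (exp (a * r (fst x)))"

lemma smooth_exp_rho: "smooth_on S (exp_rho a)"
  unfolding exp_rho_def[abs_def] using smooth_on_fst[OF open_U _ smooth_r, of UNIV]
  by (intro smooth_intros open_S) (use smooth_on_fst[OF open_U _ smooth_r, of "UNIV - {0}"] in auto)

lemma derivation_exp_rho:
  assumes "derivation P" "x \<in> S"
  shows "P (exp_rho a) x = of_real a * exp_rho a x * P rho x"
proof -
  have "((\<lambda>t. exp (a * t)) has_field_derivative a * exp (a * r (fst x))) (at (r (fst x)))"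
    by (auto intro!: derivative_eq_intros)
  with assms show ?thesis
  unfolding exp_rho_def[abs_def] rho_def[abs_def]
  using derivation_chain_real[of P "\<lambda>x. r (fst x)" x "\<lambda>t. exp (a * t)" "a * exp (a * r (fst x))"] 
    smooth_on_differentiable[OF smooth_on_fst[OF open_U _ smooth_r], of UNIV x]
  by (auto simp del: mult.assoc)
qed

lemma lap_exp_rho:
  assumes x: "x \<in> S"
  shows "lap (exp_rho a) x = of_real a * exp_rho a x * (lap rho x + of_real a * grad_sq x)"
proof -
  have d: "dz \<mu> (exp_rho a) differentiable (at x)" for \<mu>
    by (rule smooth_on_differentiable[OF smooth_on_dz[OF open_S smooth_exp_rho] x])
  have e: "exp_rho a differentiable (at x)"
    by (rule smooth_on_differentiable[OF smooth_exp_rho x])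
  have "dzbar \<nu> (dz \<mu> (exp_rho a)) x = dzbar \<nu> (\<lambda>y. of_real a * (exp_rho a y * dz \<mu> rho y)) x" for \<mu> \<nu>
    by (rule derivation_cong[OF derivation_dzbar open_S x _ d]) (simp add: derivation_exp_rho mult.assoc)
  also have "\<dots> \<mu> \<nu> = of_real a * exp_rho a x * (hess \<mu> \<nu> x + of_real a * (dz \<mu> rho x * dzbar \<nu> rho x))" for \<mu> \<nu>
    using derivation_cmult[OF derivation_dzbar differentiable_mult[OF e diff_dz_rho[OF x]]]
      derivation_mult[OF derivation_dzbar e diff_dz_rho[OF x]] derivation_exp_rho[OF derivation_dzbar x]
    by (simp add: algebra_simps)
  finally have "Ginv g \<nu> \<mu> x * dzbar \<nu> (dz \<mu> (exp_rho a)) x = of_real a * exp_rho a x * (Ginv g \<nu> \<mu> x * hess \<mu> \<nu> x)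
      + of_real a * exp_rho a x * of_real a * (Ginv g \<nu> \<mu> x * dz \<mu> rho x * dzbar \<nu> rho x)" for \<mu> \<nu>
    by (simp add: algebra_simps)
  then show ?thesis
    by (simp only: lap_def grad_sq_def sum.distrib sum_distrib_left[symmetric] distrib_left mult.assoc)
qed

text \<open>The volume form acquires the factor \<open>R\<close> to the power \<open>n\<close> and the scalar curvature loses one \<open>R\<close>, which
leaves \<open>f = exp (a \<rho>)\<close> with \<open>a = n - 1\<close>. The Laplacian of \<open>\<rho>\<close>, which has no sign, is traded for the Laplacian of
\<open>f\<close>, whose integral vanishes on a balanced manifold, and for the squared gradient of \<open>\<rho>\<close>.\<close>

lemma scal_conformal:
  assumes x: "x \<in> S" and "CARD('n) \<ge> 2"
  defines "a \<equiv> real CARD('n) - 1"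
  shows "R x ^ CARD('n) * scal conf_g x
     = exp_rho a x * (scal g x + of_nat CARD('n) * of_real a * grad_sq x)
       - of_real (CARD('n) / a) * lap (exp_rho a) x"
proof -
  have a: "a \<noteq> 0" using assms(2) by (simp add: a_def)
  have "R x ^ CARD('n) = complex_of_real (exp (real CARD('n) * r (fst x)))"
    by (simp add: R_def exp_of_nat_mult of_real_power)
  also have "real CARD('n) * r (fst x) = r (fst x) + a * r (fst x)" by (simp add: a_def algebra_simps)
  finally have "R x ^ CARD('n) = R x * exp_rho a x" by (simp add: R_def exp_rho_def exp_add)
  then have "R x ^ CARD('n) * scal conf_g x = exp_rho a x * (scal g x - of_nat CARD('n) * lap rho x)"
    by (simp add: scal_conf[OF x])
  moreover have ?thesis
    if "R x ^ CARD('n) * scal conf_g x = exp_rho a x * (scal g x - of_nat CARD('n) * lap rho x)"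
  proof -
    have "of_real (CARD('n) / a) * (of_real a * c * t) = of_nat CARD('n) * (c * t)" for c t :: complex
      using a by simp
    with that a show ?thesis by (simp add: lap_exp_rho[OF x] algebra_simps)
  qed
  ultimately show ?thesis by blast
qed

end

section \<open>Exterior powers of two-forms\<close>

text \<open>Since a form receives a whole sequence of vectors, its degree is a property of the function and not of its
type: arguments beyond the degree have no influence.\<close>

definition depends :: "nat \<Rightarrow> 'n altform \<Rightarrow> bool" where
  "depends p a \<longleftrightarrow> (\<forall>X Y. (\<forall>i<p. X i = Y i) \<longrightarrow> a X = a Y)"

definition alternating :: "nat \<Rightarrow> 'n altform \<Rightarrow> bool" where
  "alternating p a \<longleftrightarrow> (\<forall>X \<sigma>. \<sigma> permutes {..<p} \<longrightarrow> a (\<lambda>i. X (\<sigma> i)) = of_int (sign \<sigma>) * a X)"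

definition multilin :: "nat \<Rightarrow> 'n::finite altform \<Rightarrow> bool" where
  "multilin p a \<longleftrightarrow> (\<forall>X j. j < p \<longrightarrow> linear (\<lambda>y. a (X(j := y))))"

lemma dependsD: "depends p a \<Longrightarrow> (\<And>i. i < p \<Longrightarrow> X i = Y i) \<Longrightarrow> a X = a Y"
  unfolding depends_def by blast

lemma wedge_depends:
  assumes "depends p a" "depends q b"
  shows "depends (p + q) (wedge p q a b)"
  unfolding depends_def wedge_def
proof (intro allI impI)
  fix X Y :: "nat \<Rightarrow> 'a coords" assume XY: "\<forall>i<p + q. X i = Y i"
  have "a (\<lambda>i. X (\<sigma> i)) = a (\<lambda>i. Y (\<sigma> i))" "b (\<lambda>i. X (\<sigma> (p + i))) = b (\<lambda>i. Y (\<sigma> (p + i)))"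
    if "\<sigma> permutes {..<p + q}" for \<sigma>
    using XY permutes_in_image[OF that] dependsD[OF assms(1), of "\<lambda>i. X (\<sigma> i)" "\<lambda>i. Y (\<sigma> i)"]
      dependsD[OF assms(2), of "\<lambda>i. X (\<sigma> (p + i))" "\<lambda>i. Y (\<sigma> (p + i))"] by simp_all
  then show "(\<Sum>\<sigma> | \<sigma> permutes {..<p + q}. of_int (sign \<sigma>) * a (\<lambda>i. X (\<sigma> i)) * b (\<lambda>i. X (\<sigma> (p + i)))) / (fact p * fact q) =
      (\<Sum>\<sigma> | \<sigma> permutes {..<p + q}. of_int (sign \<sigma>) * a (\<lambda>i. Y (\<sigma> i)) * b (\<lambda>i. Y (\<sigma> (p + i)))) / (fact p * fact q)"
    by (intro arg_cong[of _ _ "\<lambda>s. s / (fact p * fact q)"] sum.cong refl) (simp only: mem_Collect_eq)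
qed

text \<open>Permuting the arguments permutes the summands of the wedge product.\<close>

lemma wedge_alternating: "alternating (p + q) (wedge p q a b)"
  unfolding alternating_def
proof (intro allI impI)
  fix X :: "nat \<Rightarrow> 'a coords" and \<tau> assume \<tau>: "\<tau> permutes {..<p + q}"
  let ?T = "\<lambda>X \<sigma>. of_int (sign \<sigma>) * a (\<lambda>i. X (\<sigma> i)) * b (\<lambda>i. X (\<sigma> (p + i)))"
  have "?T (\<lambda>i. X (\<tau> i)) \<sigma> = of_int (sign \<tau>) * ?T X (\<tau> \<circ> \<sigma>)" if "\<sigma> permutes {..<p + q}" for \<sigma>
  proof -
    have "sign (\<tau> \<circ> \<sigma>) = sign \<tau> * sign \<sigma>"
      using \<tau> that by (intro sign_compose) (auto intro: permutes_imp_permutation)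
    then have "sign \<sigma> = sign \<tau> * sign (\<tau> \<circ> \<sigma>)" by simp
    then show ?thesis by simp
  qed
  then have "(\<Sum>\<sigma> | \<sigma> permutes {..<p + q}. ?T (\<lambda>i. X (\<tau> i)) \<sigma>)
     = (\<Sum>\<sigma> | \<sigma> permutes {..<p + q}. of_int (sign \<tau>) * ?T X (\<tau> \<circ> \<sigma>))"
    by (intro sum.cong) auto
  also have "\<dots> = of_int (sign \<tau>) * (\<Sum>\<sigma> | \<sigma> permutes {..<p + q}. ?T X \<sigma>)"
    unfolding sum_distrib_left[symmetric]
    by (subst setum_permutations_compose_left[OF \<tau>, symmetric]) simp
  finally show "wedge p q a b (\<lambda>i. X (\<tau> i)) = of_int (sign \<tau>) * wedge p q a b X"
    by (simp add: wedge_def)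
qed

lemma wedge_multilin:
  assumes "depends p a" "multilin p a" "multilin q b"
  shows "multilin (p + q) (wedge p q a b)"
  unfolding multilin_def
proof (intro allI impI)
  fix X :: "nat \<Rightarrow> 'a coords" and j assume j: "j < p + q"
  have "linear (\<lambda>y. of_int (sign \<sigma>) * a (\<lambda>i. (X(j := y)) (\<sigma> i)) * b (\<lambda>i. (X(j := y)) (\<sigma> (p + i))))"
    if \<sigma>: "\<sigma> permutes {..<p + q}" for \<sigma>
  proof -
    define i where "i = inv \<sigma> j"
    have \<sigma>i: "\<sigma> i' = j \<longleftrightarrow> i' = i" for i'
      unfolding i_def using permutes_inverses[OF \<sigma>] by metis
    have il: "i < p + q" unfolding i_def using permutes_in_image[OF permutes_inv[OF \<sigma>]] j by auto
    have e: "(\<lambda>i'. (X(j := y)) (\<sigma> i')) = (\<lambda>i'. X (\<sigma> i'))(i := y)" for y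
      by (auto simp: fun_eq_iff \<sigma>i)
    show ?thesis
    proof (cases "i < p")
      case True
      have e2: "(\<lambda>i'. (X(j := y)) (\<sigma> (p + i'))) = (\<lambda>i'. X (\<sigma> (p + i')))" for y
        using True by (auto simp: fun_eq_iff \<sigma>i)
      have "linear (\<lambda>y. a ((\<lambda>i'. X (\<sigma> i'))(i := y)))" using assms(2) True unfolding multilin_def by blast
      then show ?thesis unfolding e e2 by (simp add: linear_iff algebra_simps)
    next
      case False
      have e2: "(\<lambda>i'. (X(j := y)) (\<sigma> (p + i'))) = (\<lambda>i'. X (\<sigma> (p + i')))(i - p := y)" for y
        using False by (auto simp: fun_eq_iff \<sigma>i)
      have e3: "a ((\<lambda>i'. X (\<sigma> i'))(i := y)) = a (\<lambda>i'. X (\<sigma> i'))" for y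
        using False by (intro dependsD[OF assms(1)]) auto
      have "linear (\<lambda>y. b ((\<lambda>i'. X (\<sigma> (p + i')))(i - p := y)))"
        using assms(3) False il unfolding multilin_def by (metis add_diff_inverse_nat nat_add_left_cancel_less)
      then show ?thesis unfolding e e2 e3 by (simp add: linear_iff algebra_simps)
    qed
  qed
  then have "linear (\<lambda>y. \<Sum>\<sigma> | \<sigma> permutes {..<p + q}.
     of_int (sign \<sigma>) * a (\<lambda>i. (X(j := y)) (\<sigma> i)) * b (\<lambda>i. (X(j := y)) (\<sigma> (p + i))))"
    by (intro linear_compose_sum) auto
  then show "linear (\<lambda>y. wedge p q a b (X(j := y)))"
    unfolding wedge_def by (simp add: linear_iff add_divide_distrib scaleR_conv_of_real)
qed

lemma wedge_pow_depends: "depends p a \<Longrightarrow> depends (p * m) (wedge_pow p a m)"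
proof (induction m)
  case 0 then show ?case by (simp add: depends_def)
next
  case (Suc m) then show ?case using wedge_depends[of p a "p * m" "wedge_pow p a m"] by simp
qed

lemma wedge_pow_alternating: "alternating (p * m) (wedge_pow p a m)"
proof (cases m)
  case 0 then show ?thesis by (simp add: alternating_def)
next
  case (Suc k) then show ?thesis using wedge_alternating[of p "p * k" a "wedge_pow p a k"] by simp
qed

lemma wedge_pow_multilin: "depends p a \<Longrightarrow> multilin p a \<Longrightarrow> multilin (p * m) (wedge_pow p a m)"
proof (induction m)
  case 0 then show ?case by (simp add: multilin_def)
next
  case (Suc m) then show ?case using wedge_multilin[of p a "p * m" "wedge_pow p a m"] by simp
qed

lemma wedge_11: "wedge 1 1 a b X = a X * b (\<lambda>i. X (Suc i)) - a (\<lambda>i. X (Transposition.transpose 0 1 i)) * b (\<lambda>i. X (Transposition.transpose 0 1 (Suc i)))"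
proof -
  have "{\<sigma>. \<sigma> permutes {..<1 + 1::nat}} = {id, Transposition.transpose 0 1}"
    using permutes_doubleton_iff[of _ 0 "1::nat"] by (auto simp: lessThan_Suc insert_commute numeral_2_eq_2)
  moreover have "id \<noteq> Transposition.transpose 0 (1::nat)" by (metis id_apply transpose_apply_first zero_neq_one)
  ultimately show ?thesis by (simp add: wedge_def sign_swap_id)
qed

lemma wedge_pow_cmult: "wedge_pow p (\<lambda>X. c * a X) m X = c ^ m * wedge_pow p a m X"
proof (induction m arbitrary: X)
  case (Suc m)
  have e: "wedge_pow p (\<lambda>X. c * a X) m = (\<lambda>X. c ^ m * wedge_pow p a m X)" using Suc by auto
  show ?case by (simp add: e wedge_def sum_distrib_left mult_ac)
qed simp

text \<open>In every summand, the vector in the kernel is an argument of one of the factors.\<close>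

lemma wedge_pow_vanish:
  assumes "\<And>X. X 0 \<in> K \<or> X 1 \<in> K \<Longrightarrow> w X = 0" "i < 2 * m" "X i \<in> K"
  shows "wedge_pow 2 w m X = 0"
  using assms(2,3)
proof (induction m arbitrary: i X)
  case (Suc m)
  have "w (\<lambda>i. X (\<sigma> i)) * wedge_pow 2 w m (\<lambda>i. X (\<sigma> (2 + i))) = 0" if \<sigma>: "\<sigma> permutes {..<2 + 2 * m}" for \<sigma>
  proof (cases "inv \<sigma> i < 2")
    case True
    then have "inv \<sigma> i = 0 \<or> inv \<sigma> i = 1" by auto
    then have "\<sigma> 0 = i \<or> \<sigma> 1 = i" using permutes_inverses[OF \<sigma>] by metis
    then show ?thesis using Suc.prems assms(1) by auto
  next
    case False
    have "inv \<sigma> i < 2 + 2 * m" using permutes_in_image[OF permutes_inv[OF \<sigma>]] Suc.prems by auto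
    moreover have "2 + (inv \<sigma> i - 2) = inv \<sigma> i" using False by simp
    ultimately have "wedge_pow 2 w m (\<lambda>i. X (\<sigma> (2 + i))) = 0"
      using False Suc.prems permutes_inverses[OF \<sigma>] by (intro Suc.IH[of "inv \<sigma> i - 2"]) auto
    then show ?thesis by simp
  qed
  then have "(\<Sum>\<sigma> | \<sigma> permutes {..<2 + 2 * m}. of_int (sign \<sigma>) * w (\<lambda>i. X (\<sigma> i)) * wedge_pow 2 w m (\<lambda>i. X (\<sigma> (2 + i)))) = 0"
    by (intro sum.neutral) auto
  then show ?case by (simp add: wedge_def)
qed simp

lemma complex_pos_iff: "0 < (c::complex) \<longleftrightarrow> (\<exists>r>0. c = of_real r)"
  by (auto simp: less_complex_def complex_eq_iff)

lemma complex_mult_pos: "0 < (a::complex) \<Longrightarrow> 0 < b \<Longrightarrow> 0 < a * b"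
  unfolding complex_pos_iff by (metis mult_pos_pos of_real_mult)

lemma sum_complex_pos:
  fixes f :: "'a \<Rightarrow> complex"
  assumes "finite I" "i \<in> I" "0 < f i" "\<And>i. i \<in> I \<Longrightarrow> 0 \<le> f i"
  shows "0 < sum f I"
  using assms sum_nonneg[of "I - {i}" f] by (simp add: sum.remove[of I i] add_pos_nonneg)

subsection \<open>Positivity on orthogonal frames\<close>

text \<open>Exchanges the pair of positions \<open>0, 1\<close> with the pair \<open>2j, 2j + 1\<close>. As a product of two transpositions
it is even.\<close>

definition pair_swap :: "nat \<Rightarrow> nat \<Rightarrow> nat" where
  "pair_swap j k = 2 * Transposition.transpose 0 j (k div 2) + k mod 2"

lemma pair_swap_involution [simp]: "pair_swap j (pair_swap j k) = k"
  by (simp add: pair_swap_def)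

lemma pair_swap_div [simp]: "pair_swap j k div 2 = Transposition.transpose 0 j (k div 2)"
  by (simp add: pair_swap_def)

lemma pair_swap_even_odd [simp]:
  "pair_swap j (2 * i) = 2 * Transposition.transpose 0 j i" "pair_swap j (Suc (2 * i)) = Suc (2 * Transposition.transpose 0 j i)"
  by (simp_all add: pair_swap_def)

lemma pair_swap_eq: "pair_swap j = Transposition.transpose 0 (2 * j) \<circ> Transposition.transpose 1 (2 * j + 1)"
proof
  fix k
  show "pair_swap j k = (Transposition.transpose 0 (2 * j) \<circ> Transposition.transpose 1 (2 * j + 1)) k"
  proof (cases "even k")
    case True then show ?thesis by (elim evenE) (auto simp: pair_swap_def Transposition.transpose_def; presburger)
  next
    case False then show ?thesis by (elim oddE) (auto simp: pair_swap_def Transposition.transpose_def; presburger)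
  qed
qed

lemma pair_swap_permutes: "j < m \<Longrightarrow> pair_swap j permutes {..<2 * m}"
  unfolding pair_swap_eq by (intro permutes_compose permutes_swap_id) auto

lemma sign_pair_swap: "sign (pair_swap j) = 1"
  unfolding pair_swap_eq by (subst sign_compose) (auto simp: permutation_swap_id sign_swap_id)

definition orthogonal_pairs :: "nat \<Rightarrow> ('n coords \<Rightarrow> 'n coords \<Rightarrow> complex) \<Rightarrow> (nat \<Rightarrow> 'n coords) \<Rightarrow> bool" where
  "orthogonal_pairs m B X \<longleftrightarrow> (\<forall>i<m. 0 < B (X (2 * i)) (X (Suc (2 * i)))) \<and>
     (\<forall>i<2*m. \<forall>j<2*m. i div 2 \<noteq> j div 2 \<longrightarrow> B (X i) (X j) = 0)"

text \<open>Expand the wedge product of the two-form with its \<open>m\<close>-th power. A permutation contributes only if it puts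
the two vectors of one pair into the first factor. After an even exchange of pairs these are the vectors
\<open>0\<close> and \<open>1\<close>; what remains is a permutation of the other vectors, whose sign cancels against the one from the
alternating power, and the induction hypothesis applies. So no summand is negative, and the identity
contributes a positive one.\<close>

lemma wedge_pow_orthogonal_pos:
  assumes skew: "\<And>x y. B x y = - B y x"
    and "orthogonal_pairs m B X"
  shows "0 < wedge_pow 2 (\<lambda>X. B (X 0) (X 1)) m X"
  using assms(2)
proof (induction m arbitrary: X)
  case (Suc m)
  let ?w = "\<lambda>X. B (X 0) (X (1::nat)) :: complex"
  let ?P = "wedge_pow 2 ?w m"
  let ?T = "\<lambda>\<sigma>. of_int (sign \<sigma>) * ?w (\<lambda>i. X (\<sigma> i)) * ?P (\<lambda>i. X (\<sigma> (2 + i)))"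
  have orth: "B (X i) (X j) = 0" if "i < 2 * Suc m" "j < 2 * Suc m" "i div 2 \<noteq> j div 2" for i j
    using Suc.prems that unfolding orthogonal_pairs_def by blast
  have pos: "0 < B (X (2 * i)) (X (Suc (2 * i)))" if "i < Suc m" for i
    using Suc.prems that unfolding orthogonal_pairs_def by blast
  have dep: "depends (2 * m) ?P" by (rule wedge_pow_depends) (simp add: depends_def)
  have alt: "alternating (2 * m) ?P" by (rule wedge_pow_alternating)
  have IH': "0 < ?P (\<lambda>i. X (pair_swap j (2 + i)))" if j: "j < Suc m" for j
  proof (rule Suc.IH, unfold orthogonal_pairs_def, intro conjI allI impI)
    have tl: "Transposition.transpose 0 j i < Suc m" if "i < Suc m" for i using that j by (auto simp: Transposition.transpose_def)
    fix i assume "i < m"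
    then show "0 < B (X (pair_swap j (2 + 2 * i))) (X (pair_swap j (2 + Suc (2 * i))))"
      using pos[OF tl[of "Suc i"]] pair_swap_even_odd[of j "Suc i"] by simp
  next
    have tl: "pair_swap j i < 2 * Suc m" if "i < 2 * Suc m" for i
      using permutes_in_image[OF pair_swap_permutes[OF j], of i] that by simp
    fix i i' assume *: "i < 2 * m" "i' < 2 * m" "i div 2 \<noteq> i' div 2"
    have "Transposition.transpose 0 j (Suc (i div 2)) \<noteq> Transposition.transpose 0 j (Suc (i' div 2))"
      using *(3) by (metis nat.inject transpose_involutory)
    then show "B (X (pair_swap j (2 + i))) (X (pair_swap j (2 + i'))) = 0"
      using * by (intro orth tl) auto
  qed
  have nonneg: "0 \<le> ?T \<sigma>" if \<sigma>: "\<sigma> permutes {..<2 + 2 * m}" for \<sigma>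
  proof (cases "?w (\<lambda>i. X (\<sigma> i)) = 0")
    case False
    have \<sigma>l: "\<sigma> i < 2 * Suc m" if "i < 2 * Suc m" for i
      using permutes_in_image[OF \<sigma>, of i] that by simp
    define j where "j = \<sigma> 0 div 2"
    have j1: "\<sigma> 1 div 2 = j" using orth[of "\<sigma> 0" "\<sigma> 1"] False \<sigma>l[of 0] \<sigma>l[of 1] unfolding j_def by fastforce
    have j: "j < Suc m" using \<sigma>l[of 0] unfolding j_def by auto
    have ne: "\<sigma> 0 \<noteq> \<sigma> 1" using permutes_inj[OF \<sigma>] by (metis injD zero_neq_one)
    define \<sigma>' where "\<sigma>' = pair_swap j \<circ> \<sigma>"
    have ps: "pair_swap j permutes {..<2 + 2 * m}" using pair_swap_permutes[OF j] by simp
    have \<sigma>': "\<sigma>' permutes {..<2 + 2 * m}" unfolding \<sigma>'_def by (rule permutes_compose[OF \<sigma> ps])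
    have \<sigma>_eq: "\<sigma> i = pair_swap j (\<sigma>' i)" for i by (simp add: \<sigma>'_def)
    have sgn': "sign \<sigma>' = sign \<sigma>"
      unfolding \<sigma>'_def using ps \<sigma> by (subst sign_compose) (auto intro: permutes_imp_permutation simp: sign_pair_swap)
    have lt2: "\<sigma>' 0 < 2" "\<sigma>' 1 < 2"
    proof -
      have "\<sigma>' 0 div 2 = 0" "\<sigma>' 1 div 2 = 0" unfolding \<sigma>'_def using j1 by (auto simp: j_def[symmetric])
      then show "\<sigma>' 0 < 2" "\<sigma>' 1 < 2" by auto
    qed
    have ne': "\<sigma>' 0 \<noteq> \<sigma>' 1" using permutes_inj[OF \<sigma>'] by (metis injD zero_neq_one)
    obtain \<tau>' where \<tau>': "\<tau>' permutes {..<2 + 2 * m}" "\<tau>' 0 = 0" "\<tau>' 1 = 1" "\<And>i. \<tau>' (2 + i) = \<sigma>' (2 + i)"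
      "of_int (sign \<sigma>') * B (X (pair_swap j (\<sigma>' 0))) (X (pair_swap j (\<sigma>' 1)))
         = of_int (sign \<tau>') * B (X (pair_swap j 0)) (X (pair_swap j 1))"
    proof (cases "\<sigma>' 0 = 0")
      case True
      then have "\<sigma>' 1 = 1" using lt2 ne' by auto
      then show ?thesis using that[of \<sigma>'] True \<sigma>' by simp
    next
      case False
      then have v: "\<sigma>' 0 = 1" "\<sigma>' 1 = 0" using lt2 ne' by auto
      have t: "Transposition.transpose 0 (1::nat) permutes {..<2 + 2 * m}" by (rule permutes_swap_id) auto
      have s: "sign (\<sigma>' \<circ> Transposition.transpose 0 1) = - sign \<sigma>'"
        using t \<sigma>' by (subst sign_compose) (auto intro: permutes_imp_permutation simp: sign_swap_id)
      show ?thesis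
      proof (rule that[of "\<sigma>' \<circ> Transposition.transpose 0 1"])
        show "\<sigma>' \<circ> Transposition.transpose 0 1 permutes {..<2 + 2 * m}" by (rule permutes_compose[OF t \<sigma>'])
        show "of_int (sign \<sigma>') * B (X (pair_swap j (\<sigma>' 0))) (X (pair_swap j (\<sigma>' 1)))
         = of_int (sign (\<sigma>' \<circ> Transposition.transpose 0 1)) * B (X (pair_swap j 0)) (X (pair_swap j 1))"
          unfolding s v by (subst skew) simp
      qed (use v in \<open>simp_all add: Transposition.transpose_def\<close>)
    qed
    \<comment> \<open>The permutation \<open>\<tau>'\<close> fixes \<open>0\<close> and \<open>1\<close>; shifting by \<open>2\<close> gives a permutation \<open>\<tau>\<close> of the same sign.\<close>
    let ?A = "{2..<2 + 2 * m}" and ?f = "\<lambda>i::nat. i - 2"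
    have \<tau>'A: "\<tau>' permutes ?A"
    proof (rule permutes_superset[OF \<tau>'(1)])
      fix x assume "x \<in> {..<2 + 2 * m} - ?A"
      then have "x = 0 \<or> x = 1" by auto
      then show "\<tau>' x = x" using \<tau>' by auto
    qed
    have inj: "inj_on ?f ?A" by (auto simp: inj_on_def)
    have im: "?f ` ?A = {..<2 * m}"
    proof -
      have "x \<in> ?f ` ?A" if "x < 2 * m" for x using that by (intro image_eqI[of _ _ "x + 2"]) auto
      then show ?thesis by auto
    qed
    define \<tau> where "\<tau> = map_permutation ?A ?f \<tau>'"
    have \<tau>: "\<tau> permutes {..<2 * m}"
      unfolding \<tau>_def by (rule map_permutation_permutes[OF bij_betw_imageI[OF inj im] \<tau>'A])
    have s\<tau>: "sign \<tau> = sign \<tau>'" unfolding \<tau>_def by (rule sign_map_permutation[OF inj \<tau>'A]) simp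
    have \<tau>_app: "\<tau>' (2 + i) = 2 + \<tau> i" if "i < 2 * m" for i
    proof -
      have "\<tau> (?f (2 + i)) = ?f (\<tau>' (2 + i))"
        unfolding \<tau>_def by (rule map_permutation_apply[OF inj]) (use that in auto)
      moreover have "\<tau>' (2 + i) \<in> ?A" using permutes_in_image[OF \<tau>'A] that by auto
      ultimately show ?thesis by auto
    qed
    have "?P (\<lambda>i. X (\<sigma> (2 + i))) = ?P (\<lambda>i. X (pair_swap j (2 + \<tau> i)))"
      by (rule dependsD[OF dep]) (simp add: \<sigma>_eq \<tau>'(4)[symmetric] \<tau>_app del: add_2_eq_Suc)
    also have "\<dots> = of_int (sign \<tau>) * ?P (\<lambda>i. X (pair_swap j (2 + i)))"
      using alt \<tau> unfolding alternating_def by (elim allE[of _ "\<lambda>i. X (pair_swap j (2 + i))"]) blast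
    finally have "?T \<sigma> = (of_int (sign \<sigma>') * B (X (pair_swap j (\<sigma>' 0))) (X (pair_swap j (\<sigma>' 1))))
        * (of_int (sign \<tau>) * ?P (\<lambda>i. X (pair_swap j (2 + i))))"
      by (simp add: sgn' \<sigma>_eq)
    also have "\<dots> = B (X (pair_swap j 0)) (X (pair_swap j 1)) * ?P (\<lambda>i. X (pair_swap j (2 + i)))
       * (of_int (sign \<tau>') * of_int (sign \<tau>'))"
      unfolding \<tau>'(5) s\<tau> by (simp only: mult_ac)
    also have "\<dots> = B (X (2 * j)) (X (Suc (2 * j))) * ?P (\<lambda>i. X (pair_swap j (2 + i)))"
      using pair_swap_even_odd[of j 0] by (simp add: of_int_mult[symmetric] del: of_int_mult)
    also have "\<dots> \<ge> 0" using pos[OF j] IH'[OF j] by (intro mult_nonneg_nonneg less_imp_le) auto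
    finally show ?thesis .
  qed simp
  have "0 < ?T id"
    using complex_mult_pos[OF pos[of 0] IH'[of 0]] by (simp add: pair_swap_def)
  then have "0 < (\<Sum>\<sigma> | \<sigma> permutes {..<2 + 2 * m}. ?T \<sigma>)"
    by (intro sum_complex_pos[of _ id]) (use nonneg in \<open>auto simp: finite_permutations permutes_id\<close>)
  moreover have "0 < (1 / (fact 2 * fact (2 * m)) :: complex)"
    unfolding complex_pos_iff by (rule exI[of _ "1 / (fact 2 * fact (2 * m))"]) simp
  ultimately have "0 < (\<Sum>\<sigma> | \<sigma> permutes {..<2 + 2 * m}. ?T \<sigma>) * (1 / (fact 2 * fact (2 * m)))"
    by (rule complex_mult_pos)
  then show ?case by (simp add: wedge_def)
qed (simp add: less_complex_def)

subsection \<open>Positivity on complex frames\<close>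

text \<open>Exchanging the equal arguments changes the sign and nothing else.\<close>

lemma alternating_repeat:
  assumes "alternating p a" "i < p" "j < p" "i \<noteq> j" "X i = X j"
  shows "a X = 0"
proof -
  have "Transposition.transpose i j permutes {..<p}" using assms by (intro permutes_swap_id) auto
  moreover have "(\<lambda>k. X (Transposition.transpose i j k)) = X"
    using assms(5) by (auto simp: fun_eq_iff Transposition.transpose_def)
  ultimately have "a X = of_int (sign (Transposition.transpose i j)) * a X"
    using assms(1) unfolding alternating_def by metis
  then show ?thesis using assms(4) by (simp add: sign_swap_id)
qed

lemma alternating_add_multiple:
  assumes "alternating p a" "multilin p a" "i < p" "j < p" "j' < p" "i \<noteq> j" "i \<noteq> j'"
  shows "a (X(i := X i + (s *\<^sub>R X j + t *\<^sub>R X j'))) = a X"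
proof -
  have l: "linear (\<lambda>y. a (X(i := y)))" using assms unfolding multilin_def by blast
  have z: "a (X(i := X k)) = 0" if "k < p" "i \<noteq> k" for k
    by (rule alternating_repeat[OF assms(1,3) that]) (use that in auto)
  show ?thesis
    using linear_add[OF l, of "X i" "s *\<^sub>R X j + t *\<^sub>R X j'"] linear_add[OF l, of "s *\<^sub>R X j" "t *\<^sub>R X j'"]
      linear_scale[OF l, of s "X j"] linear_scale[OF l, of t "X j'"] z[of j] z[of j'] assms by simp
qed

text \<open>Multiplication by complex scalars, of which the product type has only the real ones.\<close>

definition cscale :: "complex \<Rightarrow> 'n::finite coords \<Rightarrow> 'n coords" where
  "cscale c x = (c *s fst x, c *s snd x)"

lemma cscale_add: "cscale c (x + y) = cscale c x + cscale c y" "cscale (c + d) x = cscale c x + cscale d x"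
  by (simp_all add: cscale_def vector_add_ldistrib vector_sadd_rdistrib)

lemma cscale_mult: "cscale c (cscale d x) = cscale (c * d) x"
  by (simp add: cscale_def vector_smult_assoc)

lemma cscale_one [simp]: "cscale 1 x = x" by (simp add: cscale_def)

lemma cscale_zero [simp]: "cscale 0 x = 0" by (simp add: cscale_def zero_prod_def)

lemma cscale_split: "cscale c x = Re c *\<^sub>R x + Im c *\<^sub>R cscale \<i> x"
  by (simp add: cscale_def prod_eq_iff vec_eq_iff complex_eq_iff)

lemma cscale_i_split: "cscale \<i> (cscale c x) = (- Im c) *\<^sub>R x + Re c *\<^sub>R cscale \<i> x"
  by (simp add: cscale_def prod_eq_iff vec_eq_iff complex_eq_iff)

text \<open>The frame \<open>f\<^sub>0, \<i> f\<^sub>0, f\<^sub>1, \<i> f\<^sub>1, \<dots>\<close>\<close>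

definition complex_frame :: "(nat \<Rightarrow> 'n::finite coords) \<Rightarrow> nat \<Rightarrow> 'n coords" where
  "complex_frame f n = cscale (if even n then 1 else \<i>) (f (n div 2))"

locale hermitian_form =
  fixes h :: "'n::finite coords \<Rightarrow> 'n coords \<Rightarrow> complex"
  assumes h_add: "\<And>x y z. h (x + y) z = h x z + h y z"
    and h_cscale: "\<And>c x z. h (cscale c x) z = c * h x z"
    and h_cnj: "\<And>x y. cnj (h x y) = h y x"
begin

lemma h_add_right: "h z (x + y) = h z x + h z y"
  using h_add[of x y z] h_cnj by (metis complex_cnj_add)

lemma h_cscale_right: "h z (cscale c x) = cnj c * h z x"
  using h_cscale[of c x z] h_cnj by (metis complex_cnj_mult)

text \<open>For a Hermitian form \<open>h\<close> this is \<open>- 2 Im h\<close>, the associated real form of type \<open>(1, 1)\<close>.\<close>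

definition "kform x y = \<i> * (h x y - h y x)"

lemma kform_skew: "kform x y = - kform y x"
  by (simp add: kform_def algebra_simps)

lemma kform_add: "kform (x + y) z = kform x z + kform y z"
  by (simp add: kform_def h_add h_add_right algebra_simps)

lemma kform_scale: "kform (s *\<^sub>R x) z = s *\<^sub>R kform x z"
proof -
  have "s *\<^sub>R x = cscale (of_real s) x" by (simp add: cscale_def prod_eq_iff vec_eq_iff complex_eq_iff)
  then show ?thesis by (simp add: kform_def h_cscale h_cscale_right scaleR_conv_of_real algebra_simps)
qed

abbreviation "kpow m \<equiv> wedge_pow 2 (\<lambda>X. kform (X 0) (X (1::nat))) m"

lemma kpow_alternating: "alternating (2 * m) (kpow m)"
  by (rule wedge_pow_alternating)

lemma kpow_multilin: "multilin (2 * m) (kpow m)"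
proof (rule wedge_pow_multilin)
  show "depends 2 (\<lambda>X. kform (X 0) (X (1::nat)))" by (simp add: depends_def)
  have "linear (\<lambda>y. kform y z)" "linear (\<lambda>y. kform z y)" for z
    using kform_add kform_scale kform_skew[of z] by (simp_all add: linear_iff)
  then show "multilin 2 (\<lambda>X. kform (X 0) (X (1::nat)))"
    unfolding multilin_def by (auto simp: less_2_cases_iff)
qed

text \<open>Positivity on all nontrivial combinations includes the linear independence of the vectors.\<close>

definition pos_on :: "nat \<Rightarrow> (nat \<Rightarrow> 'n coords) \<Rightarrow> bool" where
  "pos_on N f \<longleftrightarrow> (\<forall>c. (\<exists>j<N. c j \<noteq> 0) \<longrightarrow> 0 < h (\<Sum>j<N. cscale (c j) (f j)) (\<Sum>j<N. cscale (c j) (f j)))"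

text \<open>Adding a complex multiple of \<open>f l\<close> to \<open>f k\<close> changes two vectors of the real frame, each by a real
combination of the two vectors that belong to \<open>f l\<close>.\<close>

lemma frame_update:
  assumes "k < N" "l < N" "k \<noteq> l"
  shows "kpow N (complex_frame (f(k := f k + cscale d (f l)))) = kpow N (complex_frame f)"
proof -
  let ?X = "complex_frame f"
  let ?v = "Re d *\<^sub>R ?X (2 * l) + Im d *\<^sub>R ?X (Suc (2 * l))"
  let ?w = "(- Im d) *\<^sub>R ?X (2 * l) + Re d *\<^sub>R ?X (Suc (2 * l))"
  let ?Y = "?X(2 * k := ?X (2 * k) + ?v)"
  have v: "?v = cscale d (f l)" by (simp add: complex_frame_def cscale_split[of d])
  have w: "?w = cscale \<i> (cscale d (f l))" by (simp add: complex_frame_def cscale_i_split)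
  have "complex_frame (f(k := f k + cscale d (f l))) = ?Y(Suc (2 * k) := ?Y (Suc (2 * k)) + ?w)"
  proof
    fix n
    have n: "n div 2 = k \<longleftrightarrow> n = 2 * k \<or> n = Suc (2 * k)" by auto
    show "complex_frame (f(k := f k + cscale d (f l))) n = (?Y(Suc (2 * k) := ?Y (Suc (2 * k)) + ?w)) n"
      unfolding v w by (cases "n div 2 = k") (auto simp: n complex_frame_def cscale_add)
  qed
  moreover have "?w = (- Im d) *\<^sub>R ?Y (2 * l) + Re d *\<^sub>R ?Y (Suc (2 * l))" using assms by auto
  ultimately have "kpow N (complex_frame (f(k := f k + cscale d (f l)))) = kpow N ?Y"
    using alternating_add_multiple[OF kpow_alternating kpow_multilin, of "Suc (2 * k)" N "2 * l" "Suc (2 * l)" ?Y "- Im d" "Re d"] assms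
    by (simp only:)
  also have "\<dots> = kpow N ?X"
    by (rule alternating_add_multiple[OF kpow_alternating kpow_multilin]) (use assms in auto)
  finally show ?thesis .
qed

text \<open>The combination of the new vectors with coefficients \<open>c\<close> is the combination of the old vectors with the
coefficient of \<open>f l\<close> increased by \<open>c k * d\<close>.\<close>

lemma pos_on_update:
  assumes "pos_on N f" "k < N" "l < N" "k \<noteq> l"
  shows "pos_on N (f(k := f k + cscale d (f l)))"
  unfolding pos_on_def
proof (intro allI impI)
  fix c :: "nat \<Rightarrow> complex" assume c: "\<exists>j<N. c j \<noteq> 0"
  \<comment> \<open>These are the coefficients with respect to the old vectors.\<close>
  let ?c = "c(l := c l + c k * d)"
  have "(\<Sum>j<N. cscale (c j) ((f(k := f k + cscale d (f l))) j))
     = (\<Sum>j<N. cscale (c j) (f j) + (if j = k then cscale (c k * d) (f l) else 0))"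
    by (intro sum.cong) (auto simp: cscale_add cscale_mult)
  also have "\<dots> = (\<Sum>j<N. cscale (c j) (f j)) + cscale (c k * d) (f l)"
    using assms by (simp add: sum.distrib)
  also have "\<dots> = (\<Sum>j<N. cscale (c j) (f j) + (if j = l then cscale (c k * d) (f l) else 0))"
    using assms by (simp add: sum.distrib)
  also have "\<dots> = (\<Sum>j<N. cscale (?c j) (f j))"
    by (intro sum.cong) (auto simp: cscale_add)
  finally have e: "(\<Sum>j<N. cscale (c j) ((f(k := f k + cscale d (f l))) j)) = (\<Sum>j<N. cscale (?c j) (f j))" .
  have "\<exists>j<N. ?c j \<noteq> 0"
  proof (cases "c k = 0")
    case True
    then show ?thesis using c by (metis add.right_neutral fun_upd_apply mult_zero_left)
  next
    case False
    then show ?thesis using assms by (intro exI[of _ k]) auto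
  qed
  then show "0 < h (\<Sum>j<N. cscale (c j) ((f(k := f k + cscale d (f l))) j)) (\<Sum>j<N. cscale (c j) ((f(k := f k + cscale d (f l))) j))"
    using assms(1) unfolding e pos_on_def by blast
qed

lemma pos_on_diag:
  assumes "pos_on N f" "j < N"
  shows "0 < h (f j) (f j)"
proof -
  have "(\<Sum>i<N. cscale (if i = j then 1 else 0) (f i)) = (\<Sum>i<N. if i = j then f i else 0)"
    by (intro sum.cong) auto
  also have "\<dots> = f j" using assms by simp
  finally have "(\<Sum>i<N. cscale (if i = j then 1 else 0) (f i)) = f j" .
  then show ?thesis
    using assms unfolding pos_on_def by (metis (mono_tags) zero_neq_one)
qed

text \<open>Makes \<open>f k\<close> orthogonal to the vectors \<open>f j\<close> with \<open>j < l\<close>, one at a time, without changing the value of the top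
exterior power on the frame.\<close>

lemma gram_schmidt_step:
  assumes "pos_on N e" "k < N" "\<And>i j. i < k \<Longrightarrow> j < i \<Longrightarrow> h (e i) (e j) = 0" "l \<le> k"
  shows "\<exists>f. pos_on N f \<and> kpow N (complex_frame f) = kpow N (complex_frame e) \<and>
    (\<forall>i<k. \<forall>j<i. h (f i) (f j) = 0) \<and> (\<forall>j<l. h (f k) (f j) = 0)"
  using assms(4)
proof (induction l)
  case 0
  then show ?case using assms by (intro exI[of _ e]) auto
next
  case (Suc l)
  then obtain f where f: "pos_on N f" "kpow N (complex_frame f) = kpow N (complex_frame e)"
    "\<forall>i<k. \<forall>j<i. h (f i) (f j) = 0" "\<forall>j<l. h (f k) (f j) = 0" by auto
  \<comment> \<open>The coefficient of the projection to \<open>f l\<close>.\<close>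
  define d where "d = - (h (f k) (f l) / h (f l) (f l))"
  have lk: "l < k" "l < N" using Suc.prems assms(2) by auto
  have nz: "h (f l) (f l) \<noteq> 0" using pos_on_diag[OF f(1) lk(2)] by auto
  let ?f = "f(k := f k + cscale d (f l))"
  have "h (?f k) (?f j) = 0" if "j < Suc l" for j
  proof (cases "j = l")
    case True
    then show ?thesis using lk nz by (simp add: h_add h_cscale d_def)
  next
    case False
    then show ?thesis using that lk f(3,4) by (simp add: h_add h_cscale)
  qed
  moreover have "h (?f i) (?f j) = 0" if "i < k" "j < i" for i j using that f(3) by simp
  moreover have "pos_on N ?f" by (rule pos_on_update[OF f(1)]) (use lk assms(2) in auto)
  moreover have "kpow N (complex_frame ?f) = kpow N (complex_frame e)"
    using frame_update[of k N l f d] f(2) lk assms(2) by simp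
  ultimately show ?case by blast
qed

lemma gram_schmidt:
  assumes "pos_on N e" "k \<le> N"
  shows "\<exists>f. pos_on N f \<and> kpow N (complex_frame f) = kpow N (complex_frame e) \<and>
    (\<forall>i<k. \<forall>j<i. h (f i) (f j) = 0)"
  using assms(2)
proof (induction k)
  case 0
  then show ?case using assms by auto
next
  case (Suc k)
  then obtain f where f: "pos_on N f" "kpow N (complex_frame f) = kpow N (complex_frame e)"
    "\<forall>i<k. \<forall>j<i. h (f i) (f j) = 0" by auto
  obtain f' where f': "pos_on N f'" "kpow N (complex_frame f') = kpow N (complex_frame f)"
    "\<forall>i<k. \<forall>j<i. h (f' i) (f' j) = 0" "\<forall>j<k. h (f' k) (f' j) = 0"
    using gram_schmidt_step[OF f(1), of k k] Suc.prems f(3) by auto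
  have "\<forall>i<Suc k. \<forall>j<i. h (f' i) (f' j) = 0" using f'(3,4) by (auto simp: less_Suc_eq)
  then show ?case using f' f(2) by auto
qed

text \<open>Gram-Schmidt orthogonalization does not change the value and leads to a frame of orthogonal pairs.\<close>

lemma kpow_pos:
  assumes "pos_on N e"
  shows "0 < kpow N (complex_frame e)"
proof -
  obtain f where f: "pos_on N f" "kpow N (complex_frame f) = kpow N (complex_frame e)"
    "\<forall>i<N. \<forall>j<i. h (f i) (f j) = 0" using gram_schmidt[OF assms, of N] by auto
  have orth: "h (f i) (f j) = 0" if "i < N" "j < N" "i \<noteq> j" for i j
    using f(3) that h_cnj by (metis complex_cnj_zero linorder_neqE_nat)
  have "orthogonal_pairs N kform (complex_frame f)"
    unfolding orthogonal_pairs_def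
  proof (intro conjI allI impI)
    fix i assume i: "i < N"
    have "kform (f i) (cscale \<i> (f i)) = h (f i) (f i) + h (f i) (f i)"
      by (simp add: kform_def h_cscale h_cscale_right algebra_simps)
    then show "0 < kform (complex_frame f (2 * i)) (complex_frame f (Suc (2 * i)))"
      using pos_on_diag[OF f(1) i] add_pos_pos[of "h (f i) (f i)" "h (f i) (f i)"] by (simp add: complex_frame_def)
  next
    fix i j assume "i < 2 * N" "j < 2 * N" "i div 2 \<noteq> j div 2"
    then have "h (f (i div 2)) (f (j div 2)) = 0" "h (f (j div 2)) (f (i div 2)) = 0"
      by (auto intro!: orth)
    then show "kform (complex_frame f i) (complex_frame f j) = 0"
      by (simp add: complex_frame_def kform_def h_cscale h_cscale_right)
  qed
  from wedge_pow_orthogonal_pos[OF kform_skew this] show ?thesis unfolding f(2) .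
qed

end

subsection \<open>Wedge products of complementary degree\<close>

text \<open>Cyclic shift by \<open>q\<close> positions. For even \<open>q\<close> it is the square of the shift by \<open>q div 2\<close>, hence even.\<close>

definition shift_perm :: "nat \<Rightarrow> nat \<Rightarrow> nat \<Rightarrow> nat" where
  "shift_perm N q i = (if i < N then (i + q) mod N else i)"

lemma shift_perm_permutes: "shift_perm N q permutes {..<N}"
proof (rule bij_imp_permutes)
  have "inj_on (shift_perm N q) {..<N}"
  proof (rule inj_onI)
    fix x y assume *: "x \<in> {..<N}" "y \<in> {..<N}" "shift_perm N q x = shift_perm N q y"
    then have "(int x + int q) mod int N = (int y + int q) mod int N"
      by (simp add: shift_perm_def flip: of_nat_add zmod_int)
    then have "int x mod int N = int y mod int N" by (simp add: mod_eq_dvd_iff)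
    then show "x = y" using * by (simp flip: zmod_int)
  qed
  moreover have "shift_perm N q ` {..<N} \<subseteq> {..<N}" by (auto simp: shift_perm_def)
  ultimately show "bij_betw (shift_perm N q) {..<N} {..<N}"
    by (simp add: bij_betw_def endo_inj_surj)
qed (auto simp: shift_perm_def)

lemma sign_shift_perm:
  assumes "even q" shows "sign (shift_perm N q) = 1"
proof -
  have "shift_perm N (2 * k) = shift_perm N k \<circ> shift_perm N k" for k
    by (auto simp: fun_eq_iff shift_perm_def mod_simps mult_2 add.assoc)
  then have "sign (shift_perm N (2 * k)) = 1" for k
    using sign_compose[of "shift_perm N k" "shift_perm N k"] permutes_imp_permutation[OF _ shift_perm_permutes]
    by simp
  then show ?thesis using assms by (elim evenE) auto
qed

text \<open>The form \<open>b\<close> vanishes if one of its arguments is among the last \<open>p\<close> vectors, so only those permutations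
contribute that send the first \<open>q\<close> vectors to \<open>b\<close>. Each of them is the cyclic shift followed by permutations
within the two blocks, and all these summands are equal.\<close>

lemma wedge_complementary_pos:
  fixes a b :: "'n::finite altform"
  assumes dep: "depends p a" "depends q b"
    and alt: "alternating p a" "alternating q b"
    and van: "\<And>Y i. i < q \<Longrightarrow> Y i \<in> V \<Longrightarrow> b Y = 0"
    and X: "\<And>i. q \<le> i \<Longrightarrow> i < p + q \<Longrightarrow> X i \<in> V"
    and ev: "even p" "even q"
    and pos: "0 < a (\<lambda>i. X (q + i))" "0 < b X"
  shows "0 < wedge p q a b X"
proof -
  let ?T = "\<lambda>\<sigma>. of_int (sign \<sigma>) * a (\<lambda>i. X (\<sigma> i)) * b (\<lambda>i. X (\<sigma> (p + i)))"
  let ?s = "shift_perm (p + q) q"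
  have val: "?s i = (if i < p then q + i else if i < p + q then i - p else i)" for i
    by (auto simp: shift_perm_def mod_if)
  have good: "?T \<sigma> = a (\<lambda>i. X (q + i)) * b X"
    if \<sigma>: "\<sigma> permutes {..<p + q}" and im: "\<And>i. i < q \<Longrightarrow> \<sigma> (p + i) < q" for \<sigma>
  proof -
    have \<sigma>l: "\<sigma> i < p + q" if "i < p + q" for i using permutes_in_image[OF \<sigma>, of i] that by simp
    have inj: "inj \<sigma>" by (rule permutes_inj[OF \<sigma>])
    define \<beta> where "\<beta> i = (if i < q then \<sigma> (p + i) else i)" for i
    have \<beta>: "\<beta> permutes {..<q}"
    proof (rule bij_imp_permutes)
      have "inj_on \<beta> {..<q}" by (auto simp: inj_on_def \<beta>_def dest!: injD[OF inj])
      moreover have "\<beta> ` {..<q} \<subseteq> {..<q}" using im by (auto simp: \<beta>_def)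
      ultimately show "bij_betw \<beta> {..<q} {..<q}" by (simp add: bij_betw_def endo_inj_surj)
    qed (auto simp: \<beta>_def)
    have ge: "q \<le> \<sigma> i" if "i < p" for i
    proof (rule ccontr)
      assume "\<not> q \<le> \<sigma> i"
      then have "\<sigma> i \<in> \<beta> ` {..<q}" using permutes_image[OF \<beta>] by auto
      then obtain j where "j < q" "\<sigma> i = \<sigma> (p + j)" by (auto simp: \<beta>_def)
      then show False using inj that by (auto dest: injD)
    qed
    define \<alpha> where "\<alpha> i = (if i < p then \<sigma> i - q else i)" for i
    have \<alpha>: "\<alpha> permutes {..<p}"
    proof (rule bij_imp_permutes)
      have "inj_on \<alpha> {..<p}" using inj ge by (auto simp: inj_on_def \<alpha>_def) (metis le_add_diff_inverse2 injD)
      moreover have "\<alpha> ` {..<p} \<subseteq> {..<p}"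
      proof
        fix y assume "y \<in> \<alpha> ` {..<p}"
        then obtain i where "i < p" "y = \<sigma> i - q" by (auto simp: \<alpha>_def)
        then show "y \<in> {..<p}" using \<sigma>l[of i] ge[of i] by auto
      qed
      ultimately show "bij_betw \<alpha> {..<p} {..<p}" by (simp add: bij_betw_def endo_inj_surj)
    qed (auto simp: \<alpha>_def)
    define \<beta>' where "\<beta>' = map_permutation {..<q} (\<lambda>i. p + i) \<beta>"
    have ip: "inj_on (\<lambda>i. p + i) {..<q}" by simp
    have bb: "bij_betw (\<lambda>i. p + i) {..<q} {p..<p + q}"
    proof -
      have "x \<in> (\<lambda>i. p + i) ` {..<q}" if "p \<le> x" "x < p + q" for x
        using that by (intro image_eqI[of _ _ "x - p"]) auto
      then show ?thesis by (auto simp: bij_betw_def)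
    qed
    have \<beta>': "\<beta>' permutes {p..<p + q}" unfolding \<beta>'_def by (rule map_permutation_permutes[OF bb \<beta>])
    have s\<beta>': "sign \<beta>' = sign \<beta>" unfolding \<beta>'_def by (rule sign_map_permutation[OF ip \<beta>]) simp
    have app: "\<beta>' (p + i) = p + \<beta> i" if "i < q" for i
      unfolding \<beta>'_def by (rule map_permutation_apply[OF ip]) (use that in simp)
    have dec: "\<sigma> = ?s \<circ> (\<alpha> \<circ> \<beta>')"
    proof
      fix i
      consider "i < p" | "p \<le> i" "i < p + q" | "p + q \<le> i" by linarith
      then show "\<sigma> i = (?s \<circ> (\<alpha> \<circ> \<beta>')) i"
      proof cases
        case 1
        then have "\<beta>' i = i" using permutes_not_in[OF \<beta>'] by simp
        then show ?thesis using 1 ge[of i] \<sigma>l[of i] by (auto simp: \<alpha>_def val)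
      next
        case 2
        then obtain j where j: "i = p + j" "j < q" by (metis le_Suc_ex nat_add_left_cancel_less)
        then show ?thesis using app[of j] im[of j] by (auto simp: \<alpha>_def val \<beta>_def)
      next
        case 3
        then have "\<beta>' i = i" "\<sigma> i = i" using permutes_not_in[OF \<beta>'] permutes_not_in[OF \<sigma>] by auto
        then show ?thesis using 3 by (auto simp: \<alpha>_def val)
      qed
    qed
    have perms: "permutation ?s" "permutation \<alpha>" "permutation \<beta>'"
      using shift_perm_permutes \<alpha> \<beta>' by (auto intro: permutes_imp_permutation[rotated])
    have sg: "sign \<sigma> = sign \<alpha> * sign \<beta>"
      unfolding dec using perms by (simp add: sign_compose permutation_compose sign_shift_perm[OF ev(2)] s\<beta>')
    have "a (\<lambda>i. X (\<sigma> i)) = a (\<lambda>i. X (q + \<alpha> i))"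
      by (rule dependsD[OF dep(1)]) (simp add: \<alpha>_def ge)
    also have "\<dots> = of_int (sign \<alpha>) * a (\<lambda>i. X (q + i))"
      using alt(1) \<alpha> unfolding alternating_def by (elim allE[of _ "\<lambda>i. X (q + i)"]) blast
    finally have A: "a (\<lambda>i. X (\<sigma> i)) = of_int (sign \<alpha>) * a (\<lambda>i. X (q + i))" .
    have "b (\<lambda>i. X (\<sigma> (p + i))) = b (\<lambda>i. X (\<beta> i))"
      by (rule dependsD[OF dep(2)]) (simp add: \<beta>_def)
    also have "\<dots> = of_int (sign \<beta>) * b X"
      using alt(2) \<beta> unfolding alternating_def by blast
    finally have B: "b (\<lambda>i. X (\<sigma> (p + i))) = of_int (sign \<beta>) * b X" .
    have "?T \<sigma> = (of_int (sign \<alpha> * sign \<alpha>) * of_int (sign \<beta> * sign \<beta>)) * (a (\<lambda>i. X (q + i)) * b X)"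
      unfolding A B sg of_int_mult by (simp only: mult_ac)
    then show ?thesis by simp
  qed
  have pp: "0 < a (\<lambda>i. X (q + i)) * b X" by (rule complex_mult_pos[OF pos])
  have "0 \<le> ?T \<sigma>" if \<sigma>: "\<sigma> permutes {..<p + q}" for \<sigma>
  proof (cases "\<forall>i<q. \<sigma> (p + i) < q")
    case True
    then show ?thesis using good[OF \<sigma>] pp by simp
  next
    case False
    then obtain i where i: "i < q" "q \<le> \<sigma> (p + i)" by auto
    have "\<sigma> (p + i) < p + q" using permutes_in_image[OF \<sigma>, of "p + i"] i by simp
    then have "b (\<lambda>i. X (\<sigma> (p + i))) = 0" using van[of i] X i by simp
    then show ?thesis by simp
  qed
  moreover have "0 < ?T ?s"
  proof -
    have "?T ?s = a (\<lambda>i. X (q + i)) * b X" by (rule good[OF shift_perm_permutes]) (simp add: val)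
    then show ?thesis using pp by simp
  qed
  ultimately have "0 < (\<Sum>\<sigma> | \<sigma> permutes {..<p + q}. ?T \<sigma>)"
    by (intro sum_complex_pos[of _ ?s]) (auto simp: finite_permutations shift_perm_permutes)
  moreover have "0 < (1 / (fact p * fact q) :: complex)"
    unfolding complex_pos_iff by (rule exI[of _ "1 / (fact p * fact q)"]) simp
  ultimately have "0 < (\<Sum>\<sigma> | \<sigma> permutes {..<p + q}. ?T \<sigma>) * (1 / (fact p * fact q))"
    by (rule complex_mult_pos)
  then show ?thesis by (simp add: wedge_def)
qed

section \<open>The volume form in a chart\<close>

lemma hermitian_form_of_matrix:
  fixes M :: "'n::finite \<Rightarrow> 'n \<Rightarrow> complex" and a :: "'n \<Rightarrow> 'n coords \<Rightarrow> complex"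
  assumes M: "\<And>\<alpha> \<beta>. cnj (M \<alpha> \<beta>) = M \<beta> \<alpha>"
    and a: "\<And>\<alpha> x y. a \<alpha> (x + y) = a \<alpha> x + a \<alpha> y" "\<And>\<alpha> c x. a \<alpha> (cscale c x) = c * a \<alpha> x"
  shows "hermitian_form (\<lambda>x y. \<Sum>\<alpha>\<in>UNIV. \<Sum>\<beta>\<in>UNIV. M \<alpha> \<beta> * (a \<alpha> x * cnj (a \<beta> y)))"
proof
  fix x y :: "'n coords"
  show "cnj (\<Sum>\<alpha>\<in>UNIV. \<Sum>\<beta>\<in>UNIV. M \<alpha> \<beta> * (a \<alpha> x * cnj (a \<beta> y)))
     = (\<Sum>\<alpha>\<in>UNIV. \<Sum>\<beta>\<in>UNIV. M \<alpha> \<beta> * (a \<alpha> y * cnj (a \<beta> x)))"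
    by (subst sum.swap) (simp add: M mult_ac)
qed (simp_all add: a algebra_simps sum.distrib sum_distrib_left)

lemma real_form_eq_kform:
  assumes "hermitian_form (\<lambda>x y. \<Sum>\<alpha>\<in>UNIV. \<Sum>\<beta>\<in>UNIV. M \<alpha> \<beta> * (a \<alpha> x * cnj (a \<beta> y)))"
    and "\<And>\<alpha> X. A \<alpha> X = a \<alpha> (X 0)"
  shows "\<i> * (\<Sum>\<alpha>\<in>UNIV. \<Sum>\<beta>\<in>UNIV. M \<alpha> \<beta> * wedge 1 1 (A \<alpha>) (\<lambda>Y. cnj (A \<beta> Y)) X)
    = hermitian_form.kform (\<lambda>x y. \<Sum>\<alpha>\<in>UNIV. \<Sum>\<beta>\<in>UNIV. M \<alpha> \<beta> * (a \<alpha> x * cnj (a \<beta> y))) (X 0) (X 1)"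
  unfolding hermitian_form.kform_def[OF assms(1)] wedge_11 assms(2)
  by (simp add: right_diff_distrib sum_subtractf)

text \<open>The embedding \<open>J\<close> of the coordinate space is the inclusion of the horizontal or of the vertical vectors.\<close>

lemma pos_on_axes:
  fixes \<phi> :: "nat \<Rightarrow> 'n::finite" and J :: "complex^'n \<Rightarrow> 'n coords"
  assumes "hermitian_form h" and inj: "inj_on \<phi> {..<N}"
    and J: "\<And>x y. J (x + y) = J x + J y" "\<And>c x. J (c *s x) = cscale c (J x)"
    and pos: "\<And>\<xi>. \<xi> \<noteq> 0 \<Longrightarrow> (\<And>i. i \<notin> \<phi> ` {..<N} \<Longrightarrow> \<xi> $ i = 0) \<Longrightarrow> 0 < h (J \<xi>) (J \<xi>)"
  shows "hermitian_form.pos_on h N (\<lambda>j. J (axis (\<phi> j) 1))"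
  unfolding hermitian_form.pos_on_def[OF assms(1)]
proof (intro allI impI)
  fix c :: "nat \<Rightarrow> complex" assume "\<exists>j<N. c j \<noteq> 0"
  then obtain j where j: "j < N" "c j \<noteq> 0" by blast
  define \<xi> where "\<xi> = (\<Sum>j<N. c j *s (axis (\<phi> j) 1 :: complex^'n))"
  have J0: "J 0 = 0" using J(2)[of 0 0] by simp
  have "J (\<Sum>j\<in>I. c j *s (axis (\<phi> j) 1 :: complex^'n)) = (\<Sum>j\<in>I. cscale (c j) (J (axis (\<phi> j) 1)))" for I
    by (induction I rule: infinite_finite_induct) (simp_all add: J J0)
  then have e: "(\<Sum>j<N. cscale (c j) (J (axis (\<phi> j) 1))) = J \<xi>" by (simp add: \<xi>_def)
  have comp: "\<xi> $ i = (\<Sum>j<N. if \<phi> j = i then c j else 0)" for i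
    unfolding \<xi>_def by (auto simp: axis_def intro!: sum.cong)
  have "\<xi> $ (\<phi> j) = (\<Sum>i<N. if i = j then c i else 0)"
    unfolding comp using inj j by (intro sum.cong) (auto dest: inj_onD)
  then have "\<xi> $ (\<phi> j) = c j" using j by simp
  then have "\<xi> \<noteq> 0" using j by auto
  moreover have "\<xi> $ i = 0" if "i \<notin> \<phi> ` {..<N}" for i
    unfolding comp using that by (intro sum.neutral) auto
  ultimately show "0 < h (\<Sum>j<N. cscale (c j) (J (axis (\<phi> j) 1))) (\<Sum>j<N. cscale (c j) (J (axis (\<phi> j) 1)))"
    unfolding e by (rule pos)
qed

lemma wedge_continuous:
  assumes "\<And>X. continuous_on S (\<lambda>x. a x X)" "\<And>X. continuous_on S (\<lambda>x. b x X)"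
  shows "continuous_on S (\<lambda>x. wedge p q (a x) (b x) X)"
  unfolding wedge_def by (intro continuous_intros assms) auto

lemma wedge_pow_continuous:
  assumes "\<And>X. continuous_on S (\<lambda>x. a x X)"
  shows "continuous_on S (\<lambda>x. wedge_pow p (a x) m X)"
proof (induction m arbitrary: X)
  case (Suc m) then show ?case using wedge_continuous[of S a "\<lambda>x. wedge_pow p (a x) m"] assms by simp
qed simp

definition vert_comp :: "('n::finite coords \<Rightarrow> real) \<Rightarrow> 'n coords \<Rightarrow> 'n \<Rightarrow> 'n coords \<Rightarrow> complex" where
  "vert_comp g x \<alpha> X = snd X $ \<alpha> + (\<Sum>\<beta>\<in>UNIV. Gam g \<alpha> \<beta> x * fst X $ \<beta>)"

lemma vert_comp_linear: "vert_comp g x \<alpha> (X + Y) = vert_comp g x \<alpha> X + vert_comp g x \<alpha> Y"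
  "vert_comp g x \<alpha> (cscale c X) = c * vert_comp g x \<alpha> X"
  by (simp_all add: vert_comp_def cscale_def algebra_simps sum.distrib sum_distrib_left)

definition logH :: "('n::finite coords \<Rightarrow> real) \<Rightarrow> 'n \<Rightarrow> 'n \<Rightarrow> 'n coords \<Rightarrow> complex" where
  "logH g \<alpha> \<beta> = dv \<alpha> (dvbar \<beta> (\<lambda>y. of_real (ln (g y))))"

definition vform :: "('n::finite coords \<Rightarrow> real) \<Rightarrow> 'n coords \<Rightarrow> 'n coords \<Rightarrow> 'n coords \<Rightarrow> complex" where
  "vform g x X Y = (\<Sum>\<alpha>\<in>UNIV. \<Sum>\<beta>\<in>UNIV. logH g \<alpha> \<beta> x * (vert_comp g x \<alpha> X * cnj (vert_comp g x \<beta> Y)))"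

definition hform :: "('n::finite coords \<Rightarrow> real) \<Rightarrow> 'n coords \<Rightarrow> 'n coords \<Rightarrow> 'n coords \<Rightarrow> complex" where
  "hform g x X Y = (\<Sum>\<alpha>\<in>UNIV. \<Sum>\<beta>\<in>UNIV. Gm g \<alpha> \<beta> x * (fst X $ \<alpha> * cnj (fst Y $ \<beta>)))"

lemma log_derivative:
  assumes "derivation P" "g differentiable (at x)" "0 < g x"
  shows "P (\<lambda>y. of_real (ln (g y))) x = inverse (of_real (g x)) * P (\<lambda>y. of_real (g y)) x"
proof -
  have "(ln has_field_derivative inverse (g x)) (at (g x))"
    using assms(3) by (auto intro!: derivative_eq_intros simp: field_simps)
  from derivation_chain_real[OF assms(1,2) this] show ?thesis by simp
qed

context finsler_chart begin

lemma hermitian_hform: "x \<in> S \<Longrightarrow> hermitian_form (hform g x)"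
  unfolding hform_def[abs_def] by (rule hermitian_form_of_matrix) (simp_all add: Gm_hermitian cscale_def)

lemma dv_G_cnj: "x \<in> S \<Longrightarrow> dv \<alpha> G x = cnj (dvbar \<alpha> G x)"
  using dvbar_cnj[OF differentiable_basics(1), of x \<alpha>] by simp

text \<open>The functions \<open>G\<^sub>\<beta> / G\<close> with barred \<open>\<beta>\<close> are the vertical derivatives of \<open>ln G\<close>.\<close>

lemma smooth_log_gradient: "smooth_on S (\<lambda>x. inverse (G x) * dvbar \<beta> G x)"
  using g_pos by (intro smooth_on_mult smooth_on_inverse smooth_G smooth_on_dvbar open_S) force

lemma logH_eq:
  assumes x: "x \<in> S"
  shows "logH g \<alpha> \<beta> x = inverse (G x) * Gm g \<alpha> \<beta> x - inverse (G x) ^ 2 * dv \<alpha> G x * dvbar \<beta> G x"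
    and "logH g \<alpha> \<beta> x = dv \<alpha> (\<lambda>x. inverse (G x) * dvbar \<beta> G x) x"
proof -
  have gd: "g differentiable (at y)" if "y \<in> S" for y
    by (rule smooth_on_differentiable[OF smooth_g that])
  show 1: "logH g \<alpha> \<beta> x = dv \<alpha> (\<lambda>x. inverse (G x) * dvbar \<beta> G x) x"
    unfolding logH_def
    by (rule derivation_cong[OF derivation_dv open_S x, symmetric])
      (use log_derivative[OF derivation_dvbar gd g_pos] smooth_on_differentiable[OF smooth_log_gradient x] in simp_all)
  have gx: "0 < g x" by (rule g_pos[OF x])
  have "(inverse has_field_derivative - (inverse (g x) ^ 2)) (at (g x))"
    using gx by (auto intro!: derivative_eq_intros simp: power2_eq_square)
  from derivation_chain_real[OF derivation_dv gd[OF x] this, of \<alpha>]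
  have i: "dv \<alpha> (\<lambda>x. inverse (G x)) x = - (inverse (G x) ^ 2) * dv \<alpha> G x" by simp
  have "smooth_on S (\<lambda>x. inverse (G x))"
    using g_pos by (intro smooth_on_inverse smooth_G open_S) force
  from derivation_mult[OF derivation_dv smooth_on_differentiable[OF this x] differentiable_basics(5)[OF x]]
  show "logH g \<alpha> \<beta> x = inverse (G x) * Gm g \<alpha> \<beta> x - inverse (G x) ^ 2 * dv \<alpha> G x * dvbar \<beta> G x"
    unfolding 1 by (simp add: i Gm_def)
qed

lemma logH_hermitian: "x \<in> S \<Longrightarrow> cnj (logH g \<alpha> \<beta> x) = logH g \<beta> \<alpha> x"
  by (simp add: logH_eq(1) Gm_hermitian dv_G_cnj mult_ac)

lemma hermitian_vform: "x \<in> S \<Longrightarrow> hermitian_form (vform g x)"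
  unfolding vform_def[abs_def] by (rule hermitian_form_of_matrix) (simp_all add: logH_hermitian vert_comp_linear)

text \<open>The vector \<open>v\<close> is in the kernel of the Hessian of \<open>ln G\<close>: in the contraction of the first term of \<open>logH_eq\<close> as
well as of the second, homogeneity leaves \<open>G\<^sub>\<beta> / G\<close>.\<close>

lemma logH_radial:
  assumes x: "x \<in> S"
  shows "(\<Sum>\<alpha>\<in>UNIV. logH g \<alpha> \<beta> x * snd x $ \<alpha>) = 0" "(\<Sum>\<beta>\<in>UNIV. logH g \<alpha> \<beta> x * cnj (snd x $ \<beta>)) = 0"
proof -
  have gx: "g x \<noteq> 0" using g_pos[OF x] by simp
  have *: "(\<Sum>\<alpha>\<in>UNIV. logH g \<alpha> \<beta> x * snd x $ \<alpha>) = 0" for \<beta>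
  proof -
    have "(\<Sum>\<alpha>\<in>UNIV. logH g \<alpha> \<beta> x * snd x $ \<alpha>)
      = inverse (G x) * (\<Sum>\<alpha>\<in>UNIV. snd x $ \<alpha> * Gm g \<alpha> \<beta> x) - inverse (G x) ^ 2 * dvbar \<beta> G x * (\<Sum>\<alpha>\<in>UNIV. snd x $ \<alpha> * dv \<alpha> G x)"
      by (simp add: logH_eq(1)[OF x] algebra_simps sum_subtractf sum_distrib_left)
    also have "\<dots> = 0" unfolding Gm_radial[OF x] G_radial[OF x] using gx by (simp add: power2_eq_square)
    finally show ?thesis .
  qed
  then show "(\<Sum>\<alpha>\<in>UNIV. logH g \<alpha> \<beta> x * snd x $ \<alpha>) = 0" .
  have "cnj (\<Sum>\<beta>\<in>UNIV. logH g \<alpha> \<beta> x * cnj (snd x $ \<beta>)) = 0"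
    using *[of \<alpha>] by (simp add: logH_hermitian[OF x])
  then show "(\<Sum>\<beta>\<in>UNIV. logH g \<alpha> \<beta> x * cnj (snd x $ \<beta>)) = 0" by (metis complex_cnj_zero_iff)
qed

text \<open>This is the strict Cauchy-Schwarz inequality for \<open>G\<^sub>\<alpha>\<^sub>\<beta>\<close>. Modulo the kernel of \<open>logH\<close>, the vector \<open>\<xi>\<close> may be
replaced by its component \<open>\<eta>\<close> orthogonal to \<open>v\<close>, where the form is \<open>1 / G\<close> times the positive definite one. The
condition on the \<open>k\<close>-th component ensures that \<open>\<xi>\<close> is no multiple of \<open>v\<close>.\<close>

lemma logH_pos:
  assumes x: "x \<in> S" and \<xi>: "\<xi> \<noteq> 0" "\<xi> $ k = 0" and v: "snd x $ k \<noteq> 0"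
  shows "0 < (\<Sum>\<alpha>\<in>UNIV. \<Sum>\<beta>\<in>UNIV. logH g \<alpha> \<beta> x * (\<xi> $ \<alpha> * cnj (\<xi> $ \<beta>)))"
proof -
  let ?H = "\<lambda>\<eta>::complex^'n. \<Sum>\<alpha>\<in>UNIV. \<Sum>\<beta>\<in>UNIV. logH g \<alpha> \<beta> x * (\<eta> $ \<alpha> * cnj (\<eta> $ \<beta>))"
  define t where "t = inverse (G x) * (\<Sum>\<alpha>\<in>UNIV. dv \<alpha> G x * \<xi> $ \<alpha>)"
  define \<eta> where "\<eta> = \<xi> - t *s snd x"
  have gx: "0 < g x" by (rule g_pos[OF x])
  have "\<eta> \<noteq> 0"
  proof
    assume "\<eta> = 0"
    then have e: "\<xi> = t *s snd x" by (simp add: \<eta>_def)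
    then have "t * snd x $ k = 0" using \<xi>(2) by simp
    then show False using v e \<xi>(1) by simp
  qed
  have orth: "(\<Sum>\<alpha>\<in>UNIV. dv \<alpha> G x * \<eta> $ \<alpha>) = 0"
  proof -
    have "(\<Sum>\<alpha>\<in>UNIV. dv \<alpha> G x * \<eta> $ \<alpha>) = (\<Sum>\<alpha>\<in>UNIV. dv \<alpha> G x * \<xi> $ \<alpha>) - t * (\<Sum>\<alpha>\<in>UNIV. snd x $ \<alpha> * dv \<alpha> G x)"
      by (simp add: \<eta>_def algebra_simps sum_subtractf sum_distrib_left)
    then show ?thesis using gx by (simp add: G_radial[OF x] t_def)
  qed
  have "?H \<xi> = ?H \<eta>"
  proof -
    have "?H \<xi> = (\<Sum>\<alpha>\<in>UNIV. \<Sum>\<beta>\<in>UNIV. logH g \<alpha> \<beta> x * (\<eta> $ \<alpha> * cnj (\<eta> $ \<beta>))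
       + \<eta> $ \<alpha> * cnj t * (logH g \<alpha> \<beta> x * cnj (snd x $ \<beta>)) + t * cnj (\<xi> $ \<beta>) * (logH g \<alpha> \<beta> x * snd x $ \<alpha>))"
      by (intro sum.cong refl) (simp add: \<eta>_def algebra_simps)
    also have "\<dots> = ?H \<eta> + (\<Sum>\<alpha>\<in>UNIV. \<eta> $ \<alpha> * cnj t * (\<Sum>\<beta>\<in>UNIV. logH g \<alpha> \<beta> x * cnj (snd x $ \<beta>)))
       + (\<Sum>\<alpha>\<in>UNIV. \<Sum>\<beta>\<in>UNIV. t * cnj (\<xi> $ \<beta>) * (logH g \<alpha> \<beta> x * snd x $ \<alpha>))"
      by (simp add: sum.distrib sum_distrib_left)
    also have "(\<Sum>\<alpha>\<in>UNIV. \<Sum>\<beta>\<in>UNIV. t * cnj (\<xi> $ \<beta>) * (logH g \<alpha> \<beta> x * snd x $ \<alpha>))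
       = (\<Sum>\<beta>\<in>UNIV. t * cnj (\<xi> $ \<beta>) * (\<Sum>\<alpha>\<in>UNIV. logH g \<alpha> \<beta> x * snd x $ \<alpha>))"
      by (subst sum.swap) (simp add: sum_distrib_left)
    finally show ?thesis by (simp add: logH_radial[OF x])
  qed
  also have "?H \<eta> = inverse (G x) * (\<Sum>\<alpha>\<in>UNIV. \<Sum>\<beta>\<in>UNIV. Gm g \<alpha> \<beta> x * \<eta> $ \<alpha> * cnj (\<eta> $ \<beta>))
     - inverse (G x) ^ 2 * ((\<Sum>\<alpha>\<in>UNIV. dv \<alpha> G x * \<eta> $ \<alpha>) * (\<Sum>\<beta>\<in>UNIV. dvbar \<beta> G x * cnj (\<eta> $ \<beta>)))"
    unfolding sum_product by (simp add: logH_eq(1)[OF x] algebra_simps sum_subtractf sum_distrib_left)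
  also have "\<dots> = inverse (G x) * (\<Sum>\<alpha>\<in>UNIV. \<Sum>\<beta>\<in>UNIV. Gm g \<alpha> \<beta> x * \<eta> $ \<alpha> * cnj (\<eta> $ \<beta>))"
    by (simp add: orth)
  finally have "?H \<xi> = inverse (G x) * (\<Sum>\<alpha>\<in>UNIV. \<Sum>\<beta>\<in>UNIV. Gm g \<alpha> \<beta> x * \<eta> $ \<alpha> * cnj (\<eta> $ \<beta>))" .
  note e = this
  have "0 < inverse (G x)"
    unfolding complex_pos_iff by (rule exI[of _ "inverse (g x)"]) (use gx in simp)
  from complex_mult_pos[OF this pos_def[OF x \<open>\<eta> \<noteq> 0\<close>]] show ?thesis unfolding e .
qed

lemma omegaV_kform: "x \<in> S \<Longrightarrow> omegaV g x = (\<lambda>X. hermitian_form.kform (vform g x) (X 0) (X 1))"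
  unfolding omegaV_def[abs_def] logH_def[symmetric]
  using real_form_eq_kform[OF hermitian_vform[unfolded vform_def[abs_def]], of x "deltav_form g x"]
  by (auto simp: vform_def[abs_def] deltav_form_def vert_comp_def fun_eq_iff)

lemma omegaH_kform: "x \<in> S \<Longrightarrow> omegaH g x = (\<lambda>X. hermitian_form.kform (hform g x) (X 0) (X 1))"
  unfolding omegaH_def[abs_def]
  using real_form_eq_kform[OF hermitian_hform[unfolded hform_def[abs_def]], of x "dz_form"]
  by (auto simp: hform_def[abs_def] dz_form_def fun_eq_iff)

text \<open>The first \<open>2n\<close> vectors of the frame are \<open>\<partial>/\<partial>z\<close> and \<open>\<i>\<close> times these; the others are vertical and in the kernel of
\<open>omegaH\<close>. Thus the value is the product of the value of the vertical power on the latter and of the horizontal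
power on the former, and each of these is the top power of a positive Hermitian form on a complex frame.\<close>

lemma vol_pos:
  assumes x: "x \<in> S" and v: "snd x $ k \<noteq> 0"
  shows "0 < vol g x (aff_frame k)"
proof -
  let ?n = "CARD('n)"
  interpret V: hermitian_form "vform g x" by (rule hermitian_vform[OF x])
  interpret H: hermitian_form "hform g x" by (rule hermitian_hform[OF x])
  let ?a = "\<lambda>X. wedge_pow 2 (omegaV g x) (?n - 1) X / fact (?n - 1)"
  let ?b = "\<lambda>X. wedge_pow 2 (omegaH g x) ?n X / fact ?n"
  have dep: "depends (2 * m) (wedge_pow 2 (omegaV g x) m)" "depends (2 * m) (wedge_pow 2 (omegaH g x) m)" for m
    by (rule wedge_pow_depends, simp add: depends_def omegaV_kform[OF x] omegaH_kform[OF x])+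
  have fp: "0 < (1 / fact m :: complex)" for m
    unfolding complex_pos_iff by (rule exI[of _ "1 / fact m"]) simp
  have "0 < wedge (2 * (?n - 1)) (2 * ?n) ?a ?b (aff_frame k)"
  proof (rule wedge_complementary_pos[where V = "{X. fst X = 0}"])
    show "depends (2 * (?n - 1)) ?a" "depends (2 * ?n) ?b"
      using dep[of "?n - 1"] dep[of ?n] unfolding depends_def by metis+
    show "alternating (2 * (?n - 1)) ?a" "alternating (2 * ?n) ?b"
      using wedge_pow_alternating[of 2 "?n - 1" "omegaV g x"] wedge_pow_alternating[of 2 ?n "omegaH g x"]
      unfolding alternating_def by simp_all
    show "?b Y = 0" if "i < 2 * ?n" "Y i \<in> {X. fst X = 0}" for Y i
    proof -
      have "omegaH g x X = 0" if "X 0 \<in> {X. fst X = 0} \<or> X 1 \<in> {X. fst X = 0}" for X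
        using that by (auto simp: omegaH_kform[OF x] H.kform_def hform_def)
      then show ?thesis using wedge_pow_vanish[of "{X. fst X = 0}" "omegaH g x" i ?n Y] that by auto
    qed
    show "aff_frame k i \<in> {X. fst X = 0}" if "2 * ?n \<le> i" for i :: nat
      using that by (simp add: aff_frame_def Let_def)
    show "even (2 * (?n - 1))" "even (2 * ?n)" by auto
    show "0 < ?b (aff_frame k)"
    proof -
      have bij: "bij_betw (from_nat_into (UNIV::'n set)) {..<?n} UNIV"
        using bij_betw_from_nat_into_finite[of "UNIV::'n set"] by simp
      have "H.pos_on ?n (\<lambda>j. (axis (from_nat_into UNIV j) 1, 0))"
      proof (rule pos_on_axes[OF H.hermitian_form_axioms, where J = "\<lambda>\<xi>. (\<xi>, 0)"])
        show "inj_on (from_nat_into (UNIV::'n set)) {..<?n}" using bij by (simp add: bij_betw_def)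
        show "0 < hform g x (\<xi>, 0) (\<xi>, 0)" if "\<xi> \<noteq> 0" for \<xi>
          using pos_def[OF x that] by (simp add: hform_def mult.assoc)
      qed (auto simp: cscale_def)
      from H.kpow_pos[OF this]
      have "0 < wedge_pow 2 (omegaH g x) ?n (complex_frame (\<lambda>j. (axis (from_nat_into UNIV j) 1, 0)))"
        by (simp add: omegaH_kform[OF x])
      also have "wedge_pow 2 (omegaH g x) ?n (complex_frame (\<lambda>j. (axis (from_nat_into UNIV j) 1, 0)))
         = wedge_pow 2 (omegaH g x) ?n (aff_frame k)"
        by (rule dependsD[OF dep(2)]) (auto simp: complex_frame_def aff_frame_def cscale_def vec_eq_iff axis_def)
      finally show ?thesis using complex_mult_pos[OF _ fp[of ?n]] by simp
    qed
    show "0 < ?a (\<lambda>i. aff_frame k (2 * ?n + i))"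
    proof -
      have card: "card (- {k}) = ?n - 1" by (simp add: Compl_eq_Diff_UNIV card_Diff_singleton)
      have bij: "bij_betw (from_nat_into (- {k})) {..<?n - 1} (- {k})"
        using bij_betw_from_nat_into_finite[of "- {k}"] by (simp add: card)
      have "V.pos_on (?n - 1) (\<lambda>j. (0, axis (from_nat_into (- {k}) j) 1))"
      proof (rule pos_on_axes[OF V.hermitian_form_axioms, where J = "\<lambda>\<xi>. (0, \<xi>)"])
        show "inj_on (from_nat_into (- {k})) {..<?n - 1}" using bij by (simp add: bij_betw_def)
        show "0 < vform g x (0, \<xi>) (0, \<xi>)"
          if "\<xi> \<noteq> 0" "\<And>i. i \<notin> from_nat_into (- {k}) ` {..<?n - 1} \<Longrightarrow> \<xi> $ i = 0" for \<xi>
        proof -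
          have "\<xi> $ k = 0" using that(2)[of k] bij by (auto simp: bij_betw_def)
          from logH_pos[OF x that(1) this v] show ?thesis by (simp add: vform_def vert_comp_def)
        qed
      qed (auto simp: cscale_def)
      from V.kpow_pos[OF this]
      have "0 < wedge_pow 2 (omegaV g x) (?n - 1) (complex_frame (\<lambda>j. (0, axis (from_nat_into (- {k}) j) 1)))"
        by (simp add: omegaV_kform[OF x])
      also have "wedge_pow 2 (omegaV g x) (?n - 1) (complex_frame (\<lambda>j. (0, axis (from_nat_into (- {k}) j) 1)))
         = wedge_pow 2 (omegaV g x) (?n - 1) (\<lambda>i. aff_frame k (2 * ?n + i))"
        by (rule dependsD[OF dep(1)]) (auto simp: complex_frame_def aff_frame_def cscale_def vec_eq_iff axis_def)
      finally show ?thesis using complex_mult_pos[OF _ fp[of "?n - 1"]] by simp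
    qed
  qed
  then show ?thesis by (simp add: vol_def Let_def)
qed

lemma vol_continuous: "continuous_on S (\<lambda>x. vol g x X)"
proof -
  note c = smooth_on_continuous_on
  have L: "continuous_on S (logH g \<alpha> \<beta>)" for \<alpha> \<beta>
    by (rule c, rule smooth_on_cong_imp[OF open_S _ smooth_on_dv[OF open_S smooth_log_gradient, of \<alpha> \<beta>]])
      (simp add: logH_eq(2))
  have D: "continuous_on S (\<lambda>x. deltav_form g x \<alpha> X)" for \<alpha> X
    unfolding deltav_form_def by (intro continuous_intros c smooth_Gam)
  have "continuous_on S (\<lambda>x. omegaV g x X)" for X
    unfolding omegaV_def logH_def[symmetric] by (intro continuous_intros L wedge_continuous D)
  moreover have "continuous_on S (\<lambda>x. omegaH g x X)" for X
    unfolding omegaH_def by (intro continuous_intros c smooth_Gm)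
  ultimately show ?thesis
    unfolding vol_def Let_def by (intro wedge_continuous continuous_intros wedge_pow_continuous) auto
qed

end

context conformal_chart begin

lemma logH_conf:
  assumes x: "x \<in> S"
  shows "logH conf_g \<alpha> \<beta> x = logH g \<alpha> \<beta> x"
proof -
  have "smooth_on S conf_g"
    unfolding conf_g_def[abs_def] using smooth_on_fst[OF open_U _ smooth_r, of "UNIV - {0}"]
    by (intro smooth_on_mult smooth_on_exp smooth_g open_S) auto
  then have d: "conf_g differentiable (at y)" if "y \<in> S" for y
    using smooth_on_differentiable that by blast
  have p: "0 < conf_g y" if "y \<in> S" for y using g_pos[OF that] by (simp add: conf_g_def)
  have "inverse (G y) * dvbar \<beta> G y = dvbar \<beta> (\<lambda>y. complex_of_real (ln (conf_g y))) y" if "y \<in> S" for y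
    using that log_derivative[OF derivation_dvbar d[OF that] p[OF that], of \<beta>] dvbar_conf[OF that, of \<beta>]
    by (simp add: conf_G)
  from derivation_cong[OF derivation_dv open_S x this smooth_on_differentiable[OF smooth_log_gradient x], of \<alpha>]
  show ?thesis unfolding logH_eq(2)[OF x] by (simp add: logH_def)
qed

text \<open>The forms \<open>deltav_form\<close> change by multiples of the components of \<open>v\<close>, which is in the kernel of \<open>logH\<close>.\<close>

lemma omegaV_conf:
  assumes x: "x \<in> S"
  shows "omegaV conf_g x = omegaV g x"
proof
  fix X :: "nat \<Rightarrow> 'n coords"
  define s where "s Y = (\<Sum>\<beta>\<in>UNIV. dz \<beta> rho x * fst (Y 0) $ \<beta>)" for Y :: "nat \<Rightarrow> 'n coords"
  have dvf: "deltav_form conf_g x \<alpha> Y = deltav_form g x \<alpha> Y + snd x $ \<alpha> * s Y" for \<alpha> Y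
    by (simp add: deltav_form_def Gam_conf[OF x] s_def algebra_simps sum.distrib sum_distrib_left)
  let ?a = "deltav_form g x"
  have van: "(\<Sum>\<alpha>\<in>UNIV. \<Sum>\<beta>\<in>UNIV. logH g \<alpha> \<beta> x * ((?a \<alpha> Y + snd x $ \<alpha> * s Y) * cnj (?a \<beta> Z + snd x $ \<beta> * s Z)))
     = (\<Sum>\<alpha>\<in>UNIV. \<Sum>\<beta>\<in>UNIV. logH g \<alpha> \<beta> x * (?a \<alpha> Y * cnj (?a \<beta> Z)))" for Y Z
  proof -
    have "(\<Sum>\<alpha>\<in>UNIV. \<Sum>\<beta>\<in>UNIV. logH g \<alpha> \<beta> x * ((?a \<alpha> Y + snd x $ \<alpha> * s Y) * cnj (?a \<beta> Z + snd x $ \<beta> * s Z)))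
      = (\<Sum>\<alpha>\<in>UNIV. \<Sum>\<beta>\<in>UNIV. logH g \<alpha> \<beta> x * (?a \<alpha> Y * cnj (?a \<beta> Z))
         + (?a \<alpha> Y * cnj (s Z)) * (logH g \<alpha> \<beta> x * cnj (snd x $ \<beta>))
         + (s Y * cnj (?a \<beta> Z + snd x $ \<beta> * s Z)) * (logH g \<alpha> \<beta> x * snd x $ \<alpha>))"
      by (intro sum.cong refl) (simp add: algebra_simps)
    also have "\<dots> = (\<Sum>\<alpha>\<in>UNIV. \<Sum>\<beta>\<in>UNIV. logH g \<alpha> \<beta> x * (?a \<alpha> Y * cnj (?a \<beta> Z)))
         + (\<Sum>\<alpha>\<in>UNIV. (?a \<alpha> Y * cnj (s Z)) * (\<Sum>\<beta>\<in>UNIV. logH g \<alpha> \<beta> x * cnj (snd x $ \<beta>)))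
         + (\<Sum>\<alpha>\<in>UNIV. \<Sum>\<beta>\<in>UNIV. (s Y * cnj (?a \<beta> Z + snd x $ \<beta> * s Z)) * (logH g \<alpha> \<beta> x * snd x $ \<alpha>))"
      by (simp only: sum.distrib sum_distrib_left)
    also have "(\<Sum>\<alpha>\<in>UNIV. \<Sum>\<beta>\<in>UNIV. (s Y * cnj (?a \<beta> Z + snd x $ \<beta> * s Z)) * (logH g \<alpha> \<beta> x * snd x $ \<alpha>))
       = (\<Sum>\<beta>\<in>UNIV. (s Y * cnj (?a \<beta> Z + snd x $ \<beta> * s Z)) * (\<Sum>\<alpha>\<in>UNIV. logH g \<alpha> \<beta> x * snd x $ \<alpha>))"
      by (subst sum.swap) (simp only: sum_distrib_left)
    finally show ?thesis by (simp add: logH_radial[OF x])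
  qed
  show "omegaV conf_g x X = omegaV g x X"
    unfolding omegaV_def logH_def[symmetric] logH_conf[OF x] wedge_11 dvf right_diff_distrib sum_subtractf van ..
qed

lemma omegaH_conf: "x \<in> S \<Longrightarrow> omegaH conf_g x = (\<lambda>X. R x * omegaH g x X)"
  by (simp add: omegaH_def fun_eq_iff Gm_conf sum_distrib_left mult_ac)

lemma vol_conf:
  assumes x: "x \<in> S"
  shows "vol conf_g x X = R x ^ CARD('n) * vol g x X"
  unfolding vol_def Let_def omegaV_conf[OF x] omegaH_conf[OF x] wedge_pow_cmult
  by (simp add: wedge_def sum_distrib_left mult_ac)

end

section \<open>Complex manifolds and their tangent bundles\<close>

locale complex_manifold =
  fixes A :: "('m::{t2_space,second_countable_topology}, 'n::finite) chart set"
  assumes atlas: "complex_atlas A"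
begin

abbreviation "img c \<equiv> snd c ` fst c"

lemma cover: "\<exists>c\<in>A. p \<in> fst c"
  using atlas unfolding complex_atlas_def by blast

lemma chart_facts:
  assumes "c \<in> A"
  shows "open (fst c)" "open (img c)" "homeomorphism (fst c) (img c) (snd c) (chart_inv c)"
  using assms atlas unfolding complex_atlas_def by blast+

lemma chart_inv:
  assumes "c \<in> A"
  shows "p \<in> fst c \<Longrightarrow> chart_inv c (snd c p) = p" "z \<in> img c \<Longrightarrow> snd c (chart_inv c z) = z"
    "z \<in> img c \<Longrightarrow> chart_inv c z \<in> fst c"
  using chart_facts(3)[OF assms] unfolding homeomorphism_def by auto

lemma chart_continuous:
  assumes "c \<in> A"
  shows "continuous_on (fst c) (snd c)" "continuous_on (img c) (chart_inv c)"
  using chart_facts(3)[OF assms] unfolding homeomorphism_def by auto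

lemma open_chart_image:
  assumes "c \<in> A" "open W"
  shows "open (snd c ` (fst c \<inter> W))"
proof -
  have "snd c ` (fst c \<inter> W) = img c \<inter> chart_inv c -` W"
    using chart_inv[OF assms(1)] by (auto intro!: image_eqI)
  then show ?thesis
    using continuous_open_preimage[OF chart_continuous(2) chart_facts(2) assms(2)] assms(1) by simp
qed

lemma transition_smooth:
  assumes "c \<in> A" "c' \<in> A"
  shows "smooth_on (snd c ` (fst c \<inter> fst c')) (transition c c')"
  using assms atlas unfolding complex_atlas_def holomorphic_map_on_def by blast

lemma transition_derivative:
  assumes "c \<in> A" "c' \<in> A" "p \<in> fst c" "p \<in> fst c'"
  shows "(transition c c' has_derivative jac c c' p) (at (snd c p))"
  unfolding jac_def using smooth_on_has_derivative[OF transition_smooth[OF assms(1,2)]] assms by blast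

lemma transition_value:
  assumes "c \<in> A" "p \<in> fst c"
  shows "transition c c' (snd c p) = snd c' p"
  by (simp add: transition_def chart_inv[OF assms(1)] assms)

lemma jac_linear:
  assumes "c \<in> A" "c' \<in> A" "p \<in> fst c" "p \<in> fst c'"
  shows "linear (jac c c' p)" "jac c c' p (a *s h) = a *s jac c c' p h"
proof -
  show "linear (jac c c' p)"
    using transition_derivative[OF assms] has_derivative_linear by blast
  have "holomorphic_map_on (snd c ` (fst c \<inter> fst c')) (transition c c')"
    using assms(1,2) atlas unfolding complex_atlas_def by blast
  then show "jac c c' p (a *s h) = a *s jac c c' p h"
    using assms(3,4) unfolding holomorphic_map_on_def jac_def by blast
qed

text \<open>The chain rule for the coordinate change from \<open>c\<close> to \<open>c''\<close> via \<open>c'\<close>.\<close>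

lemma jac_compose:
  assumes "c \<in> A" "c' \<in> A" "c'' \<in> A" "p \<in> fst c" "p \<in> fst c'" "p \<in> fst c''"
  shows "jac c' c'' p (jac c c' p v) = jac c c'' p v"
proof -
  have "(transition c' c'' has_derivative jac c' c'' p) (at (transition c c' (snd c p)))"
    using transition_derivative[OF assms(2,3,5,6)] transition_value[OF assms(1,4)] by simp
  from has_derivative_compose[OF transition_derivative[OF assms(1,2,4,5)] this]
  have 1: "((\<lambda>z. transition c' c'' (transition c c' z)) has_derivative (\<lambda>v. jac c' c'' p (jac c c' p v))) (at (snd c p))" .
  have "((\<lambda>z. transition c' c'' (transition c c' z)) has_derivative jac c c'' p) (at (snd c p))"
  proof (rule has_derivative_transform_within_open[OF transition_derivative[OF assms(1,3,4,6)]])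
    show "open (snd c ` (fst c \<inter> (fst c' \<inter> fst c'')))"
      using chart_facts(1) assms by (intro open_chart_image open_Int) auto
    show "snd c p \<in> snd c ` (fst c \<inter> (fst c' \<inter> fst c''))" using assms by blast
    show "transition c c'' x = transition c' c'' (transition c c' x)"
      if "x \<in> snd c ` (fst c \<inter> (fst c' \<inter> fst c''))" for x
      using that chart_inv[OF assms(1)] chart_inv[OF assms(2)] by (auto simp: transition_def)
  qed
  from fun_cong[OF has_derivative_unique[OF 1 this]] show ?thesis .
qed

lemma jac_id:
  assumes "c \<in> A" "p \<in> fst c"
  shows "jac c c p v = v"
proof -
  have "(transition c c has_derivative (\<lambda>v. v)) (at (snd c p))"
    by (rule has_derivative_transform_within_open[OF has_derivative_ident chart_facts(2)[OF assms(1)]])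
      (use assms chart_inv[OF assms(1)] in \<open>auto simp: transition_def\<close>)
  from has_derivative_unique[OF this transition_derivative[OF assms(1,1,2,2)]] show ?thesis by metis
qed

lemma jac_nonzero:
  assumes "c \<in> A" "c' \<in> A" "p \<in> fst c" "p \<in> fst c'" "v \<noteq> 0"
  shows "jac c c' p v \<noteq> 0"
proof
  assume "jac c c' p v = 0"
  then have "jac c' c p (jac c c' p v) = 0" using linear_0[OF jac_linear(1)[OF assms(2,1,4,3)]] by simp
  then show False using jac_compose[OF assms(1,2,1,3,4,3)] jac_id[OF assms(1,3)] assms(5) by simp
qed

lemma tpoint_eq: "tpoint A c (z, v) = (chart_inv c z,
    \<lambda>c'. if c' \<in> A \<and> chart_inv c z \<in> fst c' then jac c c' (chart_inv c z) v else 0)"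
  unfolding tpoint_def Let_def fst_conv snd_conv ..

lemma tpoint_fst [simp]: "fst (tpoint A c x) = chart_inv c (fst x)"
  by (simp add: tpoint_def Let_def)

lemma tpoint_in:
  assumes "c \<in> A" "z \<in> img c"
  shows "tpoint A c (z, v) \<in> tangent_bundle A"
    and "v \<noteq> 0 \<Longrightarrow> tpoint A c (z, v) \<in> slit_bundle A"
proof -
  note p = chart_inv(3)[OF assms]
  show 1: "tpoint A c (z, v) \<in> tangent_bundle A"
    unfolding tangent_bundle_def tpoint_eq using jac_compose[OF assms(1) _ _ p] by auto
  obtain w where w: "tpoint A c (z, v) = (chart_inv c z, w)" by (simp add: tpoint_eq)
  have "w c = v"
    using w p assms jac_id[OF assms(1) p] by (auto simp: tpoint_eq)
  then have "v \<noteq> 0 \<Longrightarrow> w \<noteq> (\<lambda>_. 0)" by auto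
  then show "v \<noteq> 0 \<Longrightarrow> tpoint A c (z, v) \<in> slit_bundle A"
    using 1 unfolding w slit_bundle_def by simp
qed

lemma tpoint_scale:
  assumes "c \<in> A" "z \<in> img c"
  shows "tpoint A c (z, \<zeta> *s v) = tscale \<zeta> (tpoint A c (z, v))"
  using jac_linear(2)[OF assms(1) _ chart_inv(3)[OF assms]] by (auto simp: tpoint_eq tscale_def fun_eq_iff)

lemma tpoint_of_tangent:
  assumes "(p, w) \<in> tangent_bundle A" "c \<in> A" "p \<in> fst c"
  shows "tpoint A c (snd c p, w c) = (p, w)"
proof -
  have w: "w c' = jac c c' p (w c)" if "c' \<in> A" "p \<in> fst c'" for c'
    using assms that unfolding tangent_bundle_def by blast
  have z: "w c' = 0" if "c' \<notin> A \<or> p \<notin> fst c'" for c'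
    using assms that unfolding tangent_bundle_def by blast
  have "(if c' \<in> A \<and> p \<in> fst c' then jac c c' p (w c) else 0) = w c'" for c'
    using w[of c'] z[of c'] by (cases "c' \<in> A \<and> p \<in> fst c'") auto
  then show ?thesis unfolding tpoint_eq chart_inv(1)[OF assms(2,3)] by simp
qed

lemma tpoint_change:
  assumes "c \<in> A" "c' \<in> A" "p \<in> fst c" "p \<in> fst c'"
  shows "tpoint A c (snd c p, v) = tpoint A c' (snd c' p, jac c c' p v)"
  using chart_inv(1)[OF assms(1,3)] chart_inv(1)[OF assms(2,4)] jac_compose[OF assms(1,2) _ assms(3,4)]
  by (auto simp: tpoint_eq fun_eq_iff)

end

section \<open>Coordinate changes\<close>

text \<open>The chain rule for the complex-linear \<open>L\<close>, in the abstract form that is needed for vertical and for horizontal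
derivatives: \<open>D\<close> is the pulled back differential, \<open>P\<close> and \<open>Q\<close> are the Wirtinger derivatives in the new coordinates.\<close>

lemma wirtinger_change:
  fixes L :: "complex^'n::finite \<Rightarrow> complex^'n"
  assumes L: "\<And>a h. L (a *s h) = a *s L h"
    and eq: "\<And>h. D (h :: complex^'n) = (\<Sum>\<gamma>\<in>UNIV. L h $ \<gamma> * P \<gamma> + cnj (L h $ \<gamma>) * Q \<gamma>)"
  shows "(D (axis \<alpha> 1) - \<i> * D (axis \<alpha> \<i>)) / 2 = (\<Sum>\<gamma>\<in>UNIV. L (axis \<alpha> 1) $ \<gamma> * P \<gamma>)"
    and "(D (axis \<alpha> 1) + \<i> * D (axis \<alpha> \<i>)) / 2 = (\<Sum>\<gamma>\<in>UNIV. cnj (L (axis \<alpha> 1) $ \<gamma>) * Q \<gamma>)"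
proof -
  have "axis \<alpha> \<i> = \<i> *s (axis \<alpha> 1 :: complex^'n)" by (simp add: vec_eq_iff axis_def)
  then have Li: "L (axis \<alpha> \<i>) $ \<gamma> = \<i> * L (axis \<alpha> 1) $ \<gamma>" for \<gamma> by (simp add: L)
  have "D (axis \<alpha> \<i>) = \<i> * ((\<Sum>\<gamma>\<in>UNIV. L (axis \<alpha> 1) $ \<gamma> * P \<gamma>) - (\<Sum>\<gamma>\<in>UNIV. cnj (L (axis \<alpha> 1) $ \<gamma>) * Q \<gamma>))"
    unfolding eq Li by (simp add: sum.distrib sum_distrib_left sum_subtractf algebra_simps sum_negf)
  note Di = this
  have D1: "D (axis \<alpha> 1) = (\<Sum>\<gamma>\<in>UNIV. L (axis \<alpha> 1) $ \<gamma> * P \<gamma>) + (\<Sum>\<gamma>\<in>UNIV. cnj (L (axis \<alpha> 1) $ \<gamma>) * Q \<gamma>)"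
    unfolding eq by (simp add: sum.distrib)
  have "(a + b - \<i> * (\<i> * (a - b))) / 2 = a" "(a + b + \<i> * (\<i> * (a - b))) / 2 = b" for a b :: complex
    by (simp_all add: algebra_simps)
  then show "(D (axis \<alpha> 1) - \<i> * D (axis \<alpha> \<i>)) / 2 = (\<Sum>\<gamma>\<in>UNIV. L (axis \<alpha> 1) $ \<gamma> * P \<gamma>)"
    "(D (axis \<alpha> 1) + \<i> * D (axis \<alpha> \<i>)) / 2 = (\<Sum>\<gamma>\<in>UNIV. cnj (L (axis \<alpha> 1) $ \<gamma>) * Q \<gamma>)"
    unfolding Di D1 by blast+
qed

text \<open>Vertical derivatives are taken at a fixed base point \<open>z\<close>, where the change of fibre coordinates is
linear. Thus no derivatives of the Jacobian appear, also not when this is applied twice.\<close>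

lemma fibre_change:
  fixes f f' :: "'n::finite coords \<Rightarrow> complex" and L :: "complex^'n \<Rightarrow> complex^'n"
  assumes L: "linear L" "\<And>a h. L (a *s h) = a *s L h"
    and eq: "\<And>u. u \<noteq> 0 \<Longrightarrow> f (z, u) = f' (z', L u)" and v: "v \<noteq> 0"
    and f: "f differentiable (at (z, v))" and f': "f' differentiable (at (z', L v))"
  shows "dv \<alpha> f (z, v) = (\<Sum>\<gamma>\<in>UNIV. L (axis \<alpha> 1) $ \<gamma> * dv \<gamma> f' (z', L v))"
    and "dvbar \<alpha> f (z, v) = (\<Sum>\<gamma>\<in>UNIV. cnj (L (axis \<alpha> 1) $ \<gamma>) * dvbar \<gamma> f' (z', L v))"
proof -
  have "((\<lambda>u. (z, u)) has_derivative (\<lambda>h. (0, h))) (at v)"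
    by (auto intro!: derivative_eq_intros)
  from has_derivative_compose[OF this] f[unfolded frechet_derivative_works]
  have 1: "((\<lambda>u. f (z, u)) has_derivative (\<lambda>h. frechet_derivative f (at (z, v)) (0, h))) (at v)" by blast
  have "(L has_derivative L) (at v)" using L(1) by (simp add: linear_imp_has_derivative)
  then have "((\<lambda>u. (z', L u)) has_derivative (\<lambda>h. (0, L h))) (at v)"
    by (auto intro!: derivative_eq_intros)
  from has_derivative_compose[OF this] f'[unfolded frechet_derivative_works]
  have "((\<lambda>u. f' (z', L u)) has_derivative (\<lambda>h. frechet_derivative f' (at (z', L v)) (0, L h))) (at v)" by blast
  then have 2: "((\<lambda>u. f (z, u)) has_derivative (\<lambda>h. frechet_derivative f' (at (z', L v)) (0, L h))) (at v)"
    by (rule has_derivative_transform_within_open[of _ _ _ _ "UNIV - {0}"]) (use eq v in auto)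
  have "frechet_derivative f (at (z, v)) (0, h)
     = (\<Sum>\<gamma>\<in>UNIV. L h $ \<gamma> * dv \<gamma> f' (z', L v) + cnj (L h $ \<gamma>) * dvbar \<gamma> f' (z', L v))" for h
    using has_derivative_unique[OF 1 2] unfolding frechet_vertical[OF f', symmetric] by meson
  from wirtinger_change[OF L(2) this, of \<alpha>]
  show "dv \<alpha> f (z, v) = (\<Sum>\<gamma>\<in>UNIV. L (axis \<alpha> 1) $ \<gamma> * dv \<gamma> f' (z', L v))"
    "dvbar \<alpha> f (z, v) = (\<Sum>\<gamma>\<in>UNIV. cnj (L (axis \<alpha> 1) $ \<gamma>) * dvbar \<gamma> f' (z', L v))"
    by (simp_all add: dv_def dvbar_def)
qed

lemma sum_lists_of_0:
  fixes f :: "'a list \<Rightarrow> 'b::comm_monoid_add"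
  shows "(\<Sum>I\<in>lists_of 0. f I) = f []"
  by (simp add: lists_of_def)

lemma sum_lists_of_1:
  fixes f :: "'a::finite list \<Rightarrow> 'b::comm_monoid_add"
  shows "(\<Sum>I\<in>lists_of 1. f I) = (\<Sum>\<alpha>\<in>UNIV. f [\<alpha>])"
proof -
  have "lists_of 1 = range (\<lambda>\<alpha>::'a. [\<alpha>])" by (auto simp: lists_of_def length_Suc_conv)
  moreover have "inj (\<lambda>\<alpha>::'a. [\<alpha>])" by (simp add: inj_def)
  ultimately show ?thesis by (simp only: sum.reindex o_def)
qed

lemma permutes_1: "\<sigma> permutes {..<1::nat} \<Longrightarrow> \<sigma> = id"
  by (simp add: lessThan_Suc)

locale finsler_manifold = complex_manifold A
  for A :: "('m::{t2_space,second_countable_topology}, 'n::finite) chart set" +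
  fixes F :: "('m, 'n) tvec \<Rightarrow> real"
  assumes finsler: "complex_finsler A F" and pseudoconvex: "strongly_pseudoconvex A F"
begin

abbreviation "gl c \<equiv> Gloc A F c"

lemma slit_coords_eq: "slit_coords c = img c \<times> (UNIV - {0})"
  by (simp add: slit_coords_def)

lemma finsler_chart:
  assumes c: "c \<in> A"
  shows "finsler_chart (img c) (gl c)"
proof
  show "open (img c)" by (rule chart_facts(2)[OF c])
  show "smooth_on (img c \<times> (UNIV - {0})) (gl c)"
    using finsler c unfolding complex_finsler_def slit_coords_eq by blast
  show "0 < gl c x" if "x \<in> img c \<times> (UNIV - {0})" for x
  proof -
    from that obtain z v where "x = (z, v)" "z \<in> img c" "v \<noteq> 0" by blast
    then have "tpoint A c x \<in> slit_bundle A" using tpoint_in(2)[OF c] by simp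
    then have "0 < F (tpoint A c x)" using finsler unfolding complex_finsler_def by blast
    then show ?thesis by (simp add: Gloc_def)
  qed
  show "gl c (z, \<zeta> *s v) = (cmod \<zeta>)\<^sup>2 * gl c (z, v)" if "z \<in> img c" for z v \<zeta>
  proof -
    have "F (tscale \<zeta> (tpoint A c (z, v))) = cmod \<zeta> * F (tpoint A c (z, v))"
      using finsler tpoint_in(1)[OF c that] unfolding complex_finsler_def by blast
    then show ?thesis by (simp add: Gloc_def tpoint_scale[OF c that] power_mult_distrib)
  qed
  show "0 < (\<Sum>\<alpha>\<in>UNIV. \<Sum>\<beta>\<in>UNIV. Gm (gl c) \<alpha> \<beta> x * \<xi> $ \<alpha> * cnj (\<xi> $ \<beta>))"
    if "x \<in> img c \<times> (UNIV - {0})" "\<xi> \<noteq> 0" for x \<xi>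
    using pseudoconvex c that unfolding strongly_pseudoconvex_def slit_coords_eq by blast
qed

lemma Gloc_change:
  assumes "c \<in> A" "c' \<in> A" "p \<in> fst c" "p \<in> fst c'"
  shows "gl c (snd c p, v) = gl c' (snd c' p, jac c c' p v)"
  by (simp add: Gloc_def tpoint_change[OF assms])

text \<open>Apply \<open>fibre_change\<close> to \<open>G\<close> and then to its derivatives by \<open>cnj v\<close>: their expressions in the other chart have the
entries of the Jacobian as coefficients, which are constant along the fibre.\<close>

lemma Gm_change:
  assumes c: "c \<in> A" "c' \<in> A" "p \<in> fst c" "p \<in> fst c'" and v: "v \<noteq> 0"
  shows "Gm (gl c) \<alpha> \<beta> (snd c p, v) = (\<Sum>\<gamma>\<in>UNIV. \<Sum>\<delta>\<in>UNIV.
     jac_comp c c' p \<gamma> \<alpha> * cnj (jac_comp c c' p \<delta> \<beta>) * Gm (gl c') \<gamma> \<delta> (snd c' p, jac c c' p v))"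
proof -
  interpret X: finsler_chart "img c" "gl c" by (rule finsler_chart[OF c(1)])
  interpret Y: finsler_chart "img c'" "gl c'" by (rule finsler_chart[OF c(2)])
  note L = jac_linear[OF c]
  have x: "(snd c p, u) \<in> X.S" "(snd c' p, jac c c' p u) \<in> Y.S" if "u \<noteq> 0" for u
    using c that jac_nonzero[OF c that] by auto
  define f' where "f' y = (\<Sum>\<delta>\<in>UNIV. cnj (jac_comp c c' p \<delta> \<beta>) * dvbar \<delta> Y.G y)" for y
  have f'd: "f' differentiable (at y)" if "y \<in> Y.S" for y
    unfolding f'_def[abs_def] using Y.differentiable_basics(5)[OF that] by (intro differentiable_sum differentiable_mult differentiable_const) auto
  have "dvbar \<beta> X.G (snd c p, u) = f' (snd c' p, jac c c' p u)" if u: "u \<noteq> 0" for u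
    unfolding f'_def jac_comp_def
    by (rule fibre_change(2)[OF L _ u]) (use Gloc_change[OF c] X.differentiable_basics(1)[OF x(1)[OF u]] Y.differentiable_basics(1)[OF x(2)[OF u]] in auto)
  note fc = fibre_change(1)[OF L this v X.differentiable_basics(5)[OF x(1)[OF v]] f'd[OF x(2)[OF v]]]
  have dvf: "dv \<gamma> f' (snd c' p, jac c c' p v) = (\<Sum>\<delta>\<in>UNIV. cnj (jac_comp c c' p \<delta> \<beta>) * Gm (gl c') \<gamma> \<delta> (snd c' p, jac c c' p v))" for \<gamma>
    unfolding f'_def[abs_def] using Y.differentiable_basics(5)[OF x(2)[OF v]]
    by (subst derivation_sum[OF derivation_dv])
      (auto intro!: differentiable_mult simp: derivation_cmult[OF derivation_dv] Gm_def)
  from fc have "Gm (gl c) \<alpha> \<beta> (snd c p, v) = (\<Sum>\<gamma>\<in>UNIV. jac_comp c c' p \<gamma> \<alpha> * dv \<gamma> f' (snd c' p, jac c c' p v))"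
    by (simp add: Gm_def jac_comp_def)
  then show ?thesis by (simp add: dvf sum_distrib_left mult.assoc)
qed

lemma omegaH_horizontal: "horizontal_form A 1 1 (omegaH_hform A F)"
  unfolding horizontal_form_def
proof (intro conjI ballI allI impI)
  fix c :: "('m, 'n) chart" and I J :: "'n list" assume c: "c \<in> A"
  interpret X: finsler_chart "img c" "gl c" by (rule finsler_chart[OF c])
  show "omegaH_hform A F c I J x = 0" if "length I \<noteq> 1 \<or> length J \<noteq> 1" for x
    using that by (auto simp: omegaH_hform_def)
  show "smooth_on (slit_coords c) (omegaH_hform A F c I J)"
  proof (cases "length I = 1 \<and> length J = 1")
    case True
    then have "omegaH_hform A F c I J = (\<lambda>x. \<i> * Gm (gl c) (I ! 0) (J ! 0) x)"
      by (auto simp: omegaH_hform_def fun_eq_iff)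
    then show ?thesis unfolding slit_coords_eq
      by (simp add: smooth_on_mult[OF X.open_S smooth_on_const[OF X.open_S] X.smooth_Gm])
  next
    case False
    then have "omegaH_hform A F c I J = (\<lambda>x. 0)" by (auto simp: omegaH_hform_def fun_eq_iff)
    then show ?thesis unfolding slit_coords_eq by (simp add: smooth_on_const[OF X.open_S])
  qed
  fix zv assume "zv \<in> slit_coords c"
  then show "case zv of (z, v) \<Rightarrow> \<forall>\<zeta>. \<zeta> \<noteq> 0 \<longrightarrow> omegaH_hform A F c I J (z, \<zeta> *s v) = omegaH_hform A F c I J (z, v)"
    using bihomD[OF X.bihom_Gm] by (auto simp: slit_coords_eq omegaH_hform_def)
next
  fix c :: "('m, 'n) chart" and I J x \<sigma> \<tau>
  assume "\<sigma> permutes {..<1::nat}" "\<tau> permutes {..<1::nat}"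
  then have "\<sigma> = id" "\<tau> = id" using permutes_1 by blast+
  then show "omegaH_hform A F c (permute_list \<sigma> I) (permute_list \<tau> J) x
      = of_int (sign \<sigma> * sign \<tau>) * omegaH_hform A F c I J x"
    by simp
next
  fix c c' :: "('m, 'n) chart" and p and v :: "complex^'n" and I J :: "'n list"
  assume *: "c \<in> A" "c' \<in> A" "p \<in> fst c \<inter> fst c'" "v \<noteq> 0" "I \<in> lists_of 1" "J \<in> lists_of 1"
  have L: "length I = 1" "length J = 1" using *(5,6) by (auto simp: lists_of_def)
  show "omegaH_hform A F c I J (snd c p, v) = (\<Sum>I'\<in>lists_of 1. \<Sum>J'\<in>lists_of 1.
         (\<Prod>i<1. jac_comp c c' p (I' ! i) (I ! i)) * (\<Prod>j<1. cnj (jac_comp c c' p (J' ! j) (J ! j))) *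
         omegaH_hform A F c' I' J' (snd c' p, jac c c' p v))"
    unfolding sum_lists_of_1 using *(3) L
    by (simp add: omegaH_hform_def Gm_change[OF *(1,2) _ _ *(4)] sum_distrib_left mult_ac)
qed

definition fun_coords :: "('m \<Rightarrow> real) \<Rightarrow> ('m, 'n) chart \<Rightarrow> 'n coords \<Rightarrow> complex" where
  "fun_coords f c x = of_real (f (chart_inv c (fst x)))"

text \<open>The horizontal \<open>(1, 0)\<close>-form \<open>\<partial>f\<close> of a function \<open>f\<close> on the base.\<close>

definition del :: "('m \<Rightarrow> real) \<Rightarrow> ('m, 'n) hform" where
  "del f c I J x = (if length I = 1 \<and> length J = 0 then dz (I ! 0) (fun_coords f c) x else 0)"

lemma fun_coords_smooth:
  assumes "smooth_fun A f" "c \<in> A"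
  shows "smooth_on (img c) (\<lambda>z. complex_of_real (f (chart_inv c z)))" "smooth_on (slit_coords c) (fun_coords f c)"
proof -
  have *: "smooth_on (img c) (\<lambda>z. f (chart_inv c z))" using assms unfolding smooth_fun_def by blast
  show 1: "smooth_on (img c) (\<lambda>z. complex_of_real (f (chart_inv c z)))"
    by (rule smooth_on_of_real[OF chart_facts(2)[OF assms(2)] *])
  show "smooth_on (slit_coords c) (fun_coords f c)"
    unfolding slit_coords_eq fun_coords_def[abs_def]
    by (rule smooth_on_fst[OF chart_facts(2)[OF assms(2)] _ 1]) auto
qed

lemma del_change:
  assumes c: "c \<in> A" "c' \<in> A" "p \<in> fst c" "p \<in> fst c'" and f: "smooth_fun A f"
  shows "dz \<alpha> (fun_coords f c) (snd c p, v) = (\<Sum>\<gamma>\<in>UNIV. jac_comp c c' p \<gamma> \<alpha> * dz \<gamma> (fun_coords f c') (snd c' p, w))"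
proof -
  let ?f = "\<lambda>c z. complex_of_real (f (chart_inv c z))"
  have d: "(?f c has_derivative frechet_derivative (?f c) (at (snd c p))) (at (snd c p))"
    using smooth_on_has_derivative[OF fun_coords_smooth(1)[OF f c(1)]] c by blast
  have d': "(?f c' has_derivative frechet_derivative (?f c') (at (snd c' p))) (at (snd c' p))"
    using smooth_on_has_derivative[OF fun_coords_smooth(1)[OF f c(2)]] c by blast
  then have "(?f c' has_derivative frechet_derivative (?f c') (at (snd c' p))) (at (transition c c' (snd c p)))"
    by (simp add: transition_value c)
  from has_derivative_compose[OF transition_derivative[OF c] this]
  have "((\<lambda>z. ?f c' (transition c c' z)) has_derivative (\<lambda>h. frechet_derivative (?f c') (at (snd c' p)) (jac c c' p h))) (at (snd c p))" .
  then have "(?f c has_derivative (\<lambda>h. frechet_derivative (?f c') (at (snd c' p)) (jac c c' p h))) (at (snd c p))"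
    by (rule has_derivative_transform_within_open[OF _ open_chart_image[OF c(1) chart_facts(1)[OF c(2)]]])
      (use c chart_inv[OF c(1)] chart_inv[OF c(2)] in \<open>auto simp: transition_def\<close>)
  from has_derivative_unique[OF d this]
  have e: "frechet_derivative (?f c) (at (snd c p)) h = frechet_derivative (?f c') (at (snd c' p)) (jac c c' p h)" for h
    by meson
  have b: "frechet_derivative (fun_coords f c) (at (snd c p, v)) (h, 0) = frechet_derivative (?f c) (at (snd c p)) h" for h
    using frechet_base[of "?f c" "(snd c p, v)"] differentiableI[OF d] unfolding fun_coords_def[abs_def] by simp
  have b': "frechet_derivative (fun_coords f c') (at (snd c' p, w)) (h, 0) = frechet_derivative (?f c') (at (snd c' p)) h" for h
    using frechet_base[of "?f c'" "(snd c' p, w)"] differentiableI[OF d'] unfolding fun_coords_def[abs_def] by simp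
  have df': "fun_coords f c' differentiable (at (snd c' p, w))"
  proof -
    have "(?f c' has_derivative frechet_derivative (?f c') (at (snd c' p))) (at (fst (snd c' p, w)))" using d' by simp
    from has_derivative_compose[OF has_derivative_fst[OF has_derivative_ident] this]
    show ?thesis unfolding fun_coords_def[abs_def] differentiable_def by blast
  qed
  have "frechet_derivative (fun_coords f c) (at (snd c p, v)) (h, 0)
     = (\<Sum>\<gamma>\<in>UNIV. jac c c' p h $ \<gamma> * dz \<gamma> (fun_coords f c') (snd c' p, w) + cnj (jac c c' p h $ \<gamma>) * dzbar \<gamma> (fun_coords f c') (snd c' p, w))" for h
    unfolding frechet_horizontal[OF df', symmetric] b b' e ..
  from wirtinger_change(1)[OF jac_linear(2)[OF c] this, of \<alpha>] show ?thesis
    by (simp add: dz_def[of \<alpha>] jac_comp_def)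
qed

lemma del_horizontal:
  assumes f: "smooth_fun A f"
  shows "horizontal_form A 1 0 (del f)"
  unfolding horizontal_form_def
proof (intro conjI ballI allI impI)
  fix c :: "('m, 'n) chart" and I J :: "'n list" assume c: "c \<in> A"
  interpret X: finsler_chart "img c" "gl c" by (rule finsler_chart[OF c])
  have o: "open (slit_coords c)" using X.open_S by (simp add: slit_coords_eq)
  show "del f c I J x = 0" if "length I \<noteq> 1 \<or> length J \<noteq> 0" for x
    using that by (auto simp: del_def)
  show "smooth_on (slit_coords c) (del f c I J)"
  proof (cases "length I = 1 \<and> length J = 0")
    case True
    then have "del f c I J = dz (I ! 0) (fun_coords f c)" by (auto simp: del_def fun_eq_iff)
    then show ?thesis using smooth_on_dz[OF o fun_coords_smooth(2)[OF f c]] by simp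
  next
    case False
    then have "del f c I J = (\<lambda>x. 0)" by (auto simp: del_def fun_eq_iff)
    then show ?thesis by (simp add: smooth_on_const[OF o])
  qed
  fix zv assume zv: "zv \<in> slit_coords c"
  have bh: "bihom (img c) 0 0 (fun_coords f c)" by (simp add: bihom_def fun_coords_def)
  have "bihom (img c) 0 0 (dz \<mu> (fun_coords f c))" for \<mu>
    by (rule bihom_dz(1)[OF X.open_U bh]) (use smooth_on_differentiable[OF fun_coords_smooth(2)[OF f c]] in \<open>simp add: slit_coords_eq\<close>)
  from bihomD[OF this] show "case zv of (z, v) \<Rightarrow> \<forall>\<zeta>. \<zeta> \<noteq> 0 \<longrightarrow> del f c I J (z, \<zeta> *s v) = del f c I J (z, v)"
    using zv by (auto simp: slit_coords_eq del_def)
next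
  fix c :: "('m, 'n) chart" and I J x \<sigma> \<tau>
  assume "\<sigma> permutes {..<1::nat}" "\<tau> permutes {..<0::nat}"
  then have "\<sigma> = id" "\<tau> = id" using permutes_1 by auto
  then show "del f c (permute_list \<sigma> I) (permute_list \<tau> J) x = of_int (sign \<sigma> * sign \<tau>) * del f c I J x"
    by simp
next
  fix c c' :: "('m, 'n) chart" and p and v :: "complex^'n" and I J :: "'n list"
  assume *: "c \<in> A" "c' \<in> A" "p \<in> fst c \<inter> fst c'" "v \<noteq> 0" "I \<in> lists_of 1" "J \<in> lists_of 0"
  have L: "length I = 1" "length J = 0" using *(5,6) by (auto simp: lists_of_def)
  show "del f c I J (snd c p, v) = (\<Sum>I'\<in>lists_of 1. \<Sum>J'\<in>lists_of 0.
         (\<Prod>i<1. jac_comp c c' p (I' ! i) (I ! i)) * (\<Prod>j<0. cnj (jac_comp c c' p (J' ! j) (J ! j))) *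
         del f c' I' J' (snd c' p, jac c c' p v))"
    unfolding sum_lists_of_1 sum_lists_of_0 using *(3) L
    by (simp add: del_def del_change[OF *(1,2) _ _ f, of p _ v "jac c c' p v"])
qed

end

section \<open>Partitions of unity on the projectivized tangent bundle\<close>

lemma norm_le_sum_components: "norm (v::complex^'n::finite) \<le> (\<Sum>k\<in>UNIV. cmod (v $ k))"
  unfolding norm_vec_def by (rule L2_set_le_sum) simp

context complex_manifold begin

text \<open>A cone function in a chart. Its support is compact and therefore closed in the Hausdorff space, so the
extension by zero is continuous.\<close>

lemma bump_exists:
  "\<exists>c r b. c \<in> A \<and> p \<in> fst c \<and> cball (snd c p) r \<subseteq> img c \<and> continuous_on UNIV b \<and> (\<forall>q. 0 \<le> (b q :: real)) \<and>
     0 < b p \<and> (\<forall>q. b q \<noteq> 0 \<longrightarrow> q \<in> fst c \<and> snd c q \<in> cball (snd c p) r)"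
proof -
  obtain c where c: "c \<in> A" "p \<in> fst c" using cover by blast
  obtain r where r: "0 < r" "cball (snd c p) r \<subseteq> img c"
    using chart_facts(2)[OF c(1)] c(2) open_contains_cball by blast
  define b where "b q = (if q \<in> fst c then max 0 (1 - dist (snd c q) (snd c p) / r) else 0)" for q
  let ?K = "chart_inv c ` cball (snd c p) r"
  have K: "closed ?K"
    using compact_continuous_image[OF continuous_on_subset[OF chart_continuous(2)[OF c(1)] r(2)]]
    by (intro compact_imp_closed) auto
  have supp: "q \<in> fst c \<and> snd c q \<in> cball (snd c p) r" if "b q \<noteq> 0" for q
    using that r(1) by (auto simp: b_def max_def dist_commute field_simps split: if_splits)
  have zero: "b q = 0" if "q \<in> - ?K" for q
  proof (rule ccontr)
    assume "b q \<noteq> 0"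
    then have "q = chart_inv c (snd c q)" "snd c q \<in> cball (snd c p) r" using supp chart_inv(1)[OF c(1)] by auto
    then show False using that by (metis ComplD imageI)
  qed
  have "continuous_on (fst c \<union> - ?K) b"
  proof (rule continuous_on_open_Un)
    show "continuous_on (fst c) b"
      by (rule continuous_on_cong[THEN iffD1, OF refl, of _ "\<lambda>q. max 0 (1 - dist (snd c q) (snd c p) / r)"])
        (use r(1) chart_continuous(1)[OF c(1)] in \<open>auto simp: b_def intro!: continuous_intros\<close>)
    show "continuous_on (- ?K) b"
      by (rule continuous_on_cong[THEN iffD1, OF refl, of _ "\<lambda>q. 0"]) (auto simp: zero)
  qed (use K chart_facts(1)[OF c(1)] in auto)
  moreover have "fst c \<union> - ?K = UNIV" using chart_inv(3)[OF c(1)] r(2) by auto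
  ultimately have "continuous_on UNIV b" by simp
  moreover have "0 < b p" using c(2) by (simp add: b_def)
  moreover have "0 \<le> b q" for q by (simp add: b_def)
  ultimately show ?thesis using c r(2) supp by blast
qed

text \<open>Finitely many bump functions have no common zero by compactness. Those that live in the same chart are added up,
since a partition of unity is indexed by charts.\<close>

lemma base_partition_exists:
  assumes "compact (UNIV :: 'm set)"
  obtains C and \<psi> :: "('m, 'n) chart \<Rightarrow> 'm \<Rightarrow> real" and K where
    "finite C" "C \<subseteq> A" "\<And>c. continuous_on UNIV (\<psi> c)" "\<And>c q. 0 \<le> \<psi> c q"
    "\<And>q. 0 < (\<Sum>c\<in>C. \<psi> c q)" "\<And>c. c \<in> C \<Longrightarrow> compact (K c) \<and> K c \<subseteq> img c"
    "\<And>c q. c \<in> C \<Longrightarrow> \<psi> c q \<noteq> 0 \<Longrightarrow> q \<in> fst c \<and> snd c q \<in> K c"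
proof -
  obtain ch r b where b: "\<And>p. ch p \<in> A" "\<And>p. p \<in> fst (ch p)" "\<And>p. cball (snd (ch p) p) (r p) \<subseteq> img (ch p)"
    "\<And>p. continuous_on UNIV (b p)" "\<And>p q. 0 \<le> (b p q :: real)" "\<And>p. 0 < b p p"
    "\<And>p q. b p q \<noteq> 0 \<Longrightarrow> q \<in> fst (ch p) \<and> snd (ch p) q \<in> cball (snd (ch p) p) (r p)"
    using bump_exists by metis
  have op: "open {q. 0 < b p q}" for p
    using b(4)[of p] by (intro open_Collect_less) auto
  have "UNIV \<subseteq> (\<Union>p\<in>UNIV. {q. 0 < b p q})" using b(6) by auto
  then obtain P where P: "finite P" "UNIV \<subseteq> (\<Union>p\<in>P. {q. 0 < b p q})"
    using compactE_image[OF assms, of UNIV "\<lambda>p. {q. 0 < b p q}"] op by auto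
  define \<psi> where "\<psi> c q = (\<Sum>p\<in>{p\<in>P. ch p = c}. b p q)" for c q
  define K where "K c = (\<Union>p\<in>{p\<in>P. ch p = c}. cball (snd c p) (r p))" for c
  show ?thesis
  proof (rule that[of "ch ` P" \<psi> K])
    show "finite (ch ` P)" "ch ` P \<subseteq> A" using P(1) b(1) by auto
    show "continuous_on UNIV (\<psi> c)" for c unfolding \<psi>_def by (intro continuous_on_sum b(4))
    show "0 \<le> \<psi> c q" for c q unfolding \<psi>_def by (intro sum_nonneg b(5))
    show "0 < (\<Sum>c\<in>ch ` P. \<psi> c q)" for q
    proof -
      obtain p where p: "p \<in> P" "0 < b p q" using P(2) by blast
      have "(\<Sum>c\<in>ch ` P. \<psi> c q) = (\<Sum>p\<in>P. b p q)"
        unfolding \<psi>_def by (rule sum.image_gen[OF P(1), symmetric])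
      also have "\<dots> > 0" using sum_pos2[of P p "\<lambda>p. b p q"] P(1) p b(5) by blast
      finally show ?thesis .
    qed
    show "compact (K c) \<and> K c \<subseteq> img c" for c
      unfolding K_def using P(1) b(3) by (auto intro!: compact_UN)
    show "q \<in> fst c \<and> snd c q \<in> K c" if "\<psi> c q \<noteq> 0" for c q
    proof -
      from that obtain p where "p \<in> P" "ch p = c" "b p q \<noteq> 0"
        unfolding \<psi>_def by (metis (mono_tags, lifting) mem_Collect_eq sum.neutral)
      then show ?thesis using b(7)[of p q] unfolding K_def by auto
    qed
  qed
qed

text \<open>Since \<open>norm v\<close> is at most \<open>n\<close> times the modulus of the largest component, this is positive for the index of that
component, while its support lies in the set where \<open>norm v \<le> 2n \<bar>v\<^sub>k\<bar>\<close>. It is homogeneous, so that the quotients of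
these functions by their sum descend to the projectivized bundle.\<close>

definition fibre_bump :: "'n \<Rightarrow> complex^'n \<Rightarrow> real" where
  "fibre_bump k v = max 0 (2 * real CARD('n) * cmod (v $ k) - norm v)"

lemma fibre_bump_nonneg: "0 \<le> fibre_bump k v"
  by (simp add: fibre_bump_def)

lemma norm_vec_scale: "norm (\<zeta> *s (v::complex^'n)) = cmod \<zeta> * norm v"
  unfolding norm_vec_def by (simp add: norm_mult L2_set_right_distrib)

lemma fibre_bump_scale: "fibre_bump k (\<zeta> *s v) = cmod \<zeta> * fibre_bump k v"
proof -
  have "2 * real CARD('n) * cmod ((\<zeta> *s v) $ k) - norm (\<zeta> *s v)
     = cmod \<zeta> * (2 * real CARD('n) * cmod (v $ k) - norm v)"
    by (simp add: norm_vec_scale norm_mult algebra_simps)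
  then show ?thesis by (simp add: fibre_bump_def max_mult_distrib_left)
qed

lemma fibre_bump_sum_pos:
  assumes "v \<noteq> 0"
  shows "0 < (\<Sum>k\<in>UNIV. fibre_bump k v)"
proof -
  have "\<exists>k. 0 < fibre_bump k v"
  proof (rule ccontr)
    assume "\<not> ?thesis"
    then have "2 * real CARD('n) * cmod (v $ k) \<le> norm v" for k
      unfolding fibre_bump_def by (metis diff_le_0_iff_le less_max_iff_disj linorder_not_less)
    then have "(\<Sum>k\<in>(UNIV::'n set). 2 * real CARD('n) * cmod (v $ k)) \<le> (\<Sum>k\<in>(UNIV::'n set). norm v)"
      by (intro sum_mono) auto
    then have "real CARD('n) * (2 * (\<Sum>k\<in>UNIV. cmod (v $ k))) \<le> real CARD('n) * norm v"
      by (simp add: sum_distrib_left algebra_simps)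
    then have "2 * (\<Sum>k\<in>UNIV. cmod (v $ k)) \<le> norm v" by simp
    with norm_le_sum_components[of v] have "norm v \<le> 0" by linarith
    then show False using assms by simp
  qed
  then obtain k where "0 < fibre_bump k v" ..
  then show ?thesis by (intro sum_pos2[of _ k]) (auto simp: fibre_bump_nonneg)
qed

lemma fibre_bump_continuous: "continuous_on S f \<Longrightarrow> continuous_on S (\<lambda>x. fibre_bump k (f x))"
  unfolding fibre_bump_def by (intro continuous_intros)

lemma slit_component_nonzero:
  assumes "(p, w) \<in> slit_bundle A" "c \<in> A" "p \<in> fst c"
  shows "w c \<noteq> 0"
proof
  assume 0: "w c = 0"
  have t: "(p, w) \<in> tangent_bundle A" "w \<noteq> (\<lambda>_. 0)" using assms(1) by (auto simp: slit_bundle_def)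
  have "tpoint A c (snd c p, w c) = (p, w)" by (rule tpoint_of_tangent[OF t(1) assms(2,3)])
  moreover have "jac c c' p 0 = 0" if "c' \<in> A" "p \<in> fst c'" for c'
    using linear_0[OF jac_linear(1)[OF assms(2) that(1) assms(3) that(2)]] .
  then have "snd (tpoint A c (snd c p, 0)) = (\<lambda>_. 0)"
    by (auto simp: tpoint_eq chart_inv(1)[OF assms(2,3)] fun_eq_iff)
  ultimately show False using 0 t(2) by simp
qed

lemma vec_axis_decompose: "(v::complex^'n) = (\<Sum>i\<in>UNIV. v $ i *s axis i 1)"
  by (simp add: vec_eq_iff axis_def if_distrib[of "\<lambda>x. _ * x"] cong: if_cong)

text \<open>By complex linearity it suffices that the derivatives of the transition map in the coordinate directions
are continuous.\<close>

lemma jac_continuous: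
  assumes c: "c \<in> A" "c' \<in> A"
  shows "continuous_on (snd c ` (fst c \<inter> fst c') \<times> UNIV) (\<lambda>x. jac c c' (chart_inv c (fst x)) (snd x))"
proof -
  let ?W = "snd c ` (fst c \<inter> fst c')"
  have s: "continuous_on ?W (\<lambda>z. frechet_derivative (transition c c') (at z) h)" for h
    by (rule smooth_on_continuous_on[OF smooth_on_derivative[OF transition_smooth[OF c]]])
  have "continuous_on (?W \<times> UNIV) (\<lambda>x. frechet_derivative (transition c c') (at (fst x)) h)" for h
    by (rule continuous_on_compose2[OF s]) (auto intro: continuous_intros)
  then have cc: "continuous_on (?W \<times> UNIV) (\<lambda>x. frechet_derivative (transition c c') (at (fst x)) h $ k)" for h k
    by (intro continuous_intros)
  have cv: "continuous_on (?W \<times> UNIV) (\<lambda>x. snd x $ i)" for i :: 'n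
    by (intro continuous_intros)
  have "continuous_on (?W \<times> UNIV) (\<lambda>x. \<chi> k. \<Sum>i\<in>UNIV. snd x $ i * frechet_derivative (transition c c') (at (fst x)) (axis i 1) $ k)"
    by (intro continuous_on_vec_lambda continuous_on_sum continuous_on_mult cc cv)
  then show ?thesis
  proof (rule continuous_on_cong[THEN iffD1, OF refl, rotated])
    fix x :: "'n coords" assume "x \<in> ?W \<times> UNIV"
    then obtain p where p: "p \<in> fst c" "p \<in> fst c'" "fst x = snd c p" by auto
    interpret linear "jac c c' p" by (rule jac_linear(1)[OF c p(1,2)])
    have "jac c c' p (snd x) = (\<Sum>i\<in>UNIV. snd x $ i *s jac c c' p (axis i 1))"
      by (subst vec_axis_decompose) (simp add: sum jac_linear(2)[OF c p(1,2)])
    then show "(\<chi> k. \<Sum>i\<in>UNIV. snd x $ i * frechet_derivative (transition c c') (at (fst x)) (axis i 1) $ k)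
       = jac c c' (chart_inv c (fst x)) (snd x)"
      by (simp add: vec_eq_iff p(3) chart_inv(1)[OF c(1) p(1)] jac_def)
  qed
qed

text \<open>The product of the normalized base functions and the normalized fibre functions. Outside the domain of the chart
\<open>c\<close>, where the components with respect to \<open>c\<close> are zero by convention, the base function of \<open>c\<close> vanishes.\<close>

lemma partition_of_unity_exists:
  assumes "compact (UNIV :: 'm set)"
  shows "\<exists>C \<theta>. partition_of_unity A C \<theta>"
proof -
  obtain C and \<psi> :: "('m, 'n) chart \<Rightarrow> 'm \<Rightarrow> real" and K where
    C: "finite C" "C \<subseteq> A" and \<psi>: "\<And>c. continuous_on UNIV (\<psi> c)" "\<And>c q. 0 \<le> \<psi> c q"
    "\<And>q. 0 < (\<Sum>c\<in>C. \<psi> c q)" and K: "\<And>c. c \<in> C \<Longrightarrow> compact (K c) \<and> K c \<subseteq> img c"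
    and supp: "\<And>c q. c \<in> C \<Longrightarrow> \<psi> c q \<noteq> 0 \<Longrightarrow> q \<in> fst c \<and> snd c q \<in> K c"
    by (rule base_partition_exists[OF assms]) blast
  define X where "X q = (\<Sum>c\<in>C. \<psi> c q)" for q
  define E where "E v = (\<Sum>k\<in>UNIV. fibre_bump k v)" for v
  define \<theta> where "\<theta> c k u = \<psi> c (fst u) / X (fst u) * (fibre_bump k (snd u c) / E (snd u c))"
    for c :: "('m, 'n) chart" and k and u :: "('m, 'n) tvec"
  have X: "0 < X q" for q using \<psi>(3) by (simp add: X_def)
  have E: "0 < E v" if "v \<noteq> 0" for v using fibre_bump_sum_pos[OF that] by (simp add: E_def)
  have Enn: "0 \<le> E v" for v unfolding E_def by (intro sum_nonneg fibre_bump_nonneg)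
  have Es: "E (\<zeta> *s v) = cmod \<zeta> * E v" for \<zeta> v by (simp add: E_def fibre_bump_scale sum_distrib_left)
  have "partition_of_unity A C \<theta>"
    unfolding partition_of_unity_def
  proof (intro conjI ballI allI impI)
    show "finite C" "C \<subseteq> A" by fact+
    fix u assume u: "u \<in> slit_bundle A"
    have "(\<Sum>k\<in>UNIV. \<theta> c k u) = \<psi> c (fst u) / X (fst u)" if c: "c \<in> C" for c
    proof (cases "\<psi> c (fst u) = 0")
      case False
      then have "snd u c \<noteq> 0" using slit_component_nonzero[of "fst u" "snd u" c] supp c u C by auto
      then have "(\<Sum>k\<in>UNIV. fibre_bump k (snd u c)) / E (snd u c) = 1" using E by (simp add: E_def less_imp_neq[THEN not_sym])
      then show ?thesis unfolding \<theta>_def by (simp add: sum_distrib_left[symmetric] sum_divide_distrib[symmetric])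
    qed (simp add: \<theta>_def)
    then have "(\<Sum>c\<in>C. \<Sum>k\<in>UNIV. \<theta> c k u) = (\<Sum>c\<in>C. \<psi> c (fst u) / X (fst u))" by simp
    also have "\<dots> = 1" using X[of "fst u"] by (simp add: sum_divide_distrib[symmetric] X_def[symmetric])
    finally show "(\<Sum>c\<in>C. \<Sum>k\<in>UNIV. \<theta> c k u) = 1" .
  next
    fix c k u assume "c \<in> C" "u \<in> slit_bundle A"
    show "0 \<le> \<theta> c k u"
      unfolding \<theta>_def using \<psi>(2) X[of "fst u"] Enn fibre_bump_nonneg by (simp add: less_imp_le)
    show "\<theta> c k (tscale \<zeta> u) = \<theta> c k u" if "\<zeta> \<noteq> 0" for \<zeta>
      unfolding \<theta>_def tscale_def using that by (simp add: Es fibre_bump_scale)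
  next
    fix c k c' assume c: "c \<in> C" and c': "c' \<in> A"
    have cA: "c \<in> A" using c C by blast
    let ?p = "\<lambda>x::'n coords. chart_inv c' (fst x)"
    let ?S1 = "snd c' ` (fst c' \<inter> fst c) \<times> (UNIV - {0::complex^'n})"
    let ?K' = "chart_inv c ` K c"
    let ?S2 = "snd c' ` (fst c' \<inter> - ?K') \<times> (UNIV - {0::complex^'n})"
    have K': "closed ?K'"
      using compact_continuous_image[OF continuous_on_subset[OF chart_continuous(2)[OF cA]]] K[OF c]
      by (intro compact_imp_closed) auto
    have cp: "continuous_on (slit_coords c') ?p"
      by (rule continuous_on_compose2[OF chart_continuous(2)[OF c']]) (auto simp: slit_coords_def intro: continuous_intros)
    have S: "slit_coords c' = ?S1 \<union> ?S2"
    proof -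
      have "?K' \<subseteq> fst c" using K[OF c] chart_inv(3)[OF cA] by auto
      then show ?thesis unfolding slit_coords_def by blast
    qed
    have cont_p: "continuous_on S' (\<lambda>x. \<phi> (?p x))" if "continuous_on UNIV \<phi>" "S' \<subseteq> slit_coords c'" for \<phi> :: "'m \<Rightarrow> real" and S'
      by (rule continuous_on_compose2[OF that(1) continuous_on_subset[OF cp that(2)]]) auto
    have "continuous_on (?S1 \<union> ?S2) (\<lambda>x. \<theta> c k (tpoint A c' x))"
    proof (rule continuous_on_open_Un)
      show "open ?S1" "open ?S2"
        using open_chart_image[OF c' chart_facts(1)[OF cA]] open_chart_image[OF c', of "- ?K'"] K' by (auto intro!: open_slit)
      let ?j = "\<lambda>x. jac c' c (?p x) (snd x)"
      have j: "continuous_on ?S1 ?j" by (rule continuous_on_subset[OF jac_continuous[OF c' cA]]) auto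
      have jn: "?j x \<noteq> 0" if "x \<in> ?S1" for x
        using that jac_nonzero[OF c' cA] chart_inv[OF c'] by auto
      have "continuous_on ?S1 (\<lambda>x. \<psi> c (?p x) / X (?p x) * (fibre_bump k (?j x) / E (?j x)))"
        unfolding E_def
      proof (intro continuous_intros cont_p \<psi>(1) fibre_bump_continuous j ballI)
        show "continuous_on UNIV X" unfolding X_def by (intro continuous_intros \<psi>(1))
        show "?S1 \<subseteq> slit_coords c'" "?S1 \<subseteq> slit_coords c'" using S by auto
        show "X (?p x) \<noteq> 0" for x using X[of "?p x"] by simp
        show "(\<Sum>k\<in>UNIV. fibre_bump k (?j x)) \<noteq> 0" if "x \<in> ?S1" for x using E[OF jn[OF that]] by (simp add: E_def)
      qed
      then show "continuous_on ?S1 (\<lambda>x. \<theta> c k (tpoint A c' x))"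
      proof (rule continuous_on_cong[THEN iffD1, OF refl, rotated])
        fix x assume "x \<in> ?S1"
        then have "?p x \<in> fst c" using chart_inv(1)[OF c'] by auto
        then show "\<psi> c (?p x) / X (?p x) * (fibre_bump k (?j x) / E (?j x)) = \<theta> c k (tpoint A c' x)"
          using cA by (cases x) (simp add: \<theta>_def tpoint_eq)
      qed
      show "continuous_on ?S2 (\<lambda>x. \<theta> c k (tpoint A c' x))"
      proof (rule continuous_on_cong[THEN iffD1, OF refl])
        show "continuous_on ?S2 (\<lambda>x. 0::real)" by simp
        fix x assume "x \<in> ?S2"
        then have "?p x \<notin> ?K'" using chart_inv(1)[OF c'] by auto
        then have "\<psi> c (?p x) = 0" using supp[OF c] chart_inv(1)[OF cA] by (metis imageI)
        then show "0 = \<theta> c k (tpoint A c' x)" by (simp add: \<theta>_def)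
      qed
    qed
    then show "continuous_on (slit_coords c') (\<lambda>x. \<theta> c k (tpoint A c' x))" using S by simp
  next
    fix c k assume c: "c \<in> C"
    show "\<exists>K R. compact K \<and> K \<subseteq> img c \<and>
           (\<forall>(p, w)\<in>slit_bundle A. \<theta> c k (p, w) \<noteq> 0 \<longrightarrow>
              p \<in> fst c \<and> snd c p \<in> K \<and> norm (w c) \<le> R * norm (w c $ k))"
    proof (intro exI conjI ballI)
      show "compact (K c)" "K c \<subseteq> img c" using K[OF c] by auto
      fix u assume "u \<in> slit_bundle A"
      show "case u of (p, w) \<Rightarrow> \<theta> c k (p, w) \<noteq> 0 \<longrightarrow>
              p \<in> fst c \<and> snd c p \<in> K c \<and> norm (w c) \<le> (2 * real CARD('n)) * norm (w c $ k)"
      proof (clarify)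
        fix p w assume nz: "\<theta> c k (p, w) \<noteq> 0"
        then have "\<psi> c p \<noteq> 0" "fibre_bump k (w c) \<noteq> 0" by (auto simp: \<theta>_def)
        then show "p \<in> fst c \<and> snd c p \<in> K c \<and> norm (w c) \<le> (2 * real CARD('n)) * norm (w c $ k)"
          using supp[OF c] by (auto simp: fibre_bump_def max_def split: if_splits)
      qed
    qed
  qed
  then show ?thesis by blast
qed

lemma chosen_partition:
  assumes "compact (UNIV :: 'm set)"
  shows "partition_of_unity A (fst (chosen_partition A)) (snd (chosen_partition A))"
  unfolding chosen_partition_def
  using someI_ex[of "\<lambda>P. partition_of_unity A (fst P) (snd P)"] partition_of_unity_exists[OF assms] by auto

end

section \<open>Integration in affine charts\<close>

lemma affv_measurable:
  "(\<lambda>x. (fst x, affv k (snd x))) \<in> borel_measurable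
     ((lborel :: (complex^'n::finite) measure) \<Otimes>\<^sub>M (\<Pi>\<^sub>M \<alpha> \<in> - {k}. lborel))"
    (is "_ \<in> borel_measurable ?M")
proof -
  have "(\<lambda>x. affv k (snd x) $ i) \<in> borel_measurable ?M" for i
  proof (cases "i = k")
    case False
    then have "(\<lambda>w. w i) \<in> measurable (\<Pi>\<^sub>M \<alpha> \<in> - {k}. lborel) (lborel :: complex measure)"
      by (intro measurable_component_singleton) auto
    from measurable_compose[OF measurable_snd this]
    show ?thesis using False by (simp add: affv_def)
  qed (simp add: affv_def)
  then have "(\<lambda>x. affv k (snd x) $ i \<bullet> b) \<in> borel_measurable ?M" for i b
    by (intro borel_measurable_inner) auto
  then have "\<forall>e\<in>Basis. (\<lambda>x. affv k (snd x) \<bullet> e) \<in> borel_measurable ?M"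
    by (auto simp: Basis_vec_def inner_axis)
  then have "(\<lambda>x. affv k (snd x)) \<in> borel_measurable ?M"
    by (rule borel_measurable_euclidean_space[THEN iffD2])
  moreover have "(\<lambda>x. fst x) \<in> borel_measurable ?M"
    using measurable_fst[of "lborel :: (complex^'n) measure" "\<Pi>\<^sub>M \<alpha> \<in> - {k}. lborel"] by simp
  ultimately show ?thesis by (intro borel_measurable_Pair)
qed

lemma affv_component: "affv k w $ k = 1" "affv k w \<noteq> 0"
proof -
  show "affv k w $ k = 1" by (simp add: affv_def)
  then show "affv k w \<noteq> 0" by (metis zero_index zero_neq_one)
qed

lemma affine_measure_box:
  fixes k :: "'n::finite"
  assumes "Z \<in> sets (lborel :: (complex^'n) measure)" "\<And>\<alpha>. W \<alpha> \<in> sets lborel"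
  shows "Z \<times> (\<Pi>\<^sub>E \<alpha> \<in> - {k}. W \<alpha>) \<in> sets (lborel \<Otimes>\<^sub>M (\<Pi>\<^sub>M \<alpha> \<in> - {k}. (lborel :: complex measure)))"
    and "emeasure (lborel \<Otimes>\<^sub>M (\<Pi>\<^sub>M \<alpha> \<in> - {k}. (lborel :: complex measure))) (Z \<times> (\<Pi>\<^sub>E \<alpha> \<in> - {k}. W \<alpha>))
      = emeasure lborel Z * (\<Prod>\<alpha>\<in>- {k}. emeasure lborel (W \<alpha>))"
proof -
  interpret P: product_sigma_finite "\<lambda>\<alpha>::'n. lborel :: complex measure" by standard
  interpret Q: finite_product_sigma_finite "\<lambda>\<alpha>::'n. lborel :: complex measure" "- {k}" by standard simp
  have W: "(\<Pi>\<^sub>E \<alpha> \<in> - {k}. W \<alpha>) \<in> sets (\<Pi>\<^sub>M \<alpha> \<in> - {k}. lborel)"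
    by (intro sets_PiM_I_finite assms) simp
  show "Z \<times> (\<Pi>\<^sub>E \<alpha> \<in> - {k}. W \<alpha>) \<in> sets (lborel \<Otimes>\<^sub>M (\<Pi>\<^sub>M \<alpha> \<in> - {k}. (lborel :: complex measure)))"
    by (intro pair_measureI assms W)
  show "emeasure (lborel \<Otimes>\<^sub>M (\<Pi>\<^sub>M \<alpha> \<in> - {k}. (lborel :: complex measure))) (Z \<times> (\<Pi>\<^sub>E \<alpha> \<in> - {k}. W \<alpha>))
      = emeasure lborel Z * (\<Prod>\<alpha>\<in>- {k}. emeasure lborel (W \<alpha>))"
    by (subst Q.emeasure_pair_measure_Times[OF assms(1) W]) (simp add: P.emeasure_PiM[of "- {k}" W, OF _ assms(2)])
qed

text \<open>The integrand is bounded, being continuous with support in a compact set of \<open>(z, v)\<close> with \<open>v\<^sub>k = 1\<close>, and it vanishes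
outside a product of bounded sets, which has finite measure.\<close>

lemma affine_integrable:
  fixes h :: "'n::finite coords \<Rightarrow> complex"
  assumes S: "open S" and h: "continuous_on S h" and K: "compact K"
    and KS: "\<And>z v. z \<in> K \<Longrightarrow> v \<noteq> 0 \<Longrightarrow> (z, v) \<in> S"
    and supp: "\<And>z v. (z, v) \<in> S \<Longrightarrow> v $ k = 1 \<Longrightarrow> h (z, v) \<noteq> 0 \<Longrightarrow> z \<in> K \<and> norm v \<le> R"
  shows "integrable (lborel \<Otimes>\<^sub>M (\<Pi>\<^sub>M \<alpha> \<in> - {k}. lborel))
    (\<lambda>x. indicator S (fst x, affv k (snd x)) *\<^sub>R h (fst x, affv k (snd x)))" (is "integrable ?M ?f")
proof -
  define N where "N = K \<times> (\<Pi>\<^sub>E \<alpha> \<in> - {k}. cball (0::complex) R)"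
  have Ks: "K \<in> sets lborel" using borel_compact[OF K] by simp
  have N: "N \<in> sets ?M" unfolding N_def by (rule affine_measure_box(1)[OF Ks]) simp
  have "emeasure ?M N = emeasure lborel K * (\<Prod>\<alpha>\<in>- {k}. emeasure lborel (cball (0::complex) R))"
    unfolding N_def by (rule affine_measure_box(2)[OF Ks]) simp
  also have "\<dots> < \<infinity>"
    using emeasure_compact_finite[OF K] emeasure_lborel_cball_finite[of "0::complex" R]
    by (auto simp: ennreal_mult_less_top power_less_top_ennreal)
  finally have Nf: "emeasure ?M N < \<infinity>" .
  let ?C = "K \<times> (cball 0 R \<inter> {v::complex^'n. v $ k = 1})"
  have "closed {v::complex^'n. v $ k = 1}" by (intro closed_Collect_eq continuous_intros)
  then have C: "compact ?C" using K by (intro compact_Times compact_Int_closed) auto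
  have "?C \<subseteq> S" using KS by (auto simp: vec_eq_iff) (metis zero_index zero_neq_one)
  then have "compact (h ` ?C)" using C h continuous_on_subset compact_continuous_image by blast
  then obtain B where B: "\<And>y. y \<in> h ` ?C \<Longrightarrow> norm y \<le> B" using compact_imp_bounded bounded_iff by metis
  have m: "?f \<in> borel_measurable ?M"
    using measurable_compose[OF affv_measurable borel_measurable_continuous_on_indicator[OF _ h]] S by simp
  have sp: "fst x \<in> K \<and> affv k (snd x) \<in> cball 0 R" if "?f x \<noteq> 0" for x
    using supp[of "fst x" "affv k (snd x)"] that affv_component by (auto simp: indicator_def split: if_splits)
  show ?thesis
  proof (rule integrableI_bounded_set[OF N m Nf])
    show "AE x in ?M. x \<in> N \<longrightarrow> norm (?f x) \<le> max B 0"
    proof (intro AE_I2 impI)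
      fix x
      show "norm (?f x) \<le> max B 0"
      proof (cases "?f x = 0")
        case False
        then have "(fst x, affv k (snd x)) \<in> ?C" using sp[of x] affv_component by auto
        then have "norm (h (fst x, affv k (snd x))) \<le> B" using B by blast
        then show ?thesis by (auto simp: indicator_def)
      qed auto
    qed
    show "AE x in ?M. x \<notin> N \<longrightarrow> ?f x = 0"
    proof (intro AE_I2 impI)
      fix x assume x: "x \<in> space ?M" "x \<notin> N"
      show "?f x = 0"
      proof (rule ccontr)
        assume nz: "?f x \<noteq> 0"
        have "cmod (snd x \<alpha>) \<le> R" if "\<alpha> \<noteq> k" for \<alpha>
        proof -
          have "cmod (affv k (snd x) $ \<alpha>) \<le> norm (affv k (snd x))" by (rule Finite_Cartesian_Product.norm_nth_le)
          then show ?thesis using sp[OF nz] that by (simp add: affv_def)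
        qed
        moreover have "snd x \<in> extensional (- {k})"
          using x(1) by (auto simp: space_pair_measure space_PiM PiE_def)
        ultimately have "x \<in> N" using sp[OF nz] unfolding N_def by (cases x) (auto simp: PiE_def)
        then show False using x(2) by simp
      qed
    qed
  qed
qed

lemma dist_affv: "dist (affv k w) (affv k w0) \<le> (\<Sum>\<alpha>\<in>- {k}. dist (w \<alpha>) (w0 \<alpha>))"
proof -
  have "dist (affv k w) (affv k w0) \<le> (\<Sum>\<alpha>\<in>UNIV. dist (affv k w $ \<alpha>) (affv k w0 $ \<alpha>))"
    unfolding dist_vec_def by (rule L2_set_le_sum) simp
  also have "\<dots> = (\<Sum>\<alpha>\<in>- {k}. dist (w \<alpha>) (w0 \<alpha>))"
    by (rule sum.mono_neutral_cong_right) (auto simp: affv_def)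
  finally show ?thesis .
qed

text \<open>A continuous nonnegative function that is positive at one point is positive on a neighbourhood; the latter contains
a product of balls, whose measure is positive.\<close>

lemma affine_integral_nonneg:
  fixes h :: "'n::finite coords \<Rightarrow> complex"
  assumes nn: "\<And>z v. (z, v) \<in> S \<Longrightarrow> v $ k = 1 \<Longrightarrow> 0 \<le> h (z, v)"
  defines "M \<equiv> lborel \<Otimes>\<^sub>M (\<Pi>\<^sub>M \<alpha> \<in> - {k}. lborel)"
  shows "0 \<le> (LINT x|M. indicator S (fst x, affv k (snd x)) *\<^sub>R h (fst x, affv k (snd x)))"
    and "open S \<Longrightarrow> continuous_on S h \<Longrightarrow> (z0, v0) \<in> S \<Longrightarrow> v0 $ k = 1 \<Longrightarrow> 0 < h (z0, v0) \<Longrightarrow>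
      integrable M (\<lambda>x. indicator S (fst x, affv k (snd x)) *\<^sub>R h (fst x, affv k (snd x))) \<Longrightarrow>
      0 < (LINT x|M. indicator S (fst x, affv k (snd x)) *\<^sub>R h (fst x, affv k (snd x)))"
proof -
  let ?f = "\<lambda>x. indicator S (fst x, affv k (snd x)) *\<^sub>R h (fst x, affv k (snd x))"
  define r where "r x = Re (?f x)" for x
  have fr: "?f = (\<lambda>x. of_real (r x))" and rnn: "0 \<le> r x" for x
  proof -
    have "0 \<le> ?f x" for x using nn[of "fst x" "affv k (snd x)"] affv_component by (auto simp: indicator_def)
    then show "?f = (\<lambda>x. of_real (r x))" "0 \<le> r x"
      by (auto simp: r_def less_eq_complex_def complex_eq_iff fun_eq_iff)
  qed
  have int: "(LINT x|M. ?f x) = of_real (LINT x|M. r x)" unfolding fr by simp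
  have ge: "0 \<le> (LINT x|M. r x)" by (rule Bochner_Integration.integral_nonneg) (rule rnn)
  then show "0 \<le> (LINT x|M. ?f x)" unfolding int by (simp add: less_eq_complex_def)
  assume S: "open S" and h: "continuous_on S h" and 0: "(z0, v0) \<in> S" "v0 $ k = 1" "0 < h (z0, v0)"
    and I: "integrable M ?f"
  have Ir: "integrable M r" using I unfolding fr by (simp add: complex_of_real_integrable_eq)
  have "(LINT x|M. r x) \<noteq> 0"
  proof
    assume "(LINT x|M. r x) = 0"
    then have ae: "AE x in M. r x = 0"
      using integral_nonneg_eq_0_iff_AE[OF Ir] rnn by auto
    have "open (S \<inter> (\<lambda>x. Re (h x)) -` {0<..})"
      by (rule continuous_open_preimage[OF _ S]) (auto intro!: continuous_intros h)
    moreover have "(z0, v0) \<in> S \<inter> (\<lambda>x. Re (h x)) -` {0<..}" using 0 by (auto simp: less_complex_def)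
    ultimately obtain d where d: "0 < d" "ball (z0, v0) d \<subseteq> S \<inter> (\<lambda>x. Re (h x)) -` {0<..}"
      using open_contains_ball by blast
    define w0 where "w0 \<alpha> = v0 $ \<alpha>" for \<alpha>
    have v0: "affv k w0 = v0" using 0(2) by (auto simp: affv_def w0_def vec_eq_iff)
    \<comment> \<open>A point of the box below differs from \<open>(z0, v0)\<close> by less than \<open>e\<close> in \<open>z\<close> and in each of the fewer than \<open>n\<close> components of \<open>w\<close>.\<close>
    define e where "e = d / (real CARD('n) + 1)"
    have e: "0 < e" using d(1) by (simp add: e_def)
    define N where "N = ball z0 e \<times> (\<Pi>\<^sub>E \<alpha> \<in> - {k}. ball (w0 \<alpha>) e)"
    have Ns: "N \<in> sets M" unfolding N_def M_def by (rule affine_measure_box(1)) auto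
    have Nm: "emeasure M N = emeasure lborel (ball z0 e) * (\<Prod>\<alpha>\<in>- {k}. emeasure lborel (ball (w0 \<alpha>) e))"
      unfolding N_def M_def by (rule affine_measure_box(2)) auto
    have "emeasure lborel (ball z0 e) \<noteq> 0" "emeasure lborel (ball (w0 \<alpha>) e) \<noteq> 0" for \<alpha>
      using e by (simp_all add: emeasure_ball unit_ball_vol_pos ennreal_eq_0_iff not_le zero_less_mult_iff)
    then have "emeasure M N \<noteq> 0" unfolding Nm by (simp add: prod_zero_iff)
    moreover have "r x \<noteq> 0" if "x \<in> N" for x
    proof -
      obtain z w where x: "x = (z, w)" "dist z0 z < e" "\<And>\<alpha>. \<alpha> \<noteq> k \<Longrightarrow> dist (w0 \<alpha>) (w \<alpha>) < e"
        using \<open>x \<in> N\<close> unfolding N_def by (auto simp: PiE_def Pi_def)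
      have "dist (z0, v0) (z, affv k w) \<le> dist z0 z + dist v0 (affv k w)"
        unfolding dist_Pair_Pair by (rule sqrt_sum_squares_le_sum) auto
      also have "dist v0 (affv k w) \<le> (\<Sum>\<alpha>\<in>- {k}. dist (w0 \<alpha>) (w \<alpha>))"
        using dist_affv[of k w0 w] by (simp add: v0)
      also have "\<dots> \<le> (\<Sum>\<alpha>\<in>- {k}. e)" by (intro sum_mono) (use x(3) in \<open>auto intro: less_imp_le\<close>)
      also have "\<dots> \<le> real CARD('n) * e"
        using e by (auto intro!: mult_right_mono card_mono)
      also have "dist z0 z + real CARD('n) * e < e + real CARD('n) * e" using x(2) by simp
      also have "\<dots> = e * (real CARD('n) + 1)" by (simp add: algebra_simps)
      also have "\<dots> = d" unfolding e_def by (simp add: add_nonneg_eq_0_iff)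
      finally have "(z, affv k w) \<in> ball (z0, v0) d" by simp
      then have "(z, affv k w) \<in> S" "0 < Re (h (z, affv k w))" using d(2) by auto
      then show ?thesis by (simp add: r_def x(1))
    qed
    then have "AE x in M. x \<notin> N" using ae by (auto elim: eventually_mono)
    then have "emeasure M N = 0" using Ns AE_iff_null_sets by (metis null_setsD1)
    ultimately show False by simp
  qed
  then show "0 < (LINT x|M. ?f x)" unfolding int using ge by (simp add: less_complex_def)
qed

section \<open>Integration over the projectivized tangent bundle\<close>

context finsler_manifold begin

text \<open>The integrand that the chart \<open>c\<close> and the affine coordinates with \<open>v\<^sub>k = 1\<close> contribute.\<close>

definition part_term where
  "part_term f c k x = indicator (img c) (fst x) *
     of_real (snd (chosen_partition A) c k (tpoint A c (fst x, affv k (snd x)))) *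
     (f c (fst x, affv k (snd x)) * vol (gl c) (fst x, affv k (snd x)) (aff_frame k))"

lemma PTM_int_vol_eq:
  "PTM_int_vol A F f = (\<Sum>c\<in>fst (chosen_partition A). \<Sum>k\<in>UNIV.
     (LINT x | (lborel \<Otimes>\<^sub>M (\<Pi>\<^sub>M \<alpha> \<in> - {k}. lborel)). part_term f c k x))"
  unfolding PTM_int_vol_def PTM_integral_def part_term_def by (simp add: Let_def case_prod_unfold)

context
  assumes compact: "compact (UNIV :: 'm set)"
begin

lemma part_facts:
  assumes "c \<in> fst (chosen_partition A)"
  shows "c \<in> A"
    "continuous_on (slit_coords c) (\<lambda>x. snd (chosen_partition A) c k (tpoint A c x))"
    "x \<in> slit_coords c \<Longrightarrow> 0 \<le> snd (chosen_partition A) c k (tpoint A c x)"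
    "\<exists>K R. compact K \<and> K \<subseteq> img c \<and> (\<forall>x\<in>slit_coords c. snd (chosen_partition A) c k (tpoint A c x) \<noteq> 0 \<longrightarrow>
       fst x \<in> K \<and> norm (snd x) \<le> R * norm (snd x $ k))"
proof -
  note P = chosen_partition[OF compact, unfolded partition_of_unity_def]
  show c: "c \<in> A" using P assms by blast
  show "continuous_on (slit_coords c) (\<lambda>x. snd (chosen_partition A) c k (tpoint A c x))"
    using P assms c by blast
  have sl: "tpoint A c x \<in> slit_bundle A" if "x \<in> slit_coords c" for x
    using that tpoint_in(2)[OF c] unfolding slit_coords_eq by (metis DiffE SigmaE singletonI)
  then show "x \<in> slit_coords c \<Longrightarrow> 0 \<le> snd (chosen_partition A) c k (tpoint A c x)"
    using P assms by blast
  obtain K R where KR: "compact K" "K \<subseteq> img c" "\<forall>(p, w)\<in>slit_bundle A. snd (chosen_partition A) c k (p, w) \<noteq> 0 \<longrightarrow>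
              p \<in> fst c \<and> snd c p \<in> K \<and> norm (w c) \<le> R * norm (w c $ k)"
    using P assms by blast
  have "fst x \<in> K \<and> norm (snd x) \<le> R * norm (snd x $ k)"
    if x: "x \<in> slit_coords c" "snd (chosen_partition A) c k (tpoint A c x) \<noteq> 0" for x
  proof -
    obtain z v where zv: "x = (z, v)" "z \<in> img c" using x(1) unfolding slit_coords_eq by auto
    define w where "w = snd (tpoint A c x)"
    have t: "tpoint A c x = (chart_inv c z, w)" by (simp add: w_def tpoint_eq zv)
    have "w c = v" using c chart_inv(3)[OF c zv(2)] jac_id[OF c chart_inv(3)[OF c zv(2)]] by (simp add: w_def tpoint_eq zv)
    then show ?thesis using KR(3) sl[OF x(1)] x(2) unfolding t using chart_inv(2)[OF c zv(2)] zv by auto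
  qed
  with KR show "\<exists>K R. compact K \<and> K \<subseteq> img c \<and> (\<forall>x\<in>slit_coords c. snd (chosen_partition A) c k (tpoint A c x) \<noteq> 0 \<longrightarrow>
       fst x \<in> K \<and> norm (snd x) \<le> R * norm (snd x $ k))" by blast
qed

definition weighted where
  "weighted f c k x = of_real (snd (chosen_partition A) c k (tpoint A c x)) * (f c x * vol (gl c) x (aff_frame k))"

lemma part_term_weighted:
  "part_term f c k x = indicator (slit_coords c) (fst x, affv k (snd x)) *\<^sub>R weighted f c k (fst x, affv k (snd x))"
  using affv_component(2)[of k "snd x"] by (auto simp: part_term_def weighted_def slit_coords_eq indicator_def)

lemma weighted_continuous:
  assumes "c \<in> fst (chosen_partition A)" "continuous_on (slit_coords c) (f c)"
  shows "continuous_on (slit_coords c) (weighted f c k)"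
proof -
  interpret X: finsler_chart "img c" "gl c" by (rule finsler_chart[OF part_facts(1)[OF assms(1)]])
  show ?thesis
    unfolding weighted_def[abs_def] using X.vol_continuous part_facts(2)[OF assms(1)]
    by (intro continuous_intros assms(2)) (auto simp: slit_coords_eq)
qed

lemma part_term_integrable:
  assumes c: "c \<in> fst (chosen_partition A)" and f: "continuous_on (slit_coords c) (f c)"
  shows "integrable (lborel \<Otimes>\<^sub>M (\<Pi>\<^sub>M \<alpha> \<in> - {k}. lborel)) (part_term f c k)"
proof -
  interpret X: finsler_chart "img c" "gl c" by (rule finsler_chart[OF part_facts(1)[OF c]])
  obtain K R where KR: "compact K" "K \<subseteq> img c"
    "\<forall>x\<in>slit_coords c. snd (chosen_partition A) c k (tpoint A c x) \<noteq> 0 \<longrightarrow>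
       fst x \<in> K \<and> norm (snd x) \<le> R * norm (snd x $ k)"
    using part_facts(4)[OF c] by blast
  show ?thesis
    unfolding part_term_weighted[abs_def]
  proof (rule affine_integrable[OF _ weighted_continuous[of _ f, OF c f] KR(1)])
    show "open (slit_coords c)" using X.open_S by (simp add: slit_coords_eq)
    show "(z, v) \<in> slit_coords c" if "z \<in> K" "v \<noteq> 0" for z v
      using that KR(2) by (auto simp: slit_coords_eq)
    show "z \<in> K \<and> norm v \<le> R" if "(z, v) \<in> slit_coords c" "v $ k = 1" "weighted f c k (z, v) \<noteq> 0" for z v
      using KR(3) that by (fastforce simp: weighted_def)
  qed
qed

lemma PTM_int_vol_linear:
  assumes "\<And>c. c \<in> A \<Longrightarrow> continuous_on (slit_coords c) (f c)" "\<And>c. c \<in> A \<Longrightarrow> continuous_on (slit_coords c) (g c)"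
  shows "PTM_int_vol A F (\<lambda>c x. f c x - a * g c x) = PTM_int_vol A F f - a * PTM_int_vol A F g"
proof -
  have "part_term (\<lambda>c x. f c x - a * g c x) c k = (\<lambda>x. part_term f c k x - a * part_term g c k x)" for c k
    by (auto simp: part_term_def algebra_simps)
  then show ?thesis
    unfolding PTM_int_vol_eq sum_distrib_left sum_subtractf[symmetric]
    by (intro sum.cong refl)
      (simp add: part_term_integrable assms part_facts(1))
qed

text \<open>The functions \<open>f c\<close> need not fit together to a function on the bundle: every chart contributes a nonnegative
amount, and a chart whose partition function is nonzero somewhere contributes a positive one.\<close>

lemma PTM_int_vol_pos:
  assumes "\<And>c. c \<in> A \<Longrightarrow> continuous_on (slit_coords c) (f c)"
    and pos: "\<And>c x. c \<in> A \<Longrightarrow> x \<in> slit_coords c \<Longrightarrow> 0 < f c x"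
  shows "0 < PTM_int_vol A F f"
proof -
  note P = chosen_partition[OF compact, unfolded partition_of_unity_def]
  let ?C = "fst (chosen_partition A)" and ?\<theta> = "snd (chosen_partition A)"
  have vp: "0 < vol (gl c) (z, v) (aff_frame k)" if "c \<in> A" "(z, v) \<in> slit_coords c" "v $ k = 1" for c z v k
  proof -
    interpret X: finsler_chart "img c" "gl c" by (rule finsler_chart[OF that(1)])
    show ?thesis using X.vol_pos[of "(z, v)" k] that by (auto simp: slit_coords_eq)
  qed
  have fv: "0 < f c (z, v) * vol (gl c) (z, v) (aff_frame k)" if "c \<in> A" "(z, v) \<in> slit_coords c" "v $ k = 1" for c z v k
    by (rule complex_mult_pos[OF pos[OF that(1,2)] vp[OF that]])
  have nn: "0 \<le> weighted f c k (z, v)" if "c \<in> ?C" "(z, v) \<in> slit_coords c" "v $ k = 1" for c z v k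
  proof -
    have "0 \<le> complex_of_real (?\<theta> c k (tpoint A c (z, v)))"
      using part_facts(3)[OF that(1,2)] by (simp add: less_eq_complex_def)
    then show ?thesis
      unfolding weighted_def using fv[OF part_facts(1)[OF that(1)] that(2,3)]
      by (rule mult_nonneg_nonneg[OF _ less_imp_le])
  qed
  have int_ge: "0 \<le> (LINT x | (lborel \<Otimes>\<^sub>M (\<Pi>\<^sub>M \<alpha> \<in> - {k}. lborel)). part_term f c k x)" if "c \<in> ?C" for c k
    unfolding part_term_weighted by (rule affine_integral_nonneg(1)) (rule nn[OF that])
  \<comment> \<open>An arbitrary point of the bundle. Some partition function is nonzero there, and rescaling the vector to \<open>v\<^sub>k = 1\<close> puts the point into the domain of integration.\<close>
  obtain c0 where c0: "c0 \<in> A" "(undefined :: 'm) \<in> fst c0" using cover by blast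
  define z0 where "z0 = snd c0 (undefined :: 'm)"
  have z0: "z0 \<in> img c0" using c0 by (simp add: z0_def)
  define u where "u = tpoint A c0 (z0, 1)"
  have one: "(1 :: complex^'n) \<noteq> 0" by (simp add: vec_eq_iff)
  have u: "u \<in> slit_bundle A" unfolding u_def by (rule tpoint_in(2)[OF c0(1) z0 one])
  have "(\<Sum>c\<in>?C. \<Sum>k\<in>UNIV. ?\<theta> c k u) = 1" using P u by blast
  then obtain c k where ck: "c \<in> ?C" "?\<theta> c k u \<noteq> 0"
    by (metis (no_types, lifting) sum.neutral zero_neq_one)
  have cA: "c \<in> A" by (rule part_facts(1)[OF ck(1)])
  obtain p w where pw: "u = (p, w)" by (cases u)
  have supp: "p \<in> fst c" "\<exists>R. norm (w c) \<le> R * norm (w c $ k)"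
  proof -
    obtain K R where "\<forall>(p, w)\<in>slit_bundle A. ?\<theta> c k (p, w) \<noteq> 0 \<longrightarrow>
              p \<in> fst c \<and> snd c p \<in> K \<and> norm (w c) \<le> R * norm (w c $ k)"
      using P ck(1) by meson
    then show "p \<in> fst c" "\<exists>R. norm (w c) \<le> R * norm (w c $ k)" using u ck(2) unfolding pw by auto
  qed
  have wn: "w c \<noteq> 0" using slit_component_nonzero[OF u[unfolded pw] cA supp(1)] .
  then have wk: "w c $ k \<noteq> 0" using supp(2) by auto
  define v where "v = inverse (w c $ k) *s w c"
  have v1: "v $ k = 1" using wk by (simp add: v_def)
  then have vn: "v \<noteq> 0" by (metis zero_index zero_neq_one)
  have tp: "tpoint A c (snd c p, v) = tscale (inverse (w c $ k)) u"
    unfolding v_def using tpoint_scale[OF cA, of "snd c p"] tpoint_of_tangent[of p w c] u cA supp(1)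
    unfolding pw slit_bundle_def by auto
  have "?\<theta> c k (tscale (inverse (w c $ k)) u) = ?\<theta> c k u"
    using P ck(1) u wk by (meson inverse_nonzero_iff_nonzero)
  then have \<theta>v: "?\<theta> c k (tpoint A c (snd c p, v)) \<noteq> 0" using ck(2) tp by simp
  have xs: "(snd c p, v) \<in> slit_coords c" using supp(1) vn by (auto simp: slit_coords_eq)
  have "0 < ?\<theta> c k (tpoint A c (snd c p, v))" using part_facts(3)[OF ck(1) xs, of k] \<theta>v by simp
  then have w0: "0 < weighted f c k (snd c p, v)"
    unfolding weighted_def by (intro complex_mult_pos fv[OF cA xs v1]) (simp add: less_complex_def)
  interpret X: finsler_chart "img c" "gl c" by (rule finsler_chart[OF cA])
  have "0 < (LINT x | (lborel \<Otimes>\<^sub>M (\<Pi>\<^sub>M \<alpha> \<in> - {k}. lborel)). part_term f c k x)"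
    unfolding part_term_weighted
  proof (rule affine_integral_nonneg(2)[OF nn[OF ck(1)] _ weighted_continuous[of _ f, OF ck(1) assms(1)[OF cA]] xs v1 w0])
    show "open (slit_coords c)" using X.open_S by (simp add: slit_coords_eq)
    show "integrable (lborel \<Otimes>\<^sub>M (\<Pi>\<^sub>M \<alpha> \<in> - {k}. lborel))
      (\<lambda>x. indicator (slit_coords c) (fst x, affv k (snd x)) *\<^sub>R weighted f c k (fst x, affv k (snd x)))"
      using part_term_integrable[of c f k, OF ck(1) assms(1)[OF cA]] unfolding part_term_weighted[abs_def] .
  qed
  then have "0 < (\<Sum>k\<in>UNIV. (LINT x | (lborel \<Otimes>\<^sub>M (\<Pi>\<^sub>M \<alpha> \<in> - {k}. lborel)). part_term f c k x))"
    by (intro sum_complex_pos[of _ k]) (auto intro: int_ge[OF ck(1)])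
  then show ?thesis
    unfolding PTM_int_vol_eq using P ck(1)
    by (intro sum_complex_pos[of _ c]) (auto intro!: sum_nonneg int_ge)
qed

end

lemma PTM_int_vol_cong:
  assumes "compact (UNIV :: 'm set)"
    and "\<And>c x k. c \<in> A \<Longrightarrow> x \<in> slit_coords c \<Longrightarrow>
      f c x * vol (Gloc A F c) x (aff_frame k) = f' c x * vol (Gloc A F' c) x (aff_frame k)"
  shows "PTM_int_vol A F f = PTM_int_vol A F' f'"
proof -
  let ?C = "fst (chosen_partition A)"
  have "indicator (img c) z * a * (f c (z, affv k w) * vol (Gloc A F c) (z, affv k w) (aff_frame k))
     = indicator (img c) z * a * (f' c (z, affv k w) * vol (Gloc A F' c) (z, affv k w) (aff_frame k))"
    if "c \<in> ?C" for c k z w and a :: complex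
  proof (cases "z \<in> img c")
    case True
    then have "(z, affv k w) \<in> slit_coords c" using affv_component(2)[of k w] by (simp add: slit_coords_eq)
    then show ?thesis using assms(2) part_facts(1)[OF assms(1) that] by simp
  qed simp
  note e = this
  show ?thesis
    unfolding PTM_int_vol_def PTM_integral_def Let_def case_prod_unfold
    by (intro sum.cong refl Bochner_Integration.integral_cong) (rule e)
qed

end

section \<open>Balanced metrics\<close>

lemma horizontal_form_degree:
  assumes "horizontal_form A p q \<phi>" "c \<in> A" "x \<in> slit_coords c" "length I \<noteq> p \<or> length J \<noteq> q"
  shows "\<phi> c I J x = 0"
  using conjunct1[OF assms(1)[unfolded horizontal_form_def]] assms(2-4) by blast

context finsler_manifold begin

abbreviation "laplacian f c \<equiv> finsler_chart.lap (gl c) (fun_coords f c)"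

lemma conformal_chart:
  assumes "smooth_fun A f" "c \<in> A"
  shows "conformal_chart (img c) (gl c) (\<lambda>z. f (chart_inv c z))"
proof -
  interpret finsler_chart "img c" "gl c" by (rule finsler_chart[OF assms(2)])
  show ?thesis by standard (use assms in \<open>simp add: smooth_fun_def\<close>)
qed

lemma laplacian_smooth:
  assumes "smooth_fun A f" "c \<in> A"
  shows "smooth_on (slit_coords c) (laplacian f c)"
proof -
  interpret finsler_chart "img c" "gl c" by (rule finsler_chart[OF assms(2)])
  show ?thesis using smooth_lap fun_coords_smooth(2)[OF assms] by (simp add: slit_coords_eq)
qed

text \<open>The form \<open>dbarH (del f)\<close> has the coefficients \<open>- f\<^sub>\<mu>\<^sub>\<nu>\<close>, with barred \<open>\<nu>\<close>, and \<open>omegaH\<close> the coefficients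
\<open>\<i> G\<^sub>\<mu>\<^sub>\<nu>\<close>. In their inner product one inverse matrix cancels against \<open>G\<^sub>\<mu>\<^sub>\<nu>\<close>.\<close>

lemma trace_del_bar_del:
  assumes f: "smooth_fun A f" and c: "c \<in> A" and x: "x \<in> slit_coords c"
  shows "pt_inner 1 1 (gl c) (dbarH A F (del f) c) (omegaH_hform A F c) x = \<i> * laplacian f c x"
proof -
  interpret X: conformal_chart "img c" "gl c" "\<lambda>z. f (chart_inv c z)"
    by (rule conformal_chart[OF f c])
  have rho: "X.rho = fun_coords f c" by (simp add: X.rho_def fun_coords_def fun_eq_iff)
  have x': "x \<in> X.S" using x by (simp add: slit_coords_eq)
  let ?h = "\<lambda>a b. dzbar b (dz a (fun_coords f c)) x"
  have d: "dbarH A F (del f) c [a] [b] x = - ?h a b" for a b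
  proof -
    have "del f c [a] [] = dz a (fun_coords f c)" by (simp add: del_def fun_eq_iff)
    then show ?thesis
      using X.deltabar_dz_rho[OF x', of b a] by (simp add: dbarH_def drop_nth_def rho)
  qed
  have o: "cnj (omegaH_hform A F c [a] [b] x) = - \<i> * Gm (gl c) b a x" for a b
    using X.Gm_hermitian[OF x'] by (simp add: omegaH_hform_def)
  have "pt_inner 1 1 (gl c) (dbarH A F (del f) c) (omegaH_hform A F c) x
     = (\<Sum>a\<in>UNIV. \<Sum>b\<in>UNIV. \<Sum>e\<in>UNIV. \<Sum>k\<in>UNIV.
          (- ?h a b) * Ginv (gl c) e a x * Ginv (gl c) b k x * (- \<i> * Gm (gl c) k e x))"
    unfolding pt_inner_def sum_lists_of_1 by (simp add: d o)
  also have "\<dots> = (\<Sum>a\<in>UNIV. \<Sum>b\<in>UNIV. \<i> * ?h a b *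
      (\<Sum>e\<in>UNIV. Ginv (gl c) e a x * (\<Sum>k\<in>UNIV. Ginv (gl c) b k x * Gm (gl c) k e x)))"
    by (simp add: sum_distrib_left mult_ac)
  also have "\<dots> = (\<Sum>a\<in>UNIV. \<Sum>b\<in>UNIV. \<i> * ?h a b * Ginv (gl c) b a x)"
    by (simp add: X.Ginv_left[OF x'])
  also have "\<dots> = \<i> * laplacian f c x"
    by (simp add: X.lap_def sum_distrib_left mult_ac)
  finally show ?thesis .
qed

text \<open>The two adjoints map \<open>omegaH\<close> to forms of the types \<open>(0, 1)\<close> and \<open>(1, 0)\<close>. Their sum vanishes, hence each of them
does. Adjointness turns the integral of the Laplacian into the inner product of \<open>\<partial>f\<close> with the second one.\<close>

lemma balanced_laplacian_integral:
  assumes bal: "balanced_finsler A F" and f: "smooth_fun A f"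
  shows "PTM_int_vol A F (laplacian f) = 0"
proof -
  have cpt: "compact (UNIV :: 'm set)" using bal unfolding balanced_finsler_def by blast
  obtain T Tbar where T: "formal_adjoint A F (0, 1) (1, 1) (dH A F) T"
    and Tb: "formal_adjoint A F (1, 0) (1, 1) (dbarH A F) Tbar"
    and sum0: "\<forall>c\<in>A. \<forall>I J. \<forall>x\<in>slit_coords c.
           T (omegaH_hform A F) c I J x + Tbar (omegaH_hform A F) c I J x = 0"
    using bal unfolding balanced_finsler_def by blast
  let ?\<omega> = "omegaH_hform A F"
  have "horizontal_form A 0 1 (T ?\<omega>)" "horizontal_form A 1 0 (Tbar ?\<omega>)"
    using T Tb omegaH_horizontal unfolding formal_adjoint_def by auto
  note deg = horizontal_form_degree[OF this(1)] horizontal_form_degree[OF this(2)]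
  have z: "Tbar ?\<omega> c I J x = 0" if "c \<in> A" "x \<in> slit_coords c" for c I J x
  proof (cases "length I = 1 \<and> length J = 0")
    case True
    then have "T ?\<omega> c I J x = 0" using deg(1)[OF that] by auto
    then show ?thesis using sum0 that by (metis add_0)
  qed (use deg(2)[OF that] in auto)
  have "PTM_int_vol A F (\<lambda>c x. \<i> * laplacian f c x) = L2_inner A F 1 1 (dbarH A F (del f)) ?\<omega>"
    unfolding L2_inner_def by (rule PTM_int_vol_cong[OF cpt]) (simp only: trace_del_bar_del[OF f])
  also have "\<dots> = L2_inner A F 1 0 (del f) (Tbar ?\<omega>)"
    using Tb del_horizontal[OF f] omegaH_horizontal unfolding formal_adjoint_def by auto
  also have "\<dots> = PTM_int_vol A F (\<lambda>c x. 0)"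
    unfolding L2_inner_def by (rule PTM_int_vol_cong[OF cpt]) (simp add: pt_inner_def z)
  also have "\<dots> = 0" by (simp add: PTM_int_vol_def PTM_integral_def Let_def case_prod_unfold)
  finally have 1: "PTM_int_vol A F (\<lambda>c x. \<i> * laplacian f c x) = 0" .
  \<comment> \<open>The difference has the form for which linearity was established.\<close>
  have "PTM_int_vol A F (\<lambda>c x. 0 - (- \<i>) * laplacian f c x) = PTM_int_vol A F (\<lambda>c x. 0) - (- \<i>) * PTM_int_vol A F (laplacian f)"
    by (rule PTM_int_vol_linear[OF cpt]) (auto intro: smooth_on_continuous_on laplacian_smooth[OF f])
  then show ?thesis using 1 \<open>PTM_int_vol A F (\<lambda>c x. 0) = 0\<close> by simp
qed

end

theorem theorem1p8:
  fixes A :: "('m::{t2_space,second_countable_topology}, 'n::finite) chart set"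
    and F :: "('m, 'n) tvec \<Rightarrow> real"
    and \<rho> :: "'m \<Rightarrow> real"
  assumes "CARD('n) \<ge> 2"
    and "balanced_finsler A F"
    and "\<forall>c\<in>A. \<forall>x\<in>slit_coords c. 0 < scal (Gloc A F c) x"
    and "smooth_fun A \<rho>"
  shows "0 < PTM_int_vol A (conformal \<rho> F) (\<lambda>c. scal (Gloc A (conformal \<rho> F) c))"
proof -
  interpret finsler_manifold A F
    using assms(2) unfolding balanced_finsler_def by unfold_locales blast+
  have cpt: "compact (UNIV :: 'm set)" using assms(2) unfolding balanced_finsler_def by blast
  define a where "a = real CARD('n) - 1"
  have a: "0 < a" using assms(1) by (simp add: a_def)
  define f where "f p = exp (a * \<rho> p)" for p
  have f: "smooth_fun A f"
    unfolding smooth_fun_def f_def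
  proof
    fix c assume c: "c \<in> A"
    have "smooth_on (img c) (\<lambda>z. \<rho> (chart_inv c z))" using assms(4) c unfolding smooth_fun_def by blast
    then show "smooth_on (img c) (\<lambda>z. exp (a * \<rho> (chart_inv c z)))"
      by (intro smooth_on_exp smooth_on_mult smooth_on_const chart_facts(2)[OF c])
  qed
  \<comment> \<open>The positive part of the conformally changed integrand. The rest is a multiple of the Laplacian of \<open>f\<close>.\<close>
  define P where "P c x = fun_coords f c x * (scal (gl c) x + of_nat CARD('n) * of_real a *
     conformal_chart.grad_sq (gl c) (\<lambda>z. \<rho> (chart_inv c z)) x)" for c x
  have loc: "scal (Gloc A (conformal \<rho> F) c) x * vol (Gloc A (conformal \<rho> F) c) x X
       = (P c x - of_real (CARD('n) / a) * laplacian f c x) * vol (gl c) x X"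
      "continuous_on (slit_coords c) (P c)" "0 < P c x"
    if c: "c \<in> A" and x: "x \<in> slit_coords c" for c x X
  proof -
    interpret X: conformal_chart "img c" "gl c" "\<lambda>z. \<rho> (chart_inv c z)"
      by (rule conformal_chart[OF assms(4) c])
    have x': "x \<in> X.S" using x by (simp add: slit_coords_eq)
    have conf: "Gloc A (conformal \<rho> F) c = X.conf_g"
      by (simp add: fun_eq_iff Gloc_def conformal_def X.conf_g_def power_mult_distrib exp_double[symmetric])
    have E: "X.exp_rho a = fun_coords f c" by (simp add: X.exp_rho_def fun_coords_def f_def fun_eq_iff)
    show "scal (Gloc A (conformal \<rho> F) c) x * vol (Gloc A (conformal \<rho> F) c) x X
       = (P c x - of_real (CARD('n) / a) * laplacian f c x) * vol (gl c) x X"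
      using X.scal_conformal[OF x' assms(1), folded a_def]
      unfolding conf X.vol_conf[OF x'] E P_def by (simp add: mult_ac)
    have "smooth_on (slit_coords c) (P c)"
      unfolding P_def[abs_def] using X.smooth_scal X.smooth_grad_sq X.open_S fun_coords_smooth(2)[OF f c]
      by (intro smooth_on_mult smooth_on_add smooth_on_const) (simp_all add: slit_coords_eq)
    then show "continuous_on (slit_coords c) (P c)" by (rule smooth_on_continuous_on)
    have "0 \<le> of_nat CARD('n) * complex_of_real a * X.grad_sq x"
      using a X.grad_sq_nonneg[OF x'] by (intro mult_nonneg_nonneg) (simp_all add: less_eq_complex_def)
    then have "0 < scal (gl c) x + of_nat CARD('n) * of_real a * X.grad_sq x"
      using assms(3) c x by (intro add_pos_nonneg) auto
    moreover have "0 < fun_coords f c x" by (simp add: fun_coords_def f_def less_complex_def)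
    ultimately show "0 < P c x" unfolding P_def by (intro complex_mult_pos)
  qed
  have cont: "continuous_on (slit_coords c) (P c)" if "c \<in> A" for c
  proof (cases "slit_coords c = {}")
    case False
    then show ?thesis using loc(2)[OF that] by blast
  qed simp
  have "PTM_int_vol A F (\<lambda>c x. P c x - of_real (CARD('n) / a) * laplacian f c x)
     = PTM_int_vol A (conformal \<rho> F) (\<lambda>c. scal (Gloc A (conformal \<rho> F) c))"
    by (rule PTM_int_vol_cong[OF cpt]) (simp only: loc(1))
  moreover have "PTM_int_vol A F (\<lambda>c x. P c x - of_real (CARD('n) / a) * laplacian f c x)
     = PTM_int_vol A F P - of_real (CARD('n) / a) * PTM_int_vol A F (laplacian f)"
    by (rule PTM_int_vol_linear[OF cpt cont]) (auto intro: smooth_on_continuous_on laplacian_smooth[OF f])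
  ultimately have "PTM_int_vol A (conformal \<rho> F) (\<lambda>c. scal (Gloc A (conformal \<rho> F) c)) = PTM_int_vol A F P"
    by (simp add: balanced_laplacian_integral[OF assms(2) f])
  also have "0 < PTM_int_vol A F P"
    by (rule PTM_int_vol_pos[OF cpt cont loc(3)])
  finally show ?thesis .
qed

end
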